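(* For all integers $s,t$ with $s\ge 4$ and $t>\min\left\{\frac{3}{2}s^2-\frac{21}{4}s+\frac{57}{8}+\frac{3}{8(2s-3)},\ (s-1)!\right\}$, the $3$-graph $K_{s,t}^{+}$ is bounded.
   Context: A $3$-graph is a collection of $3$-subsets (edges) of a finite vertex set. For a graph $F$, its expansion $F^{+}$ is the $3$-graph obtained by adding to each edge of $F$ a new vertex, distinct edges receiving distinct new vertices; $F$ is the core of $F^+$. $K_{s,t}$ is the complete bipartite graph with parts of sizes $s$ and $t$. For a $3$-graph $\mathcal{H}$, the degree of a vertex is the number of edges containing it, $\Delta(\mathcal{H})$ is the maximum degree, and $\mathrm{ex}(n,\mathcal{F})$ is the maximum number of edges in an $n$-vertex $3$-graph containing no copy of $\mathcal{F}$. A $3$-graph $\mathcal{F}$ is $(\alpha,\beta)$-bounded (for reals $\alpha,\beta>0$) if there exists $N_0$ such that every $3$-graph $\mathcal{H}$ on $n\ge N_0$ vertices with $\Delta(\mathcal{H})\ge \alpha\binom{n-1}{2}$ and $|\mathcal{H}|\ge (1-\beta)\,\mathrm{ex}(n,\mathcal{F})$ contains a copy of $\mathcal{F}$. $\mathcal{F}$ is bounded if it is $(\alpha,\beta)$-bounded for some constants $0<\alpha,\beta<1$. *)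

theory Defs
  imports Complex_Main
begin

datatype 'a hypergraph = Hypergraph (verts: "'a set") (edges: "'a set set")

definition uniform_graph :: "nat \<Rightarrow> 'a hypergraph \<Rightarrow> bool" where
  "uniform_graph r H \<longleftrightarrow> finite (verts H) \<and> (\<forall>e\<in>edges H. e \<subseteq> verts H \<and> card e = r)"

abbreviation graph :: "'a hypergraph \<Rightarrow> bool" where
  "graph \<equiv> uniform_graph 2"

abbreviation three_graph :: "'a hypergraph \<Rightarrow> bool" where
  "three_graph \<equiv> uniform_graph 3"

text \<open>Copies are not required to be induced.\<close>

definition contains_copy :: "'b hypergraph \<Rightarrow> 'a hypergraph \<Rightarrow> bool" where
  "contains_copy H F \<longleftrightarrow>
     (\<exists>f. inj_on f (verts F) \<and> f ` verts F \<subseteq> verts H \<and> (\<forall>e\<in>edges F. f ` e \<in> edges H))"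

definition complete_bipartite :: "nat \<Rightarrow> nat \<Rightarrow> (nat + nat) hypergraph" where
  "complete_bipartite s t =
     Hypergraph ({..<s} <+> {..<t}) {{Inl i, Inr j} | i j. i < s \<and> j < t}"

text \<open>The new vertex added to an edge \<open>e\<close> is \<open>Inr e\<close>, so that distinct edges receive
  distinct new vertices, none of which is a vertex \<open>Inl v\<close> of the core.\<close>

definition expansion :: "'a hypergraph \<Rightarrow> ('a + 'a set) hypergraph" where
  "expansion F = Hypergraph (verts F <+> edges F) ((\<lambda>e. insert (Inr e) (Inl ` e)) ` edges F)"

definition degree :: "'a hypergraph \<Rightarrow> 'a \<Rightarrow> nat" where
  "degree H v = card {e \<in> edges H. v \<in> e}"

definition max_degree :: "'a hypergraph \<Rightarrow> nat" where
  "max_degree H = Max (degree H ` verts H)"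

text \<open>Host 3-graphs have natural numbers as vertices; the vertex set may be any finite set of
  naturals, so every finite 3-graph is represented up to isomorphism.\<close>

definition ex :: "nat \<Rightarrow> 'a hypergraph \<Rightarrow> nat" where
  "ex n F = Max {card (edges H) | H :: nat hypergraph.
     three_graph H \<and> card (verts H) = n \<and> \<not> contains_copy H F}"

definition alpha_beta_bounded :: "real \<Rightarrow> real \<Rightarrow> 'a hypergraph \<Rightarrow> bool" where
  "alpha_beta_bounded \<alpha> \<beta> F \<longleftrightarrow>
     (\<exists>N0. \<forall>n\<ge>N0. \<forall>H :: nat hypergraph.
        three_graph H \<longrightarrow> card (verts H) = n \<longrightarrow>
        real (max_degree H) \<ge> \<alpha> * real ((n - 1) choose 2) \<longrightarrow>
        real (card (edges H)) \<ge> (1 - \<beta>) * real (ex n F) \<longrightarrow>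
        contains_copy H F)"

definition bounded_three_graph :: "'a hypergraph \<Rightarrow> bool" where
  "bounded_three_graph F \<longleftrightarrow>
     (\<exists>\<alpha> \<beta>. 0 < \<alpha> \<and> \<alpha> < 1 \<and> 0 < \<beta> \<and> \<beta> < 1 \<and> alpha_beta_bounded \<alpha> \<beta> F)"

lemma graph_complete_bipartite: "graph (complete_bipartite s t)"
  by (auto simp: uniform_graph_def complete_bipartite_def)

lemma three_graph_expansion:
  assumes "graph F"
  shows "three_graph (expansion F)"
proof -
  have fin: "finite (verts F)" and sub: "\<And>e. e \<in> edges F \<Longrightarrow> e \<subseteq> verts F \<and> card e = 2"
    using assms by (auto simp: uniform_graph_def)
  have "finite (edges F)"
    using fin sub by (meson PowI finite_Pow_iff finite_subset subsetI)
  moreover have "card (insert (Inr e) (Inl ` e)) = 3" if "e \<in> edges F" for e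
  proof -
    have "finite e" using sub[OF that] fin finite_subset by blast
    moreover have "card (Inl ` e) = 2" using sub[OF that] by (simp add: card_image)
    moreover have "Inr e \<notin> Inl ` e" by blast
    ultimately show ?thesis by simp
  qed
  ultimately show ?thesis
    using fin sub by (auto simp: uniform_graph_def expansion_def)
qed

end

theory Submission
  imports Defs "HOL-Library.Z2" "HOL-Algebra.Algebraic_Closure_Type" "HOL-Combinatorics.Permutations"
begin

text \<open>Let \<open>q = s - 1\<close>, \<open>F = K\<^sub>s\<^sub>,\<^sub>t\<^sup>+\<close> and \<open>f n = ex n F\<close>, and let \<open>H\<close> be \<open>F\<close>-free with at least \<open>3/4 f n\<close> edges and
  a vertex \<open>v\<close> of degree at least \<open>15/16 (n - 1 choose 2)\<close>. Delete few triples so that every remaining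
  shadow pair has large codegree; the shadow graph \<open>A\<close> is then \<open>K\<^sub>s\<^sub>,\<^sub>t\<close>-free. Let \<open>V'\<close> be the set of vertices
  having large codegree with \<open>v\<close>. Adding \<open>v\<close> to a set of \<open>q\<close> vertices shows that the latter has at most \<open>t\<close>
  common neighbours in \<open>V'\<close>, so the argument of Kovari, Sos and Turan bounds the number of triangles of \<open>A\<close> that
  touch \<open>V'\<close> by \<open>O(e(A) n\<^sup>1\<^sup>-\<^sup>2\<^sup>/\<^sup>q + n\<^sup>2)\<close>. The complement of \<open>V'\<close> has at most \<open>n/6\<close> vertices, and two disjoint
  copies of the triples inside it show that there are at most \<open>f n / 2\<close> of them. Hence
  \<open>f n = O(n\<^sup>2 + e(A) n\<^sup>1\<^sup>-\<^sup>2\<^sup>/\<^sup>q)\<close>, and it remains to bound \<open>f n\<close> from below.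

  For \<open>s = 4\<close> and \<open>t \<ge> 7\<close> the triangles of the projective norm graph over a field of characteristic 2 give
  \<open>f n = \<Omega>(n\<^sup>9\<^sup>/\<^sup>4)\<close>, while \<open>e(A) = O(n\<^sup>7\<^sup>/\<^sup>4)\<close>. For \<open>s \<ge> 5\<close> the minimum in the theorem is the quadratic
  function of \<open>s\<close>, and two cases are distinguished. If \<open>e(A)\<close> is small, the triangles of a random graph of
  suitable density, with one triangle family deleted for each copy of \<open>K\<^sub>s\<^sub>,\<^sub>t\<close>, are numerous enough. If \<open>e(A)\<close> is
  large, then \<open>A\<close> itself serves as a host: take two copies of one half of \<open>A\<close> and a third part that is glued to
  the first two by the other half and by a randomly permuted copy of it. A copy of \<open>K\<^sub>s\<^sub>,\<^sub>t\<close> in the resulting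
  tripartite graph must have a whole side in the third part and meet both other parts; such copies are rare
  and are destroyed after thinning the edges at the third part at random. The result has more than
  \<open>n\<^sup>\<kappa> e(A) n\<^sup>1\<^sup>-\<^sup>2\<^sup>/\<^sup>q\<close> triples.\<close>

text \<open>A lower bound of order \<open>n powr (3 - 3 / s)\<close>, the triangle count of a
  \<open>K_{s,t}\<close>-free graph of density \<open>n powr (- 1 / s)\<close>, would settle
  everything: the upper bound has exponent at most \<open>3 - 1 / s - 2 / q\<close>, and
  \<open>1 / q > 1 / s\<close>. Norm graphs give this only for \<open>t > (s - 1)!\<close>. For
  smaller \<open>t\<close> the obstacle is that the order of \<open>e(A)\<close> stays undetermined,
  so \<open>A\<close> is played off against itself.

  The two cases are separated by an exponent \<open>y\<close>: \<open>A\<close> is sparse if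
  \<open>e(A)\<close> is at most about \<open>n powr (2 - y)\<close>. With random density
  \<open>n powr (- \<mu>)\<close> the sparse case needs \<open>y > 3 * \<mu> - 2 / q\<close>; the
  dense case needs \<open>y\<close> small enough that the loss through bicliques stays below the
  gain in triangles. The quadratic condition on \<open>t\<close> makes the two ranges meet for
  \<open>s \<ge> 5\<close>.

  The permutation is essential. Without it, a set of fewer than \<open>s\<close> vertices could be
  used in both of the first two parts, and its common neighbourhood in the third may be large. After
  a random twist a biclique with \<open>t\<close> vertices in the third part needs \<open>t\<close>
  coincidences of \<open>\<pi>\<close>.\<close>

no_notation Polynomials.var (\<open>X\<index>\<close>)

section \<open>Expansions of complete bipartite graphs\<close>

text \<open>A copy is described by its edges alone and over any vertex type: \<open>P\<close> and
  \<open>Q\<close> list the two sides of the core, and \<open>R (i, j)\<close> is the vertex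
  expanding the core edge from \<open>P i\<close> to \<open>Q j\<close>. Constructions can then live
  on pairs, without the sum types of \<open>expansion\<close>.\<close>

definition kst_copy :: "nat \<Rightarrow> nat \<Rightarrow> 'a set set \<Rightarrow> bool" where
  "kst_copy s t E \<longleftrightarrow> (\<exists>P Q R. inj_on P {..<s} \<and> inj_on Q {..<t} \<and> inj_on R ({..<s} \<times> {..<t}) \<and>
     P ` {..<s} \<inter> Q ` {..<t} = {} \<and> (P ` {..<s} \<union> Q ` {..<t}) \<inter> R ` ({..<s} \<times> {..<t}) = {} \<and>
     (\<forall>i<s. \<forall>j<t. {P i, Q j, R (i, j)} \<in> E))"

lemma kst_copyE:
  assumes "kst_copy s t E"
  obtains P Q R where "inj_on P {..<s}" "inj_on Q {..<t}" "inj_on R ({..<s} \<times> {..<t})"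
    "P ` {..<s} \<inter> Q ` {..<t} = {}" "(P ` {..<s} \<union> Q ` {..<t}) \<inter> R ` ({..<s} \<times> {..<t}) = {}"
    "\<And>i j. i < s \<Longrightarrow> j < t \<Longrightarrow> {P i, Q j, R (i, j)} \<in> E"
proof -
  from assms obtain P Q R where "inj_on P {..<s} \<and> inj_on Q {..<t} \<and> inj_on R ({..<s} \<times> {..<t}) \<and>
     P ` {..<s} \<inter> Q ` {..<t} = {} \<and> (P ` {..<s} \<union> Q ` {..<t}) \<inter> R ` ({..<s} \<times> {..<t}) = {} \<and>
     (\<forall>i<s. \<forall>j<t. {P i, Q j, R (i, j)} \<in> E)"
    unfolding kst_copy_def by (elim exE)
  thus ?thesis by (intro that[of P Q R]) simp_all
qed

text \<open>Positivity of \<open>s\<close> and \<open>t\<close> puts every vertex of the expansion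
  into a triple, so the image of a copy lies in \<open>verts H\<close> as soon as its triples are
  edges of \<open>H\<close>.\<close>

lemma contains_copy_expansion_iff:
  assumes H: "three_graph H" and st: "s > 0" "t > 0"
  shows "contains_copy H (expansion (complete_bipartite s t)) \<longleftrightarrow> kst_copy s t (edges H)"
proof
  let ?F = "expansion (complete_bipartite s t)"
  have vF: "verts ?F = ({..<s} <+> {..<t}) <+> {{Inl i, Inr j} | i j. i < s \<and> j < t}"
    by (simp add: expansion_def complete_bipartite_def)
  have eF: "edges ?F = (\<lambda>e. insert (Inr e) (Inl ` e)) ` {{Inl i, Inr j} | i j. i < s \<and> j < t}"
    by (simp add: expansion_def complete_bipartite_def)
  {
    assume "contains_copy H ?F"
    then obtain f where f: "inj_on f (verts ?F)" "\<And>e. e \<in> edges ?F \<Longrightarrow> f ` e \<in> edges H"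
      by (auto simp: contains_copy_def)
    define P where "P i = f (Inl (Inl i))" for i
    define Q where "Q j = f (Inl (Inr j))" for j
    define R where "R p = f (Inr {Inl (fst p), Inr (snd p)})" for p
    have inV: "i < s \<Longrightarrow> Inl (Inl i) \<in> verts ?F" "j < t \<Longrightarrow> Inl (Inr j) \<in> verts ?F"
      "i < s \<Longrightarrow> j < t \<Longrightarrow> Inr {Inl i, Inr j} \<in> verts ?F" for i j
      by (auto simp: vF)
    have "inj_on P {..<s}" "inj_on Q {..<t}"
      using inj_onD[OF f(1)] inV by (auto simp: inj_on_def P_def Q_def)
    moreover have "inj_on R ({..<s} \<times> {..<t})"
    proof
      fix x y assume xy: "x \<in> {..<s} \<times> {..<t}" "y \<in> {..<s} \<times> {..<t}" "R x = R y"
      obtain i j k l where x: "x = (i, j)" and y: "y = (k, l)" by fastforce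
      have "Inr {Inl i, Inr j} = (Inr {Inl k, Inr l} :: (nat + nat) + (nat + nat) set)"
        using xy by (intro inj_onD[OF f(1)] inV) (auto simp: R_def x y)
      thus "x = y" by (auto simp: doubleton_eq_iff x y)
    qed
    moreover have ne: "P i \<noteq> Q j" "P i \<noteq> R (k, l)" "Q j \<noteq> R (k, l)" if "i < s" "j < t" "k < s" "l < t" for i j k l
      using inj_onD[OF f(1) _ inV(1) inV(2), of i j] inj_onD[OF f(1) _ inV(1) inV(3), of i k l]
        inj_onD[OF f(1) _ inV(2) inV(3), of j k l] that by (auto simp: P_def Q_def R_def)
    have "P ` {..<s} \<inter> Q ` {..<t} = {}" using ne(1)[OF _ _ st] by auto
    moreover have "(P ` {..<s} \<union> Q ` {..<t}) \<inter> R ` ({..<s} \<times> {..<t}) = {}"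
      using ne(2)[OF _ st(2), symmetric] ne(3)[OF st(1), symmetric] by auto
    moreover have "{P i, Q j, R (i, j)} \<in> edges H" if "i < s" "j < t" for i j
    proof -
      have "insert (Inr {Inl i, Inr j}) (Inl ` {Inl i, Inr j}) \<in> edges ?F" unfolding eF using that by blast
      from f(2)[OF this] show ?thesis by (simp add: P_def Q_def R_def insert_commute)
    qed
    ultimately show "kst_copy s t (edges H)"
      unfolding kst_copy_def by (intro exI[of _ P] exI[of _ Q] exI[of _ R]) simp
  }
  {
    assume "kst_copy s t (edges H)"
    then obtain P Q R where inj: "inj_on P {..<s}" "inj_on Q {..<t}" "inj_on R ({..<s} \<times> {..<t})"
      and disj: "P ` {..<s} \<inter> Q ` {..<t} = {}" "(P ` {..<s} \<union> Q ` {..<t}) \<inter> R ` ({..<s} \<times> {..<t}) = {}"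
      and E: "\<And>i j. i < s \<Longrightarrow> j < t \<Longrightarrow> {P i, Q j, R (i, j)} \<in> edges H"
      by (rule kst_copyE) (rule that; assumption)
    define f where "f x = (case x of Inl (Inl i) \<Rightarrow> P i | Inl (Inr j) \<Rightarrow> Q j
       | Inr e \<Rightarrow> R (THE p. e = {Inl (fst p), Inr (snd p)}))" for x :: "(nat + nat) + (nat + nat) set"
    have the: "(THE p. {Inl i, Inr j} = {Inl (fst p), Inr (snd p)}) = (i, j)" for i j :: nat
      by (rule the_equality) (auto simp: doubleton_eq_iff)
    have f: "f (Inl (Inl i)) = P i" "f (Inl (Inr j)) = Q j" "f (Inr {Inl i, Inr j}) = R (i, j)" for i j
      by (simp_all add: f_def the)
    have "inj_on f (verts ?F)"
    proof
      fix x y assume xy: "x \<in> verts ?F" "y \<in> verts ?F" "f x = f y"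
      have cases: "(\<exists>i<s. z = Inl (Inl i)) \<or> (\<exists>j<t. z = Inl (Inr j)) \<or> (\<exists>i<s. \<exists>j<t. z = Inr {Inl i, Inr j})"
        if "z \<in> verts ?F" for z using that unfolding vF by auto
      have ne: "P i \<noteq> Q j" "P i \<noteq> R (k, l)" "Q j \<noteq> R (k, l)" if "i < s" "j < t" "k < s" "l < t" for i j k l
        using disj that by blast+
      have injs: "i < s \<Longrightarrow> k < s \<Longrightarrow> P i = P k \<Longrightarrow> i = k" "j < t \<Longrightarrow> l < t \<Longrightarrow> Q j = Q l \<Longrightarrow> j = l"
        "i < s \<Longrightarrow> j < t \<Longrightarrow> k < s \<Longrightarrow> l < t \<Longrightarrow> R (i, j) = R (k, l) \<Longrightarrow> i = k \<and> j = l" for i j k l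
        using inj by (auto simp: inj_on_def)
      have three: W if "\<And>i. i < s \<Longrightarrow> z = Inl (Inl i) \<Longrightarrow> W" "\<And>j. j < t \<Longrightarrow> z = Inl (Inr j) \<Longrightarrow> W"
        "\<And>i j. i < s \<Longrightarrow> j < t \<Longrightarrow> z = Inr {Inl i, Inr j} \<Longrightarrow> W" "z \<in> verts ?F" for z W
        using cases[OF that(4)] that(1-3) by blast
      show "x = y"
      proof (rule three[OF _ _ _ xy(1)])
        fix xi assume x: "xi < s" "x = Inl (Inl xi)"
        show "x = y"
        proof (rule three[OF _ _ _ xy(2)])
          fix yi assume y: "yi < s" "y = Inl (Inl yi)"
          show "x = y" using injs(1)[OF x(1) y(1)] xy(3) unfolding x y f by blast
        next
          fix yj assume y: "yj < t" "y = Inl (Inr yj)"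
          show "x = y" using ne(1)[OF x(1) y(1) st] xy(3) unfolding x y f by blast
        next
          fix yi yj assume y: "yi < s" "yj < t" "y = Inr {Inl yi, Inr yj}"
          show "x = y" using ne(2)[OF x(1) st(2) y(1,2)] xy(3) unfolding x y f by blast
        qed
      next
        fix xj assume x: "xj < t" "x = Inl (Inr xj)"
        show "x = y"
        proof (rule three[OF _ _ _ xy(2)])
          fix yi assume y: "yi < s" "y = Inl (Inl yi)"
          show "x = y" using ne(1)[OF y(1) x(1) st] xy(3) unfolding x y f by metis
        next
          fix yj assume y: "yj < t" "y = Inl (Inr yj)"
          show "x = y" using injs(2)[OF x(1) y(1)] xy(3) unfolding x y f by blast
        next
          fix yi yj assume y: "yi < s" "yj < t" "y = Inr {Inl yi, Inr yj}"
          show "x = y" using ne(3)[OF st(1) x(1) y(1,2)] xy(3) unfolding x y f by blast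
        qed
      next
        fix xi xj assume x: "xi < s" "xj < t" "x = Inr {Inl xi, Inr xj}"
        show "x = y"
        proof (rule three[OF _ _ _ xy(2)])
          fix yi assume y: "yi < s" "y = Inl (Inl yi)"
          show "x = y" using ne(2)[OF y(1) st(2) x(1,2)] xy(3) unfolding x y f by metis
        next
          fix yj assume y: "yj < t" "y = Inl (Inr yj)"
          show "x = y" using ne(3)[OF st(1) y(1) x(1,2)] xy(3) unfolding x y f by metis
        next
          fix yi yj assume y: "yi < s" "yj < t" "y = Inr {Inl yi, Inr yj}"
          show "x = y" using injs(3)[OF x(1,2) y(1,2)] xy(3) unfolding x y f by blast
        qed
      qed
    qed
    moreover have "f ` e \<in> edges H" if e: "e \<in> edges ?F" for e
    proof -
      obtain i j where "i < s" "j < t" "e = insert (Inr {Inl i, Inr j}) (Inl ` {Inl i, Inr j})"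
        using e unfolding eF by auto
      thus ?thesis using E[of i j] by (simp add: f insert_commute)
    qed
    moreover have "f ` verts ?F \<subseteq> verts H"
    proof -
      have sub: "e \<subseteq> verts H" if "e \<in> edges H" for e using H that by (auto simp: uniform_graph_def)
      have "P i \<in> verts H \<and> Q j \<in> verts H \<and> R (i, j) \<in> verts H" if "i < s" "j < t" for i j
        using sub[OF E[OF that]] by simp
      thus ?thesis unfolding vF using st by (auto simp: f)
    qed
    ultimately show "contains_copy H ?F" unfolding contains_copy_def by blast
  }
qed

text \<open>Disjointness of \<open>S\<close> and \<open>T\<close> comes from the irreflexivity of
  the relations to which this is applied.\<close>

definition kst_free :: "nat \<Rightarrow> nat \<Rightarrow> ('a \<Rightarrow> 'a \<Rightarrow> bool) \<Rightarrow> bool" where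
  "kst_free s t A \<longleftrightarrow> (\<forall>S T. finite S \<longrightarrow> finite T \<longrightarrow> card S = s \<longrightarrow> card T = t \<longrightarrow> \<not> (\<forall>x\<in>S. \<forall>y\<in>T. A x y))"

lemma kst_free_imp_not_kst_copy:
  assumes "kst_free s t A" "\<And>e x y. e \<in> E \<Longrightarrow> x \<in> e \<Longrightarrow> y \<in> e \<Longrightarrow> x \<noteq> y \<Longrightarrow> A x y"
  shows "\<not> kst_copy s t E"
proof
  assume "kst_copy s t E"
  then obtain P Q R where inj: "inj_on P {..<s}" "inj_on Q {..<t}"
    and disj: "P ` {..<s} \<inter> Q ` {..<t} = {}"
    and E: "\<And>i j. i < s \<Longrightarrow> j < t \<Longrightarrow> {P i, Q j, R (i, j)} \<in> E"
    by (rule kst_copyE) (rule that; assumption)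
  have "\<forall>x\<in>P ` {..<s}. \<forall>y\<in>Q ` {..<t}. A x y"
  proof safe
    fix i j assume "i < s" "j < t"
    moreover have "P i \<noteq> Q j" using disj calculation by blast
    ultimately show "A (P i) (Q j)" using assms(2)[OF E[of i j]] by simp
  qed
  moreover have "card (P ` {..<s}) = s" "card (Q ` {..<t}) = t" using inj by (simp_all add: card_image)
  ultimately show False using assms(1) unfolding kst_free_def by (meson finite_imageI finite_lessThan)
qed

text \<open>Greedy choice: when \<open>i\<close> is treated, the values already used together with
  \<open>Z\<close> are fewer than the elements of \<open>C i\<close>.\<close>

lemma distinct_representatives:
  assumes "finite I" "finite Z" "\<And>i. i \<in> I \<Longrightarrow> card I + card Z \<le> card (C i)"
  shows "\<exists>R. inj_on R I \<and> (\<forall>i\<in>I. R i \<in> C i - Z)"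
  using assms
proof (induction I rule: finite_induct)
  case (insert i I)
  then obtain R where R: "inj_on R I" "\<forall>i\<in>I. R i \<in> C i - Z" by fastforce
  have "card (R ` I \<union> Z) \<le> card I + card Z"
    by (meson add_mono card_Un_le card_image_le insert.hyps(1) le_trans order_refl)
  also have "\<dots> < card (C i)" using insert.prems(2)[of i] insert.hyps by simp
  finally have "\<not> C i \<subseteq> R ` I \<union> Z"
    using card_mono[of "R ` I \<union> Z" "C i"] insert by fastforce
  then obtain z where z: "z \<in> C i" "z \<notin> R ` I" "z \<notin> Z" by blast
  have "inj_on (R(i := z)) (insert i I)" "\<forall>j\<in>insert i I. (R(i := z)) j \<in> C j - Z"
    using R z insert.hyps by (auto simp: inj_on_def)
  thus ?case by blast
qed auto

text \<open>The bound \<open>s * t + (s + t)\<close> is what the greedy choice asks for: the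
  \<open>s * t\<close> expanding vertices have to be distinct and to avoid the \<open>s + t\<close>
  core vertices. It returns as \<open>K\<close> in the cleaning of the host.\<close>

lemma kst_copyI:
  assumes fin: "finite S" "finite T" and card: "card S = s" "card T = t" and disj: "S \<inter> T = {}"
    and ext: "\<And>x y. x \<in> S \<Longrightarrow> y \<in> T \<Longrightarrow> s * t + (s + t) \<le> card {z. {x, y, z} \<in> E}"
  shows "kst_copy s t E"
proof -
  obtain P where P: "bij_betw P {..<s} S"
    using ex_bij_betw_nat_finite[OF fin(1)] card by (metis atLeast0LessThan)
  obtain Q where Q: "bij_betw Q {..<t} T"
    using ex_bij_betw_nat_finite[OF fin(2)] card by (metis atLeast0LessThan)
  have PQ: "P ` {..<s} = S" "Q ` {..<t} = T" "inj_on P {..<s}" "inj_on Q {..<t}"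
    using P Q by (auto simp: bij_betw_def)
  have "\<exists>R. inj_on R ({..<s} \<times> {..<t}) \<and> (\<forall>p\<in>{..<s} \<times> {..<t}. R p \<in> {z. {P (fst p), Q (snd p), z} \<in> E} - (S \<union> T))"
  proof (rule distinct_representatives)
    fix p assume "p \<in> {..<s} \<times> {..<t}"
    hence "P (fst p) \<in> S" "Q (snd p) \<in> T" using PQ by auto
    from ext[OF this] show "card ({..<s} \<times> {..<t}) + card (S \<union> T) \<le> card {z. {P (fst p), Q (snd p), z} \<in> E}"
      using card_Un_disjoint[OF fin disj] card by (simp add: card_cartesian_product)
  qed (use fin in auto)
  then obtain R where R: "inj_on R ({..<s} \<times> {..<t})"
    "\<And>p. p \<in> {..<s} \<times> {..<t} \<Longrightarrow> R p \<in> {z. {P (fst p), Q (snd p), z} \<in> E} - (S \<union> T)" by blast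
  have "(S \<union> T) \<inter> R ` ({..<s} \<times> {..<t}) = {}" using R(2) by blast
  moreover have "{P i, Q j, R (i, j)} \<in> E" if "i < s" "j < t" for i j using R(2)[of "(i, j)"] that by simp
  ultimately show ?thesis
    unfolding kst_copy_def using PQ R(1) disj by (intro exI[of _ P] exI[of _ Q] exI[of _ R]) simp
qed

section \<open>Transfer of families to hosts on the natural numbers\<close>

lemma kst_copy_image:
  assumes g: "inj_on g (\<Union>E)" and st: "s > 0" "t > 0" and copy: "kst_copy s t ((`) g ` E)"
  shows "kst_copy s t E"
proof -
  obtain P Q R where inj: "inj_on P {..<s}" "inj_on Q {..<t}" "inj_on R ({..<s} \<times> {..<t})"
    and disj: "P ` {..<s} \<inter> Q ` {..<t} = {}" "(P ` {..<s} \<union> Q ` {..<t}) \<inter> R ` ({..<s} \<times> {..<t}) = {}"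
    and E: "\<And>i j. i < s \<Longrightarrow> j < t \<Longrightarrow> {P i, Q j, R (i, j)} \<in> (`) g ` E"
    using copy by (rule kst_copyE) (rule that; assumption)
  define h where "h = inv_into (\<Union>E) g"
  have img: "P i \<in> g ` \<Union>E" "Q j \<in> g ` \<Union>E" "R (i, j) \<in> g ` \<Union>E" if ij: "i < s" "j < t" for i j
  proof -
    obtain e where e: "e \<in> E" "{P i, Q j, R (i, j)} = g ` e" using E[OF ij] by blast
    have "g ` e \<subseteq> g ` \<Union>E" using e(1) by blast
    thus "P i \<in> g ` \<Union>E" "Q j \<in> g ` \<Union>E" "R (i, j) \<in> g ` \<Union>E" using e(2) by blast+
  qed
  have hinj: "h x = h y \<Longrightarrow> x = y" if "x \<in> g ` \<Union>E" "y \<in> g ` \<Union>E" for x y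
    using that unfolding h_def by (metis inv_into_injective)
  have ne: "P i \<noteq> Q j" "P i \<noteq> R (k, l)" "Q j \<noteq> R (k, l)" if "i < s" "j < t" "k < s" "l < t" for i j k l
    using disj that by blast+
  have hne: "h (P i) \<noteq> h (Q j)" "h (P i) \<noteq> h (R (k, l))" "h (Q j) \<noteq> h (R (k, l))"
    if "i < s" "j < t" "k < s" "l < t" for i j k l
    using ne[OF that] hinj[OF img(1)[OF that(1,2)] img(2)[OF that(1,2)]]
      hinj[OF img(1)[OF that(1,2)] img(3)[OF that(3,4)]] hinj[OF img(2)[OF that(1,2)] img(3)[OF that(3,4)]] by blast+
  have "inj_on (h \<circ> P) {..<s}" "inj_on (h \<circ> Q) {..<t}" "inj_on (h \<circ> R) ({..<s} \<times> {..<t})"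
    using inj hinj[OF img(1) img(1), OF _ st(2) _ st(2)] hinj[OF img(2) img(2), OF st(1) _ st(1)] hinj[OF img(3) img(3)]
    by (auto simp: inj_on_def)
  moreover have "(h \<circ> P) ` {..<s} \<inter> (h \<circ> Q) ` {..<t} = {}"
    using hne st by auto
  moreover have "((h \<circ> P) ` {..<s} \<union> (h \<circ> Q) ` {..<t}) \<inter> (h \<circ> R) ` ({..<s} \<times> {..<t}) = {}"
  proof -
    have "h (R (k, l)) \<noteq> h (P i)" if "i < s" "k < s" "l < t" for i k l
      using hne(2)[OF that(1) st(2) that(2,3)] by simp
    moreover have "h (R (k, l)) \<noteq> h (Q j)" if "j < t" "k < s" "l < t" for j k l
      using hne(3)[OF st(1) that(1) that(2,3)] by simp
    ultimately show ?thesis by auto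
  qed
  moreover have "{(h \<circ> P) i, (h \<circ> Q) j, (h \<circ> R) (i, j)} \<in> E" if ij: "i < s" "j < t" for i j
  proof -
    obtain e where e: "e \<in> E" "{P i, Q j, R (i, j)} = g ` e" using E[OF ij] by blast
    have "h ` {P i, Q j, R (i, j)} = e"
      unfolding e(2) h_def using inv_into_image_cancel[OF g] e(1) by blast
    thus ?thesis using e(1) by simp
  qed
  ultimately show ?thesis
    unfolding kst_copy_def by (intro exI[of _ "h \<circ> P"] exI[of _ "h \<circ> Q"] exI[of _ "h \<circ> R"]) simp
qed

text \<open>The entry point of every lower bound for \<open>ex\<close>: a family over any type is
  carried into \<open>{..<n}\<close> by an injection, and the remaining numbers become isolated
  vertices.\<close>

lemma card_le_ex:
  fixes E :: "'a set set"
  assumes fin: "finite (\<Union>E)" and E: "\<And>e. e \<in> E \<Longrightarrow> card e = 3" and n: "card (\<Union>E) \<le> n"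
    and st: "s > 0" "t > 0" and free: "\<not> kst_copy s t E"
  shows "card E \<le> ex n (expansion (complete_bipartite s t))"
proof -
  let ?F = "expansion (complete_bipartite s t)"
  obtain g0 where g0: "bij_betw g0 (\<Union>E) {0..<card (\<Union>E)}" using ex_bij_betw_finite_nat[OF fin] by blast
  define g where "g = g0"
  have g: "inj_on g (\<Union>E)" "g ` \<Union>E \<subseteq> {..<n}" using g0 n by (auto simp: bij_betw_def g_def)
  define H where "H = Hypergraph {..<n} ((`) g ` E)"
  have injE: "inj_on ((`) g) E"
    by (rule inj_on_subset[OF inj_on_image_Pow[OF g(1)]]) auto
  have H: "three_graph H"
    unfolding uniform_graph_def H_def
  proof (clarsimp, intro conjI)
    fix e assume e: "e \<in> E"
    show "g ` e \<subseteq> {..<n}" using g(2) e by blast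
    have "inj_on g e" using g(1) e by (meson Union_upper inj_on_subset)
    thus "card (g ` e) = 3" using E[OF e] by (simp add: card_image)
  qed
  have "\<not> contains_copy H ?F"
    using kst_copy_image[OF g(1) st] free unfolding contains_copy_expansion_iff[OF H st] by (auto simp: H_def)
  hence "card (edges H) \<in> {card (edges H) | H :: nat hypergraph. three_graph H \<and> card (verts H) = n \<and> \<not> contains_copy H ?F}"
    (is "_ \<in> ?M") using H by (intro CollectI exI[of _ H]) (simp add: H_def)
  moreover have "finite ?M"
  proof (rule finite_subset)
    \<comment> \<open>\<open>ex\<close> is a \<open>Max\<close>, which bounds its members only over
      a finite set; counting all subsets of the vertex set is enough for that.\<close>
    show "?M \<subseteq> {..2 ^ n}"
    proof safe
      fix H :: "nat hypergraph" assume H: "three_graph H" "n = card (verts H)"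
      hence "edges H \<subseteq> Pow (verts H)" "finite (Pow (verts H))" by (auto simp: uniform_graph_def)
      from card_mono[OF this(2,1)] show "card (edges H) \<le> 2 ^ card (verts H)"
        using H by (simp add: card_Pow uniform_graph_def)
    qed
  qed simp
  ultimately have "card (edges H) \<le> ex n ?F" unfolding ex_def by (intro Max_ge)
  thus ?thesis by (simp add: H_def card_image[OF injE])
qed

text \<open>The core is connected and each expanding vertex shares a triple with it, so a copy in
  the union of two tagged copies of \<open>E\<close> lies in one of them, the one with the tag of
  \<open>P 0\<close>.\<close>

lemma two_card_le_ex:
  fixes E :: "'a set set"
  assumes fin: "finite (\<Union>E)" and E: "\<And>e. e \<in> E \<Longrightarrow> card e = 3" and n: "2 * card (\<Union>E) \<le> n"
    and st: "s > 0" "t > 0" and free: "\<not> kst_copy s t E"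
  shows "2 * card E \<le> ex n (expansion (complete_bipartite s t))"
proof -
  define X where "X b = (`) (Pair b) ` E" for b :: bool
  have inj: "inj_on (Pair b) A" for b :: bool and A :: "'a set" by (simp add: inj_on_def)
  have UX: "\<Union>(X b) = Pair b ` \<Union>E" for b by (auto simp: X_def)
  have cX: "card (X b) = card E" for b
    unfolding X_def by (rule card_image, rule inj_on_subset[OF inj_on_image_Pow[OF inj[of b UNIV]]]) auto
  have cU: "card (\<Union>(X b)) = card (\<Union>E)" for b unfolding UX by (rule card_image[OF inj])
  have finE: "finite E" using fin by (rule finite_UnionD)
  have disj: "X True \<inter> X False = {}"
  proof -
    have False if "e \<in> E" "e' \<in> E" "Pair True ` e = Pair False ` e'" for e e'
    proof -
      have "e \<noteq> {}" using E[OF that(1)] by auto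
      then obtain x where "x \<in> e" by blast
      hence "(True, x) \<in> Pair False ` e'" using that(3) by blast
      thus False by auto
    qed
    thus ?thesis unfolding X_def by blast
  qed
  have "card (X True \<union> X False) \<le> ex n (expansion (complete_bipartite s t))"
  proof (rule card_le_ex)
    show "finite (\<Union>(X True \<union> X False))" by (simp add: UX fin)
    show "card e = 3" if "e \<in> X True \<union> X False" for e
      using that E card_image[OF inj] by (auto simp: X_def)
    have "card (\<Union>(X True \<union> X False)) \<le> card (\<Union>(X True)) + card (\<Union>(X False))"
      unfolding Union_Un_distrib by (rule card_Un_le)
    thus "card (\<Union>(X True \<union> X False)) \<le> n" using n by (simp add: cU)
    show "\<not> kst_copy s t (X True \<union> X False)"
    proof
      assume "kst_copy s t (X True \<union> X False)"
      then obtain P Q R where inj': "inj_on P {..<s}" "inj_on Q {..<t}" "inj_on R ({..<s} \<times> {..<t})"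
        and disj': "P ` {..<s} \<inter> Q ` {..<t} = {}" "(P ` {..<s} \<union> Q ` {..<t}) \<inter> R ` ({..<s} \<times> {..<t}) = {}"
        and ed: "\<And>i j. i < s \<Longrightarrow> j < t \<Longrightarrow> {P i, Q j, R (i, j)} \<in> X True \<union> X False"
        by (rule kst_copyE) (rule that; assumption)
      have same: "fst (P i) = fst (Q j)" if ij: "i < s" "j < t" for i j
      proof -
        obtain b' where "{P i, Q j, R (i, j)} \<in> X b'" using ed[OF ij] by blast
        then obtain e where e: "{P i, Q j, R (i, j)} = Pair b' ` e" by (auto simp: X_def)
        have "P i \<in> Pair b' ` e" "Q j \<in> Pair b' ` e" unfolding e[symmetric] by simp_all
        thus ?thesis by auto
      qed
      define b where "b = fst (P 0)"
      have b: "fst (P i) = b" if "i < s" for i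
        using same[OF that st(2)] same[OF st] by (simp add: b_def)
      have "{P i, Q j, R (i, j)} \<in> X b" if ij: "i < s" "j < t" for i j
      proof -
        obtain b' where b': "{P i, Q j, R (i, j)} \<in> X b'" using ed[OF ij] by blast
        then obtain e where "{P i, Q j, R (i, j)} = Pair b' ` e" by (auto simp: X_def)
        hence "fst (P i) = b'" by (metis fst_conv image_iff insertI1)
        thus ?thesis using b' b[OF ij(1)] by simp
      qed
      hence "kst_copy s t (X b)"
        unfolding kst_copy_def using inj' disj' by (intro exI[of _ P] exI[of _ Q] exI[of _ R]) simp
      hence "kst_copy s t E" unfolding X_def by (rule kst_copy_image[OF inj st])
      thus False using free by simp
    qed
  qed (use st in auto)
  moreover have "card (X True \<union> X False) = 2 * card E"
    using finE by (subst card_Un_disjoint) (auto simp: disj cX, auto simp: X_def)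
  ultimately show ?thesis by simp
qed

section \<open>Counting in graphs without complete bipartite subgraphs\<close>

lemma sum_binomial_double_count:
  fixes X :: "'a set" and Y :: "'b set"
  assumes "finite X" "finite Y"
  shows "(\<Sum>x\<in>X. card {y\<in>Y. R x y} choose k) = (\<Sum>S | S \<subseteq> Y \<and> card S = k. card {x\<in>X. \<forall>y\<in>S. R x y})"
proof -
  have "(\<Sum>x\<in>X. card {y\<in>Y. R x y} choose k) = (\<Sum>x\<in>X. card {S. S \<subseteq> {y\<in>Y. R x y} \<and> card S = k})"
    using assms by (intro sum.cong refl) (simp add: n_subsets)
  also have "\<dots> = (\<Sum>x\<in>X. card {S \<in> {S. S \<subseteq> Y \<and> card S = k}. \<forall>y\<in>S. R x y})"
    by (intro sum.cong refl arg_cong[of _ _ card]) auto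
  also have "\<dots> = (\<Sum>S | S \<subseteq> Y \<and> card S = k. card {x\<in>X. \<forall>y\<in>S. R x y})"
    by (rule sum_multicount_gen) (use assms in auto)
  finally show ?thesis .
qed

lemma binomial_le_power: "n choose k \<le> n ^ k"
proof (cases "k \<le> n")
  case True
  thus ?thesis by (rule binomial_le_pow)
qed (simp add: binomial_eq_0)

text \<open>The Kovari-Sos-Turan count with a cut-off in place of convexity: a degree
  \<open>d\<close> is at most \<open>\<theta>\<close>, or else
  \<open>d = d ^ k / d ^ (k - 1)\<close> is at most
  \<open>k ^ k * (d choose k) / \<theta> ^ (k - 1)\<close>, and the binomials are double counted. A
  free \<open>\<theta>\<close> lets each application balance the two terms.\<close>

lemma kst_threshold:
  fixes X :: "'a set" and Y :: "'b set" and \<theta> :: real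
  assumes fin: "finite X" "finite Y" and k: "k > 0"
    and common: "\<And>S. S \<subseteq> Y \<Longrightarrow> card S = k \<Longrightarrow> card {x\<in>X. \<forall>y\<in>S. R x y} \<le> t"
    and \<theta>: "\<theta> \<ge> k"
  shows "(\<Sum>x\<in>X. real (card {y\<in>Y. R x y})) \<le> card X * \<theta> + t * k ^ k * real (card Y) ^ k / \<theta> ^ (k - 1)"
proof -
  let ?d = "\<lambda>x. card {y\<in>Y. R x y}"
  have \<theta>0: "\<theta> > 0" using k \<theta> by linarith
  have each: "real (?d x) \<le> \<theta> + k ^ k * real (?d x choose k) / \<theta> ^ (k - 1)" for x
  proof (cases "real (?d x) \<le> \<theta>")
    case True
    moreover have "0 \<le> k ^ k * real (?d x choose k) / \<theta> ^ (k - 1)" using \<theta>0 by simp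
    ultimately show ?thesis by linarith
  next
    case False
    define d where "d = real (?d x)"
    have d: "d > \<theta>" "k \<le> ?d x" using False \<theta> by (auto simp: d_def)
    have "d * \<theta> ^ (k - 1) \<le> d * d ^ (k - 1)" using d(1) \<theta>0 by (intro mult_left_mono power_mono) auto
    also have "\<dots> = d ^ k" using k by (cases k) simp_all
    also have "\<dots> = k ^ k * (d / k) ^ k" using k by (simp add: power_divide)
    also have "\<dots> \<le> k ^ k * real (?d x choose k)"
      unfolding d_def using binomial_ge_n_over_k_pow_k[OF d(2), where 'a = real] by (intro mult_left_mono) auto
    finally have "d \<le> k ^ k * real (?d x choose k) / \<theta> ^ (k - 1)" using \<theta>0 by (simp add: field_simps)
    thus ?thesis using \<theta>0 unfolding d_def by linarith
  qed
  have "(\<Sum>S | S \<subseteq> Y \<and> card S = k. card {x\<in>X. \<forall>y\<in>S. R x y}) \<le> card {S. S \<subseteq> Y \<and> card S = k} * t"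
    using sum_bounded_above[of "{S. S \<subseteq> Y \<and> card S = k}" "\<lambda>S. card {x\<in>X. \<forall>y\<in>S. R x y}" t] common by simp
  also have "\<dots> \<le> card Y ^ k * t" using fin by (simp add: n_subsets binomial_le_power)
  finally have bin: "(\<Sum>x\<in>X. ?d x choose k) \<le> card Y ^ k * t" by (simp only: sum_binomial_double_count[OF fin])
  have "(\<Sum>x\<in>X. real (?d x)) \<le> (\<Sum>x\<in>X. \<theta> + k ^ k * real (?d x choose k) / \<theta> ^ (k - 1))"
    by (rule sum_mono) (rule each)
  also have "\<dots> = card X * \<theta> + k ^ k * real (\<Sum>x\<in>X. ?d x choose k) / \<theta> ^ (k - 1)"
    by (simp add: sum.distrib sum_distrib_left sum_divide_distrib)
  also have "\<dots> \<le> card X * \<theta> + k ^ k * real (card Y ^ k * t) / \<theta> ^ (k - 1)"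
    using bin \<theta>0 by (intro add_left_mono divide_right_mono mult_left_mono of_nat_mono) auto
  finally show ?thesis by (simp add: mult_ac)
qed

text \<open>Here and below \<open>r\<close> stands for the \<open>k\<close>-th root of the order \<open>n\<close> of the graph, so that
  \<open>r ^ k / r\<close> is \<open>n\<close> to the power \<open>1 - 1 / k\<close>.\<close>

lemma kst_bound:
  fixes X :: "'a set" and Y :: "'b set" and r :: real
  assumes fin: "finite X" "finite Y" and k: "k > 0"
    and common: "\<And>S. S \<subseteq> Y \<Longrightarrow> card S = k \<Longrightarrow> card {x\<in>X. \<forall>y\<in>S. R x y} \<le> t"
    and r: "r > 0" and X: "real (card X) \<le> r ^ k"
  shows "(\<Sum>x\<in>X. real (card {y\<in>Y. R x y})) \<le> k * r ^ k + (1 + t * k ^ k) * card Y * (r ^ k / r)"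
proof -
  define y where "y = real (card Y)"
  \<comment> \<open>\<open>y / r\<close> balances the two terms when \<open>card X\<close> is about
    \<open>r ^ k\<close>; the maximum secures \<open>\<theta> \<ge> k\<close>.\<close>
  define \<theta> where "\<theta> = max (real k) (y / r)"
  have y: "y \<ge> 0" by (simp add: y_def)
  have \<theta>: "\<theta> \<ge> k" "\<theta> > 0" "\<theta> \<le> k + y / r" using k y r by (auto simp: \<theta>_def)
  have yr: "y / \<theta> \<le> r" using \<theta>(2) r by (simp add: \<theta>_def field_simps max_def split: if_splits)
  have rk: "r ^ k / r = r ^ (k - 1)" using k r by (cases k) auto
  have "card X * \<theta> \<le> r ^ k * (k + y / r)" using X \<theta> r by (intro mult_mono) auto
  also have "\<dots> = k * r ^ k + y * (r ^ k / r)" by (simp add: algebra_simps)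
  finally have 1: "card X * \<theta> \<le> k * r ^ k + y * (r ^ k / r)" .
  have "y ^ k / \<theta> ^ (k - 1) = y * (y / \<theta>) ^ (k - 1)" using k by (cases k) (simp_all add: power_divide)
  also have "\<dots> \<le> y * r ^ (k - 1)" using y \<theta> yr by (intro mult_left_mono power_mono) auto
  finally have "y ^ k / \<theta> ^ (k - 1) \<le> y * (r ^ k / r)" using rk by simp
  hence "real (t * k ^ k) * (y ^ k / \<theta> ^ (k - 1)) \<le> real (t * k ^ k) * (y * (r ^ k / r))"
    by (rule mult_left_mono) simp
  hence 2: "real t * real (k ^ k) * y ^ k / \<theta> ^ (k - 1) \<le> t * k ^ k * y * (r ^ k / r)"
    by (simp only: times_divide_eq_right mult.assoc of_nat_mult)
  show ?thesis
    using kst_threshold[OF fin k common \<theta>(1)] 1 2 unfolding y_def by (simp add: algebra_simps)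
qed

text \<open>Triangles are sorted by \<open>y\<close>. A set of \<open>q - 1\<close> neighbours of
  \<open>y\<close>, together with \<open>y\<close> itself, has at most \<open>t\<close> common
  neighbours in \<open>V'\<close>, so \<open>kst_threshold\<close> with exponent
  \<open>q - 1\<close> applies inside the neighbourhood of \<open>y\<close>. This suffices as long
  as \<open>b y\<close>, the number of neighbours of \<open>y\<close> in \<open>V'\<close>, is of
  order \<open>N / r\<close>. The vertices \<open>y\<close> with larger \<open>b y\<close> have
  total \<open>b\<close> only linear in \<open>N\<close>, and the trivial bound
  \<open>b y * N\<close> adds a multiple of \<open>N\<^sup>2\<close>.\<close>

lemma triangles_touching_bound:
  fixes V V' :: "'a set" and r :: real
  assumes fin: "finite V" and V': "V' \<subseteq> V" and q: "q \<ge> 2"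
    and sym: "\<And>x y. A x y \<Longrightarrow> A y x" and irr: "\<And>x. \<not> A x x"
    and common: "\<And>S. S \<subseteq> V \<Longrightarrow> card S = q \<Longrightarrow> card {x\<in>V'. \<forall>y\<in>S. A x y} \<le> t"
    and r: "r > 0" and n: "real (card V) \<le> r ^ q"
  defines "C \<equiv> 2 * (1 + real t * real q ^ q) + real t * real q ^ q"
  shows "(\<Sum>y\<in>V. \<Sum>x\<in>{x\<in>V'. A x y}. real (card {z\<in>{z\<in>V. A y z}. A x z}))
    \<le> C * (\<Sum>y\<in>V. real (card {z\<in>V. A y z})) * (r ^ q / r\<^sup>2) + 3 * q * (r ^ q)\<^sup>2"
proof -
  define N where "N = r ^ q"
  define a where "a y = real (card {z\<in>V. A y z})" for y
  define b where "b y = real (card {x\<in>V'. A x y})" for y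
  define T where "T y = (\<Sum>x\<in>{x\<in>V'. A x y}. real (card {z\<in>{z\<in>V. A y z}. A x z}))" for y
  \<comment> \<open>Twice the coefficient that \<open>kst_bound\<close> yields between
    \<open>V'\<close> and \<open>Y\<close>: beyond \<open>L * (N / r)\<close> its main term is at
    most half of the sum that it bounds and can be absorbed.\<close>
  define L where "L = 2 * (1 + real t * real q ^ q)"
  define Y where "Y = {y\<in>V. b y > L * (N / r)}"
  have N: "N > 0" using r by (simp add: N_def)
  have finV': "finite V'" using fin V' finite_subset by blast
  have cV': "real (card V') \<le> N" using card_mono[OF fin V'] n unfolding N_def by linarith
  have a0: "a y \<ge> 0" and b0: "b y \<ge> 0" for y by (simp_all add: a_def b_def)
  have aN: "a y \<le> N" for y
  proof -
    have "card {z\<in>V. A y z} \<le> card V" using fin by (intro card_mono) auto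
    thus ?thesis using n by (simp add: a_def N_def)
  qed
  have bN: "b y \<le> N" for y
  proof -
    have "card {x\<in>V'. A x y} \<le> card V'" using finV' by (intro card_mono) auto
    thus ?thesis using cV' by (simp add: b_def)
  qed
  have triv: "T y \<le> b y * N" for y
  proof -
    have "T y \<le> (\<Sum>x\<in>{x\<in>V'. A x y}. N)" unfolding T_def
    proof (rule sum_mono)
      fix x
      have "card {z\<in>{z\<in>V. A y z}. A x z} \<le> card {z\<in>V. A y z}" using fin by (intro card_mono) auto
      thus "real (card {z\<in>{z\<in>V. A y z}. A x z}) \<le> N" using aN[of y] by (simp add: a_def)
    qed
    thus ?thesis by (simp add: b_def)
  qed
  have Tsmall: "T y \<le> (q - 1) * N + C * a y * (N / r\<^sup>2)" if y: "y \<in> V" "y \<notin> Y" for y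
  proof -
    \<comment> \<open>With \<open>b y\<close> of order \<open>N / r\<close>, the cut-off
      \<open>a y / r\<close> makes both terms of order \<open>a y * (N / r\<^sup>2)\<close>.\<close>
    define \<theta> where "\<theta> = max (real (q - 1)) (a y / r)"
    have \<theta>: "\<theta> \<ge> real (q - 1)" "\<theta> > 0" "\<theta> \<le> real (q - 1) + a y / r"
      using q a0[of y] r by (auto simp: \<theta>_def)
    have "T y \<le> card {x\<in>V'. A x y} * \<theta> + t * real ((q - 1) ^ (q - 1)) * real (card {z\<in>V. A y z}) ^ (q - 1) / \<theta> ^ (q - 1 - 1)"
      unfolding T_def
    proof (rule order_trans[OF kst_threshold[OF _ _ _ _ \<theta>(1), where t = t]])
      fix S assume S: "S \<subseteq> {z\<in>V. A y z}" "card S = q - 1"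
      have finS: "finite S" using S(1) fin by (simp add: finite_subset)
      have "y \<notin> S" using S irr by auto
      hence "card (insert y S) = q" using S(2) q finS by simp
      moreover have "insert y S \<subseteq> V" using y S by auto
      ultimately have "card {x\<in>V'. \<forall>w\<in>insert y S. A x w} \<le> t" by (intro common)
      moreover have "{x\<in>{x\<in>V'. A x y}. \<forall>w\<in>S. A x w} = {x\<in>V'. \<forall>w\<in>insert y S. A x w}" by auto
      ultimately show "card {x\<in>{x\<in>V'. A x y}. \<forall>w\<in>S. A x w} \<le> t" by simp
    qed (use fin finV' q in auto)
    also have "t * real ((q - 1) ^ (q - 1)) * real (card {z\<in>V. A y z}) ^ (q - 1) / \<theta> ^ (q - 1 - 1)
        \<le> t * real q ^ q * a y * (N / r\<^sup>2)"
    proof -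
      have ar: "a y / \<theta> \<le> r" using \<theta>(2) r by (simp add: \<theta>_def field_simps max_def split: if_splits)
      obtain m where q2: "q = Suc (Suc m)" using q by (metis One_nat_def Suc_1 Suc_le_D Suc_le_mono)
      have "a y ^ (q - 1) / \<theta> ^ (q - 1 - 1) = a y * (a y / \<theta>) ^ (q - 2)"
        using q2 by (simp add: power_divide)
      also have "\<dots> \<le> a y * r ^ (q - 2)" using a0[of y] \<theta> ar by (intro mult_left_mono power_mono) auto
      also have "r ^ (q - 2) = N / r\<^sup>2" using q r by (simp add: N_def power_diff)
      finally have 1: "a y ^ (q - 1) / \<theta> ^ (q - 1 - 1) \<le> a y * (N / r\<^sup>2)" .
      have "(q - 1) ^ (q - 1) \<le> q ^ (q - 1)" by (intro power_mono) auto
      also have "\<dots> \<le> q ^ q" using q by (intro power_increasing) auto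
      finally have "real ((q - 1) ^ (q - 1)) \<le> real q ^ q" by (metis of_nat_le_iff of_nat_power)
      hence "(t * real ((q - 1) ^ (q - 1))) * (a y ^ (q - 1) / \<theta> ^ (q - 1 - 1)) \<le> (t * real q ^ q) * (a y * (N / r\<^sup>2))"
        using 1 a0[of y] \<theta>(2) by (intro mult_mono) auto
      hence "t * real ((q - 1) ^ (q - 1)) * a y ^ (q - 1) / \<theta> ^ (q - 1 - 1) \<le> t * real q ^ q * a y * (N / r\<^sup>2)"
        by (simp only: times_divide_eq_right mult.assoc)
      thus ?thesis unfolding a_def .
    qed
    also have "card {x\<in>V'. A x y} * \<theta> \<le> (q - 1) * N + L * a y * (N / r\<^sup>2)"
    proof -
      have "card {x\<in>V'. A x y} * \<theta> \<le> b y * (real (q - 1) + a y / r)"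
        unfolding b_def using \<theta> by (intro mult_left_mono) auto
      also have "\<dots> = real (q - 1) * b y + b y * (a y / r)" by (simp add: algebra_simps)
      also have "\<dots> \<le> real (q - 1) * N + (L * (N / r)) * (a y / r)"
        using bN[of y] y a0[of y] b0[of y] r N by (intro add_mono mult_mono) (auto simp: Y_def L_def)
      also have "\<dots> = (q - 1) * N + L * a y * (N / r\<^sup>2)" by (simp add: power2_eq_square)
      finally show ?thesis .
    qed
    finally show ?thesis by (simp add: C_def L_def algebra_simps add_divide_distrib)
  qed
  have Yb: "(\<Sum>y\<in>Y. b y) \<le> 2 * q * N"
  proof -
    have finY: "finite Y" using fin by (simp add: Y_def)
    have "(\<Sum>y\<in>Y. b y) = real (\<Sum>y\<in>Y. card {x\<in>V'. A x y})" by (simp add: b_def)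
    also have "(\<Sum>y\<in>Y. card {x\<in>V'. A x y}) = (\<Sum>x\<in>V'. card {y\<in>Y. A x y})"
      using sum_multicount_gen[of V' Y "\<lambda>x y. A x y" "\<lambda>y. card {x\<in>V'. A x y}"] finV' finY by simp
    also have "real \<dots> \<le> q * N + (1 + t * q ^ q) * card Y * (N / r)"
      unfolding N_def of_nat_sum
    proof (rule kst_bound[OF finV' finY])
      fix S assume "S \<subseteq> Y" "card S = q"
      thus "card {x \<in> V'. \<forall>y\<in>S. A x y} \<le> t" by (intro common) (auto simp: Y_def)
    qed (use q r cV' in \<open>simp_all add: N_def\<close>)
    finally have e: "(\<Sum>y\<in>Y. b y) \<le> q * N + (1 + t * q ^ q) * card Y * (N / r)" .
    have "card Y * (L * (N / r)) \<le> (\<Sum>y\<in>Y. b y)"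
      by (rule sum_bounded_below) (auto simp: Y_def)
    moreover have "card Y * (L * (N / r)) = 2 * ((1 + t * q ^ q) * card Y * (N / r))"
      by (simp add: L_def algebra_simps)
    ultimately show ?thesis using e by linarith
  qed
  have "(\<Sum>y\<in>V. T y) = (\<Sum>y\<in>V - Y. T y) + (\<Sum>y\<in>Y. T y)"
    using fin by (intro sum.subset_diff) (auto simp: Y_def)
  also have "(\<Sum>y\<in>V - Y. T y) \<le> (\<Sum>y\<in>V - Y. (q - 1) * N + C * a y * (N / r\<^sup>2))"
    by (rule sum_mono) (rule Tsmall; simp)
  also have "\<dots> \<le> (\<Sum>y\<in>V. (q - 1) * N + C * a y * (N / r\<^sup>2))"
    using fin N a0 by (intro sum_mono2) (auto simp: C_def)
  also have "\<dots> = card V * ((q - 1) * N) + C * (\<Sum>y\<in>V. a y) * (N / r\<^sup>2)"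
    by (simp add: sum.distrib sum_distrib_left sum_distrib_right sum_divide_distrib)
  also have "\<dots> \<le> N * (q * N) + C * (\<Sum>y\<in>V. a y) * (N / r\<^sup>2)"
    using n N by (intro add_right_mono mult_mono) (auto simp: N_def)
  also have "(\<Sum>y\<in>Y. T y) \<le> (\<Sum>y\<in>Y. b y * N)" by (rule sum_mono) (rule triv)
  also have "\<dots> \<le> 2 * q * N * N" using Yb N by (simp add: sum_distrib_right[symmetric])
  finally show ?thesis unfolding T_def a_def N_def by (simp add: power2_eq_square algebra_simps)
qed

section \<open>Vertices of large degree\<close>

text \<open>A subfamily maximising the number of triples minus \<open>K\<close> times the number of shadow pairs
  has no shadow pair of codegree below \<open>K\<close>.\<close>

lemma full_subfamily:
  fixes E :: "'a set set"
  assumes fin: "finite V" and E: "\<And>e. e \<in> E \<Longrightarrow> e \<subseteq> V \<and> card e = 3"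
  obtains E' where "E' \<subseteq> E" "card E \<le> card E' + K * (card V) ^ 2"
    "\<And>e x y. e \<in> E' \<Longrightarrow> x \<in> e \<Longrightarrow> y \<in> e \<Longrightarrow> x \<noteq> y \<Longrightarrow> K \<le> card {z. {x, y, z} \<in> E'}"
proof -
  define sh where "sh F = {P. card P = 2 \<and> (\<exists>e\<in>F. P \<subseteq> e)}" for F :: "'a set set"
  define \<Phi> where "\<Phi> F = int (card F) - int K * int (card (sh F))" for F
  have finE: "finite E" using E fin by (meson Sup_le_iff finite_UnionD finite_subset)
  have shV: "sh F \<subseteq> {P. P \<subseteq> V \<and> card P = 2}" if "F \<subseteq> E" for F
    using that E by (auto simp: sh_def)
  have finsh: "finite (sh F)" if "F \<subseteq> E" for F
    by (rule finite_subset[OF shV[OF that]]) (use fin in simp)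
  have "\<exists>E'\<in>Pow E. \<forall>F\<in>Pow E. \<Phi> F \<le> \<Phi> E'"
  proof -
    have "Max (\<Phi> ` Pow E) \<in> \<Phi> ` Pow E" using finE by (intro Max_in) auto
    then obtain E' where "E' \<in> Pow E" "\<Phi> E' = Max (\<Phi> ` Pow E)" by force
    moreover have "\<Phi> F \<le> Max (\<Phi> ` Pow E)" if "F \<in> Pow E" for F using finE that by (intro Max_ge) auto
    ultimately show ?thesis by metis
  qed
  then obtain E' where E': "E' \<subseteq> E" "\<And>F. F \<subseteq> E \<Longrightarrow> \<Phi> F \<le> \<Phi> E'" by blast
  have finE': "finite E'" using E'(1) finE finite_subset by blast
  show ?thesis
  proof (rule that[OF E'(1)])
    have "card (sh E) \<le> card {P. P \<subseteq> V \<and> card P = 2}"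
      using shV[of E] fin by (intro card_mono) auto
    also have "\<dots> \<le> (card V) ^ 2" using fin by (simp add: n_subsets binomial_le_power)
    finally have "int K * int (card (sh E)) \<le> int K * int ((card V) ^ 2)" by (intro mult_left_mono) auto
    moreover have "0 \<le> int K * int (card (sh E'))" by simp
    hence "int (card E) - int K * int (card (sh E)) \<le> int (card E')"
      using E'(2)[OF order_refl] unfolding \<Phi>_def by linarith
    ultimately have "int (card E) \<le> int (card E' + K * (card V) ^ 2)" by simp
    thus "card E \<le> card E' + K * (card V) ^ 2" by (simp only: of_nat_le_iff)
  next
    fix e x y assume exy: "e \<in> E'" "x \<in> e" "y \<in> e" "x \<noteq> y"
    show "K \<le> card {z. {x, y, z} \<in> E'}"
    proof (rule ccontr)
      assume less: "\<not> K \<le> card {z. {x, y, z} \<in> E'}"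
      \<comment> \<open>Removing all triples on a pair of codegree below \<open>K\<close> loses
        fewer than \<open>K\<close> triples and at least one shadow pair, so \<open>\<Phi>\<close>
        would increase.\<close>
      define D where "D = {e \<in> E'. {x, y} \<subseteq> e}"
      have finz: "finite {z. {x, y, z} \<in> E'}"
        by (rule finite_subset[of _ V]) (use E E' fin in auto)
      have "D \<subseteq> (\<lambda>z. {x, y, z}) ` {z. {x, y, z} \<in> E'}"
      proof
        fix e assume e: "e \<in> D"
        hence "card (e - {x, y}) = 1" using E E'(1) exy(4) by (subst card_Diff_subset) (auto simp: D_def)
        then obtain z where "e - {x, y} = {z}" by (auto simp: card_1_singleton_iff)
        hence "e = {x, y, z}" using e by (auto simp: D_def)
        thus "e \<in> (\<lambda>z. {x, y, z}) ` {z. {x, y, z} \<in> E'}" using e by (auto simp: D_def)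
      qed
      hence "card D \<le> card {z. {x, y, z} \<in> E'}" by (rule surj_card_le[OF finz])
      hence cD: "card D < K" using less by simp
      have "sh (E' - D) \<subseteq> sh E' - {{x, y}}" by (auto simp: sh_def D_def)
      hence "card (sh (E' - D)) \<le> card (sh E' - {{x, y}})" using finsh[OF E'(1)] by (intro card_mono) auto
      also have "\<dots> = card (sh E') - 1"
        using exy by (intro card_Diff_singleton) (auto simp: sh_def)
      finally have 1: "card (sh (E' - D)) \<le> card (sh E') - 1" .
      have "{x, y} \<in> sh E'" using exy by (auto simp: sh_def)
      hence "card (sh E') > 0" using finsh[OF E'(1)] card_gt_0_iff by blast
      hence "int (card (sh (E' - D))) \<le> int (card (sh E')) - 1" using 1 by linarith
      hence "int K * int (card (sh (E' - D))) \<le> int K * (int (card (sh E')) - 1)" by (intro mult_left_mono) auto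
      moreover have "card (E' - D) = card E' - card D" "card D \<le> card E'"
        using finE' by (auto simp: D_def intro!: card_Diff_subset card_mono)
      ultimately have "\<Phi> (E' - D) > \<Phi> E'" using cD by (simp add: \<Phi>_def algebra_simps)
      thus False using E'(2)[of "E' - D"] E'(1) by fastforce
    qed
  qed
qed

lemma sum_codegrees:
  fixes E :: "'a set set"
  assumes fin: "finite V" and E: "\<And>e. e \<in> E \<Longrightarrow> e \<subseteq> V \<and> card e = 3"
  shows "(\<Sum>x\<in>V - {v}. card {z. {v, x, z} \<in> E}) = 2 * card {e \<in> E. v \<in> e}"
proof -
  let ?D = "{e \<in> E. v \<in> e}"
  have finE: "finite E" using E fin by (meson Sup_le_iff finite_UnionD finite_subset)
  have "card {z. {v, x, z} \<in> E} = card {e \<in> ?D. x \<in> e}" if x: "x \<in> V - {v}" for x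
  proof (rule bij_betw_same_card[of "\<lambda>z. {v, x, z}"])
    show "bij_betw (\<lambda>z. {v, x, z}) {z. {v, x, z} \<in> E} {e \<in> ?D. x \<in> e}"
      unfolding bij_betw_def
    proof
      have three: "z \<noteq> v \<and> z \<noteq> x" if "{v, x, z} \<in> E" for z
      proof -
        have "card {v, x} \<le> 2" by (simp add: card_insert_if)
        thus ?thesis using E[OF that] by (auto simp: insert_commute)
      qed
      show "inj_on (\<lambda>z. {v, x, z}) {z. {v, x, z} \<in> E}"
        using three by (auto simp: inj_on_def doubleton_eq_iff insert_eq_iff)
      show "(\<lambda>z. {v, x, z}) ` {z. {v, x, z} \<in> E} = {e \<in> ?D. x \<in> e}"
      proof safe
        fix e assume e: "e \<in> E" "v \<in> e" "x \<in> e"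
        hence "card (e - {v, x}) = 1" using E x by (subst card_Diff_subset) auto
        then obtain z where "e - {v, x} = {z}" by (auto simp: card_1_singleton_iff)
        hence "e = {v, x, z}" using e by auto
        thus "e \<in> (\<lambda>z. {v, x, z}) ` {z. {v, x, z} \<in> E}" using e by auto
      qed
    qed
  qed
  hence "(\<Sum>x\<in>V - {v}. card {z. {v, x, z} \<in> E}) = (\<Sum>x\<in>V - {v}. card {e \<in> ?D. x \<in> e})" by simp
  also have "\<dots> = (\<Sum>e\<in>?D. card {x \<in> V - {v}. x \<in> e})"
    using sum_multicount_gen[of "V - {v}" ?D "\<lambda>x e. x \<in> e" "\<lambda>e. card {x \<in> V - {v}. x \<in> e}"] fin finE by simp
  also have "\<dots> = (\<Sum>e\<in>?D. 2)"
  proof (rule sum.cong[OF refl])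
    fix e assume e: "e \<in> ?D"
    hence "{x \<in> V - {v}. x \<in> e} = e - {v}" "finite e" using E fin finite_subset by blast+
    thus "card {x \<in> V - {v}. x \<in> e} = 2" using e E by simp
  qed
  finally show ?thesis by simp
qed

text \<open>\<open>A\<close> is the shadow of a cleaned family \<open>E'\<close> of triples avoiding
  \<open>v\<close>; its edges have codegree at least \<open>K\<close> in \<open>E\<close>, as
  \<open>kst_copyI\<close> demands. So do the pairs of \<open>v\<close> with \<open>V'\<close>,
  which lets \<open>v\<close> take part in a copy although it is isolated in \<open>A\<close>. The
  factor \<open>K + 1\<close> pays for the cleaning and for the triples through
  \<open>v\<close>.\<close>

lemma high_degree_structure:
  fixes E :: "'a set set" and \<delta> :: real
  assumes fin: "finite V" and E: "\<And>e. e \<in> E \<Longrightarrow> e \<subseteq> V \<and> card e = 3" and v: "v \<in> V"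
    and free: "\<not> kst_copy s t E" and st: "s > 0" "t > 0"
    and K: "K = s * t + (s + t)"
  obtains A and V' W :: "'a set" where "V' \<subseteq> V" "W \<subseteq> V" "V' \<inter> W = {}" "v \<notin> V'" "v \<notin> W" "V = insert v (V' \<union> W)"
    "\<And>x y. A x y \<Longrightarrow> A y x" "\<And>x. \<not> A x x" "\<And>x y. A x y \<Longrightarrow> x \<in> V' \<union> W"
    "kst_free s t A"
    "\<And>S. S \<subseteq> V \<Longrightarrow> card S = s - 1 \<Longrightarrow> card {x\<in>V'. \<forall>y\<in>S. A x y} \<le> t"
    "2 * card {e \<in> E. v \<in> e} \<le> card V' * card V + K * card W"
    "real (card E) \<le> card {e \<in> E. e \<subseteq> W} + real (K + 1) * (real (card V))\<^sup>2
       + (\<Sum>y\<in>V. \<Sum>x\<in>{x\<in>V'. A x y}. real (card {z\<in>{z\<in>V. A y z}. A x z}))"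
proof -
  define V' where "V' = {x \<in> V - {v}. K \<le> card {z. {v, x, z} \<in> E}}"
  define W where "W = {x \<in> V - {v}. \<not> K \<le> card {z. {v, x, z} \<in> E}}"
  have finE: "finite E" using E fin by (meson Sup_le_iff finite_UnionD finite_subset)
  have finz: "finite {z. {x, y, z} \<in> F}" if "F \<subseteq> E" for x y F
    by (rule finite_subset[of _ V]) (use that E fin in auto)
  define E0 where "E0 = {e \<in> E. v \<notin> e}"
  obtain E' where E': "E' \<subseteq> E0" "card E0 \<le> card E' + K * (card V) ^ 2"
    "\<And>e x y. e \<in> E' \<Longrightarrow> x \<in> e \<Longrightarrow> y \<in> e \<Longrightarrow> x \<noteq> y \<Longrightarrow> K \<le> card {z. {x, y, z} \<in> E'}"
    using full_subfamily[OF fin, of E0 K] E by (auto simp: E0_def)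
  have E'E: "E' \<subseteq> E" "\<And>e. e \<in> E' \<Longrightarrow> v \<notin> e" using E'(1) by (auto simp: E0_def)
  have E'3: "e \<subseteq> V \<and> card e = 3" if "e \<in> E'" for e using that E'E E by blast
  define A where "A x y \<longleftrightarrow> x \<noteq> y \<and> (\<exists>e\<in>E'. x \<in> e \<and> y \<in> e)" for x y
  have AK: "K \<le> card {z. {x, y, z} \<in> E}" if "A x y" for x y
  proof -
    obtain e where "e \<in> E'" "x \<in> e" "y \<in> e" "x \<noteq> y" using \<open>A x y\<close> by (auto simp: A_def)
    hence "K \<le> card {z. {x, y, z} \<in> E'}" using E'(3) by blast
    also have "\<dots> \<le> card {z. {x, y, z} \<in> E}" using E'E finz[OF order_refl] by (intro card_mono) auto
    finally show ?thesis .
  qed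
  have AV: "x \<in> V' \<union> W" if "A x y" for x y
    using that E'E E'3 by (auto simp: A_def V'_def W_def)
  show ?thesis
  proof (rule that[of V' W A])
    show "V' \<subseteq> V" "W \<subseteq> V" "V' \<inter> W = {}" "v \<notin> V'" "v \<notin> W" "V = insert v (V' \<union> W)"
      using v by (auto simp: V'_def W_def)
    show "A y x" if "A x y" for x y using that by (auto simp: A_def)
    show "\<not> A x x" for x by (simp add: A_def)
    show "x \<in> V' \<union> W" if "A x y" for x y using AV[OF that] .
    show "kst_free s t A"
      unfolding kst_free_def
    proof (intro allI impI notI)
      fix S T assume ST: "finite S" "finite T" "card S = s" "card T = t" "\<forall>x\<in>S. \<forall>y\<in>T. A x y"
      have "kst_copy s t E"
        by (rule kst_copyI[OF ST(1-4)]) (use ST(5) AK in \<open>auto simp: K A_def\<close>)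
      thus False using free by simp
    qed
  next
    fix S assume S: "S \<subseteq> V" "card S = s - 1"
    show "card {x\<in>V'. \<forall>y\<in>S. A x y} \<le> t"
    proof (rule ccontr)
      assume "\<not> card {x\<in>V'. \<forall>y\<in>S. A x y} \<le> t"
      then obtain T where T: "T \<subseteq> {x\<in>V'. \<forall>y\<in>S. A x y}" "card T = t" "finite T"
        by (meson obtain_subset_with_card_n nat_le_linear)
      have finS: "finite S" using S(1) fin finite_subset by blast
      \<comment> \<open>As \<open>v\<close> is isolated in \<open>A\<close>, a set \<open>S\<close>
        with a common neighbour misses \<open>v\<close>, and \<open>insert v S\<close> has exactly
        \<open>s\<close> elements.\<close>
      obtain x0 where "x0 \<in> T" using T(2) st(2) by fastforce
      hence "A x0 y" if "y \<in> S" for y using T(1) that by blast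
      hence vS: "v \<notin> S" using E'E(2) unfolding A_def by blast
      have "kst_copy s t E"
      proof (rule kst_copyI)
        show "finite (insert v S)" "finite T" using finS T by auto
        show "card (insert v S) = s" using finS vS S st by simp
        show "card T = t" by (rule T)
        show "insert v S \<inter> T = {}" using T(1) by (auto simp: A_def V'_def)
        fix x y assume xy: "x \<in> insert v S" "y \<in> T"
        have yV: "y \<in> V'" using xy T(1) by auto
        show "s * t + (s + t) \<le> card {z. {x, y, z} \<in> E}"
        proof (cases "x = v")
          case True
          thus ?thesis using yV by (simp add: V'_def K)
        next
          case False
          hence "A y x" using xy T(1) by auto
          hence "A x y" by (auto simp: A_def)
          thus ?thesis using AK K by simp
        qed
      qed
      thus False using free by simp
    qed
  next
    have finVW: "finite V'" "finite W" using fin by (auto simp: V'_def W_def)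
    have "2 * card {e \<in> E. v \<in> e} = (\<Sum>x\<in>V - {v}. card {z. {v, x, z} \<in> E})"
      using sum_codegrees[OF fin E] by simp
    also have "V - {v} = V' \<union> W" by (auto simp: V'_def W_def)
    also have "(\<Sum>x\<in>V' \<union> W. card {z. {v, x, z} \<in> E}) = (\<Sum>x\<in>V'. card {z. {v, x, z} \<in> E}) + (\<Sum>x\<in>W. card {z. {v, x, z} \<in> E})"
      using finVW by (intro sum.union_disjoint) (auto simp: V'_def W_def)
    also have "\<dots> \<le> card V' * card V + card W * K"
    proof (intro add_mono)
      have "card {z. {v, x, z} \<in> E} \<le> card V" for x using E fin by (intro card_mono) auto
      thus "(\<Sum>x\<in>V'. card {z. {v, x, z} \<in> E}) \<le> card V' * card V"
        using sum_bounded_above[of V' _ "card V"] by simp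
      show "(\<Sum>x\<in>W. card {z. {v, x, z} \<in> E}) \<le> card W * K"
        using sum_bounded_above[of W "\<lambda>x. card {z. {v, x, z} \<in> E}" K] by (simp add: W_def)
    qed
    finally show "2 * card {e \<in> E. v \<in> e} \<le> card V' * card V + K * card W" by (simp add: mult.commute)
  next
    have finVW: "finite V'" "finite W" using fin by (auto simp: V'_def W_def)
    define Tr where "Tr = (SIGMA y:V. SIGMA x:{x\<in>V'. A x y}. {z\<in>{z\<in>V. A y z}. A x z})"
    have finTr: "finite Tr" using fin finVW by (auto simp: Tr_def)
    have cTr: "real (card Tr) = (\<Sum>y\<in>V. \<Sum>x\<in>{x\<in>V'. A x y}. real (card {z\<in>{z\<in>V. A y z}. A x z}))"
      unfolding Tr_def using fin finVW by (simp add: card_SigmaI)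
    have "E' \<subseteq> {e \<in> E. e \<subseteq> W} \<union> (\<lambda>(y, x, z). {x, y, z}) ` Tr"
    proof
      fix e assume e: "e \<in> E'"
      show "e \<in> {e \<in> E. e \<subseteq> W} \<union> (\<lambda>(y, x, z). {x, y, z}) ` Tr"
      proof (cases "e \<subseteq> W")
        case False
        have "e \<subseteq> V' \<union> W" using E'3[OF e] E'E(2)[OF e] by (auto simp: V'_def W_def)
        then obtain x where x: "x \<in> e" "x \<in> V'" using False by blast
        have "card (e - {x}) = 2" using E'3[OF e] x by simp
        then obtain y z where yz: "e - {x} = {y, z}" "y \<noteq> z" by (auto simp: card_2_iff)
        hence e3: "e = {x, y, z}" "y \<noteq> x" "z \<noteq> x" using x by auto
        have "x \<in> e" "y \<in> e" "z \<in> e" unfolding e3(1) by simp_all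
        hence "A x y" "A y z" "A x z" unfolding A_def using e e3(2,3)[symmetric] yz(2) by blast+
        moreover have "{x, y, z} \<subseteq> V" using E'3[OF e] by (simp only: e3(1))
        ultimately have "(y, x, z) \<in> Tr" using x(2) by (simp add: Tr_def)
        thus ?thesis using e3(1) by (intro UnI2 image_eqI[of _ _ "(y, x, z)"]) simp_all
      next
        case True
        thus ?thesis using e E'E(1) by blast
      qed
    qed
    hence "card E' \<le> card ({e \<in> E. e \<subseteq> W} \<union> (\<lambda>(y, x, z). {x, y, z}) ` Tr)"
      using finE finTr by (intro card_mono) auto
    also have "\<dots> \<le> card {e \<in> E. e \<subseteq> W} + card ((\<lambda>(y, x, z). {x, y, z}) ` Tr)" by (rule card_Un_le)
    also have "\<dots> \<le> card {e \<in> E. e \<subseteq> W} + card Tr" using card_image_le[OF finTr] by (intro add_left_mono) auto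
    finally have 1: "card E' \<le> card {e \<in> E. e \<subseteq> W} + card Tr" .
    have "2 * card {e \<in> E. v \<in> e} = (\<Sum>x\<in>V - {v}. card {z. {v, x, z} \<in> E})"
      using sum_codegrees[OF fin E] by simp
    also have "\<dots> \<le> card (V - {v}) * card V"
    proof -
      have "card {z. {v, x, z} \<in> E} \<le> card V" for x using E fin by (intro card_mono) auto
      thus ?thesis using sum_bounded_above[of "V - {v}" _ "card V"] by simp
    qed
    also have "\<dots> \<le> card V * card V" using fin by (intro mult_right_mono card_mono) auto
    finally have 2: "card {e \<in> E. v \<in> e} \<le> card V * card V" by simp
    have "card E = card (E0 \<union> {e \<in> E. v \<in> e})" by (rule arg_cong[of _ _ card]) (auto simp: E0_def)
    hence "card E \<le> card E0 + card {e \<in> E. v \<in> e}" using card_Un_le[of E0 "{e \<in> E. v \<in> e}"] by linarith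
    hence "card E \<le> card {e \<in> E. e \<subseteq> W} + card Tr + K * (card V) ^ 2 + card V * card V"
      using 1 2 E'(2) by linarith
    hence "real (card E) \<le> real (card {e \<in> E. e \<subseteq> W} + card Tr + K * (card V) ^ 2 + card V * card V)"
      by (simp only: of_nat_le_iff)
    thus "real (card E) \<le> card {e \<in> E. e \<subseteq> W} + real (K + 1) * (real (card V))\<^sup>2
       + (\<Sum>y\<in>V. \<Sum>x\<in>{x\<in>V'. A x y}. real (card {z\<in>{z\<in>V. A y z}. A x z}))"
      unfolding cTr[symmetric] by (simp add: power2_eq_square algebra_simps)
  qed
qed

section \<open>Random subsets and random permutations\<close>

text \<open>The expectation over a random \<open>R\<close> containing each element of
  \<open>A\<close> independently with probability \<open>p\<close>, without a probability space:
  elements are revealed one by one, and the better conditional expectation is followed.\<close>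

lemma exists_subset_ge_average:
  fixes p :: real and w :: "'i \<Rightarrow> real"
  assumes "finite A" "finite I" and p: "0 \<le> p" "p \<le> 1"
    and "\<And>i. i \<in> I \<Longrightarrow> S i \<subseteq> A" "\<And>i. i \<in> I \<Longrightarrow> T i \<subseteq> A" "\<And>i. i \<in> I \<Longrightarrow> S i \<inter> T i = {}"
  shows "\<exists>R\<subseteq>A. (\<Sum>i\<in>I. w i * (p ^ card (S i) * (1 - p) ^ card (T i))) \<le> (\<Sum>i\<in>{i\<in>I. S i \<subseteq> R \<and> T i \<inter> R = {}}. w i)"
  using assms(1,2,5,6,7)
proof (induction A arbitrary: I S T rule: finite_induct)
  case empty
  have ST: "S i = {}" "T i = {}" if "i \<in> I" for i using empty(2,3)[OF that] by auto
  have eq: "{i\<in>I. S i \<subseteq> {} \<and> T i \<inter> {} = {}} = I" using ST by auto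
  have "(\<Sum>i\<in>I. w i * (p ^ card (S i) * (1 - p) ^ card (T i))) = (\<Sum>i\<in>I. w i)"
    using ST by (intro sum.cong) auto
  hence "(\<Sum>i\<in>I. w i * (p ^ card (S i) * (1 - p) ^ card (T i))) \<le> (\<Sum>i\<in>{i\<in>I. S i \<subseteq> {} \<and> T i \<inter> {} = {}}. w i)"
    unfolding eq by (rule eq_refl)
  thus ?case by blast
next
  case (insert a A)
  define f where "f i = w i * (p ^ card (S i) * (1 - p) ^ card (T i))" for i
  define I1 where "I1 = {i\<in>I. a \<notin> T i}"
  define I0 where "I0 = {i\<in>I. a \<notin> S i}"
  \<comment> \<open>\<open>W1\<close> and \<open>W0\<close> are the expectations conditioned on
    \<open>a \<in> R\<close> and on \<open>a \<notin> R\<close>; the total is their average with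
    weights \<open>p\<close> and \<open>1 - p\<close>.\<close>
  define W1 where "W1 = (\<Sum>i\<in>I1. w i * (p ^ card (S i - {a}) * (1 - p) ^ card (T i)))"
  define W0 where "W0 = (\<Sum>i\<in>I0. w i * (p ^ card (S i) * (1 - p) ^ card (T i - {a})))"
  have fin: "finite (S i)" "finite (T i)" if "i \<in> I" for i
    using insert.prems(2,3)[OF that] insert.hyps(1) finite_subset by blast+
  have sub: "S i \<subseteq> insert a A" "T i \<subseteq> insert a A" "\<And>x. x \<in> S i \<Longrightarrow> x \<in> T i \<Longrightarrow> False" if "i \<in> I" for i
    using insert.prems(2-4)[OF that] by blast+
  have "(\<Sum>i\<in>I. f i) = (\<Sum>i\<in>I. p * (if a \<notin> T i then w i * (p ^ card (S i - {a}) * (1 - p) ^ card (T i)) else 0)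
     + (1 - p) * (if a \<notin> S i then w i * (p ^ card (S i) * (1 - p) ^ card (T i - {a})) else 0))"
  proof (rule sum.cong[OF refl])
    fix i assume i: "i \<in> I"
    consider "a \<in> S i" "a \<notin> T i" | "a \<notin> S i" "a \<in> T i" | "a \<notin> S i" "a \<notin> T i"
      using insert.prems(4)[OF i] by blast
    thus "f i = p * (if a \<notin> T i then w i * (p ^ card (S i - {a}) * (1 - p) ^ card (T i)) else 0)
     + (1 - p) * (if a \<notin> S i then w i * (p ^ card (S i) * (1 - p) ^ card (T i - {a})) else 0)"
    proof cases
      case 1
      have "card (S i) = Suc (card (S i - {a}))" using card_Suc_Diff1[OF fin(1)[OF i] 1(1)] by simp
      hence "p ^ card (S i) = p * p ^ card (S i - {a})" by (metis power_Suc)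
      thus ?thesis using 1 by (simp add: f_def del: card_Diff_insert card_Diff_singleton)
    next
      case 2
      have "card (T i) = Suc (card (T i - {a}))" using card_Suc_Diff1[OF fin(2)[OF i] 2(2)] by simp
      hence "(1 - p) ^ card (T i) = (1 - p) * (1 - p) ^ card (T i - {a})" by (metis power_Suc)
      thus ?thesis using 2 by (simp add: f_def del: card_Diff_insert card_Diff_singleton)
    next
      case 3
      thus ?thesis by (simp add: f_def algebra_simps)
    qed
  qed
  also have "\<dots> = p * W1 + (1 - p) * W0"
    unfolding W1_def W0_def I1_def I0_def using insert.prems(1)
    by (simp add: sum.distrib sum_distrib_left[symmetric] sum.inter_filter[symmetric])
  finally have avg: "(\<Sum>i\<in>I. f i) = p * W1 + (1 - p) * W0" .
  have "(\<Sum>i\<in>I. f i) \<le> W1 \<or> (\<Sum>i\<in>I. f i) \<le> W0"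
  proof (rule ccontr)
    assume neg: "\<not> ?thesis"
    define m where "m = max W1 W0"
    have "p * W1 + (1 - p) * W0 \<le> p * m + (1 - p) * m"
      using p by (intro add_mono mult_left_mono) (auto simp: m_def)
    also have "\<dots> = m" by (simp add: algebra_simps)
    finally show False using neg avg by (auto simp: m_def)
  qed
  thus ?case
  proof
    assume le: "(\<Sum>i\<in>I. f i) \<le> W1"
    have "\<exists>R\<subseteq>A. W1 \<le> (\<Sum>i\<in>{i\<in>I1. S i - {a} \<subseteq> R \<and> T i \<inter> R = {}}. w i)"
      unfolding W1_def by (rule insert.IH) (use insert.prems(1) sub(1,2) in \<open>auto simp: I1_def dest: sub(3)\<close>)
    then obtain R where R: "R \<subseteq> A" "W1 \<le> (\<Sum>i\<in>{i\<in>I1. S i - {a} \<subseteq> R \<and> T i \<inter> R = {}}. w i)" by blast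
    have "{i\<in>I1. S i - {a} \<subseteq> R \<and> T i \<inter> R = {}} = {i\<in>I. S i \<subseteq> insert a R \<and> T i \<inter> insert a R = {}}"
      by (auto simp: I1_def)
    thus ?thesis using R le unfolding f_def by (intro exI[of _ "insert a R"]) auto
  next
    assume le: "(\<Sum>i\<in>I. f i) \<le> W0"
    have "\<exists>R\<subseteq>A. W0 \<le> (\<Sum>i\<in>{i\<in>I0. S i \<subseteq> R \<and> (T i - {a}) \<inter> R = {}}. w i)"
      unfolding W0_def by (rule insert.IH) (use insert.prems(1) sub(1,2) in \<open>auto simp: I0_def dest: sub(3)\<close>)
    then obtain R where R: "R \<subseteq> A" "W0 \<le> (\<Sum>i\<in>{i\<in>I0. S i \<subseteq> R \<and> (T i - {a}) \<inter> R = {}}. w i)" by blast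
    have "{i\<in>I0. S i \<subseteq> R \<and> (T i - {a}) \<inter> R = {}} = {i\<in>I. S i \<subseteq> R \<and> T i \<inter> R = {}}"
      using R(1) insert.hyps(2) by (auto simp: I0_def)
    thus ?thesis using R le unfolding f_def by (intro exI[of _ R]) auto
  qed
qed

lemma exists_subset_ge_average_subset:
  fixes p :: real and w :: "'i \<Rightarrow> real" and A :: "'a set"
  assumes "finite A" "finite I" "0 \<le> p" "p \<le> 1" "\<And>i. i \<in> I \<Longrightarrow> S i \<subseteq> A"
  obtains R where "R \<subseteq> A" "(\<Sum>i\<in>I. w i * p ^ card (S i)) \<le> (\<Sum>i\<in>{i\<in>I. S i \<subseteq> R}. w i)"
proof -
  have "\<exists>R\<subseteq>A. (\<Sum>i\<in>I. w i * (p ^ card (S i) * (1 - p) ^ card ({} :: 'a set))) \<le> (\<Sum>i\<in>{i\<in>I. S i \<subseteq> R \<and> {} \<inter> R = {}}. w i)"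
    by (rule exists_subset_ge_average) (simp_all add: assms)
  then obtain R where "R \<subseteq> A" "(\<Sum>i\<in>I. w i * p ^ card (S i)) \<le> (\<Sum>i\<in>{i\<in>I. S i \<subseteq> R}. w i)"
    by (simp only: card.empty power_0 mult_1_right Int_empty_left simp_thms) blast
  thus ?thesis by (rule that)
qed

text \<open>By induction on \<open>M\<close>: the permutations extending \<open>M\<close> are split
  by their value at a new point, one of \<open>card Z - card M\<close> values not yet taken.
  Composition with a transposition shows that these classes have equal size.\<close>

lemma card_permutes_extending:
  assumes fin: "finite Z" and M: "M \<subseteq> Z \<times> Z" "inj_on fst M" "inj_on snd M"
  shows "card {\<pi>. \<pi> permutes Z \<and> (\<forall>(x, y)\<in>M. \<pi> x = y)} = fact (card Z - card M)"
proof -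
  have finM: "finite M" using M(1) fin by (meson finite_SigmaI finite_subset)
  from finM M show ?thesis
  proof (induction M rule: finite_induct)
    case empty
    thus ?case using card_permutations[OF refl fin] by simp
  next
    case (insert xy M)
    obtain x y where xy: "xy = (x, y)" by fastforce
    define P where "P M' = {\<pi>. \<pi> permutes Z \<and> (\<forall>(x, y)\<in>M'. \<pi> x = y)}" for M' :: "('a \<times> 'a) set"
    have finP: "finite (P M')" for M'
      by (rule finite_subset[OF _ finite_permutations[OF fin]]) (auto simp: P_def)
    have xZ: "x \<in> Z" "y \<in> Z" using insert.prems(1) xy by auto
    have inj: "inj_on fst M" "inj_on snd M" "M \<subseteq> Z \<times> Z" using insert.prems by (auto simp: inj_on_def)
    have xM: "x \<notin> fst ` M" and yM: "y \<notin> snd ` M"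
      using insert.prems(2,3) insert.hyps(2) by (force simp: xy)+
    define Z' where "Z' = Z - snd ` M"
    have cM: "card (snd ` M) = card M" using inj(2) by (rule card_image)
    have "snd ` M \<subseteq> Z" using inj(3) by auto
    hence cZ': "card Z' = card Z - card M" unfolding Z'_def using fin cM
      by (metis card_Diff_subset finite_subset)
    have yZ': "y \<in> Z'" using xZ yM by (simp add: Z'_def)
    have finZ': "finite Z'" using fin by (simp add: Z'_def)
    have eq: "P M = (\<Union>z\<in>Z'. P (insert (x, z) M))"
    proof
      show "P M \<subseteq> (\<Union>z\<in>Z'. P (insert (x, z) M))"
      proof
        fix \<pi> assume pi: "\<pi> \<in> P M"
        hence perm: "\<pi> permutes Z" by (simp add: P_def)
        have "\<pi> x \<notin> snd ` M"
        proof
          assume "\<pi> x \<in> snd ` M"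
          then obtain u where u: "(u, \<pi> x) \<in> M" by force
          hence "\<pi> u = \<pi> x" using pi by (auto simp: P_def)
          hence "u = x" using permutes_inj[OF perm] by (simp add: inj_def)
          thus False using u xM by force
        qed
        hence "\<pi> x \<in> Z'" using permutes_in_image[OF perm] xZ by (simp add: Z'_def)
        moreover have "\<pi> \<in> P (insert (x, \<pi> x) M)" using pi by (simp add: P_def)
        ultimately show "\<pi> \<in> (\<Union>z\<in>Z'. P (insert (x, z) M))" by blast
      qed
    qed (auto simp: P_def)
    have same: "card (P (insert (x, z) M)) = card (P (insert (x, y) M))" if z: "z \<in> Z'" for z
    proof (rule bij_betw_same_card[of "\<lambda>\<pi>. transpose y z \<circ> \<pi>"], rule bij_betw_byWitness[where f' = "\<lambda>\<pi>. transpose y z \<circ> \<pi>"])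
      have tr: "transpose y z permutes Z" using xZ z by (intro permutes_swap_id) (auto simp: Z'_def)
      have fix1: "transpose y z u = u" if "u \<in> snd ` M" for u
        using that yZ' z by (intro transpose_apply_other) (auto simp: Z'_def)
      have step: "transpose y z \<circ> \<pi> \<in> P (insert (x, v) M)"
        if "\<pi> \<in> P (insert (x, u) M)" "transpose y z u = v" for \<pi> u v
      proof -
        have "(transpose y z \<circ> \<pi>) a = b" if "(a, b) \<in> M" for a b
        proof -
          have "\<pi> a = b" using \<open>\<pi> \<in> P (insert (x, u) M)\<close> that by (auto simp: P_def)
          thus ?thesis using fix1[of b] that by force
        qed
        thus ?thesis using that tr by (auto simp: P_def intro: permutes_compose)
      qed
      show "(\<lambda>\<pi>. transpose y z \<circ> \<pi>) ` P (insert (x, z) M) \<subseteq> P (insert (x, y) M)"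
        using step[of _ z y] by auto
      show "(\<lambda>\<pi>. transpose y z \<circ> \<pi>) ` P (insert (x, y) M) \<subseteq> P (insert (x, z) M)"
        using step[of _ y z] by auto
    qed (auto simp: fun_eq_iff)
    have "card (P M) = (\<Sum>z\<in>Z'. card (P (insert (x, z) M)))"
      unfolding eq
    proof (rule card_UN_disjoint[OF finZ'])
      show "\<forall>i\<in>Z'. \<forall>j\<in>Z'. i \<noteq> j \<longrightarrow> P (insert (x, i) M) \<inter> P (insert (x, j) M) = {}"
        by (auto simp: P_def)
    qed (use finP in auto)
    also have "\<dots> = card Z' * card (P (insert (x, y) M))" using same by simp
    finally have c: "card (P M) = card Z' * card (P (insert (x, y) M))" .
    have fP: "card (P M) = fact (card Z - card M)" unfolding P_def by (rule insert.IH[OF inj(3,1,2)])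
    have "card Z' > 0" using yZ' finZ' by (auto simp: card_gt_0_iff)
    then obtain m where m: "card Z' = Suc m" by (cases "card Z'") auto
    have "card Z - card M = Suc m" using cZ' m by simp
    hence "fact (Suc m) = Suc m * card (P (insert (x, y) M))" using c m fP by metis
    hence "card (P (insert (x, y) M)) = fact m" by (metis fact_Suc mult_cancel1 nat.distinct(1) of_nat_id)
    moreover have "card Z - card (insert xy M) = m" using cZ' m insert.hyps by simp
    ultimately show ?case unfolding P_def xy by simp
  qed
qed

lemma exists_permutation_ge_average:
  fixes w :: "'i \<Rightarrow> real"
  assumes fin: "finite Z" "finite I"
    and M: "\<And>i. i \<in> I \<Longrightarrow> M i \<subseteq> Z \<times> Z \<and> inj_on fst (M i) \<and> inj_on snd (M i)"
  obtains \<pi> where "\<pi> permutes Z"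
    "(\<Sum>i\<in>I. w i * (fact (card Z - card (M i)) / fact (card Z))) \<le> (\<Sum>i\<in>{i\<in>I. \<forall>(x, y)\<in>M i. \<pi> x = y}. w i)"
proof -
  let ?P = "{\<pi>. \<pi> permutes Z}"
  let ?L = "\<Sum>i\<in>I. w i * (fact (card Z - card (M i)) / fact (card Z))"
  have finP: "finite ?P" by (rule finite_permutations[OF fin(1)])
  have "id \<in> ?P" using permutes_id[of Z] by simp
  hence ne: "?P \<noteq> {}" by blast
  have cP: "card ?P = fact (card Z)" by (rule card_permutations[OF refl fin(1)])
  have "(\<Sum>\<pi>\<in>?P. \<Sum>i\<in>{i\<in>I. \<forall>(x, y)\<in>M i. \<pi> x = y}. w i) = (\<Sum>i\<in>I. \<Sum>\<pi>\<in>{\<pi>\<in>?P. \<forall>(x, y)\<in>M i. \<pi> x = y}. w i)"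
    by (rule sum.swap_restrict[OF finP fin(2)])
  also have "\<dots> = (\<Sum>i\<in>I. w i * fact (card Z - card (M i)))"
    by (intro sum.cong refl) (simp add: card_permutes_extending[OF fin(1)] M)
  also have "\<dots> = fact (card Z) * ?L" by (simp add: sum_distrib_left field_simps)
  finally have tot: "(\<Sum>\<pi>\<in>?P. \<Sum>i\<in>{i\<in>I. \<forall>(x, y)\<in>M i. \<pi> x = y}. w i) = fact (card Z) * ?L" .
  have "\<exists>\<pi>\<in>?P. ?L \<le> (\<Sum>i\<in>{i\<in>I. \<forall>(x, y)\<in>M i. \<pi> x = y}. w i)"
  proof (rule ccontr)
    assume "\<not> ?thesis"
    hence "(\<Sum>\<pi>\<in>?P. \<Sum>i\<in>{i\<in>I. \<forall>(x, y)\<in>M i. \<pi> x = y}. w i) < (\<Sum>\<pi>\<in>?P. ?L)"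
      using finP ne by (intro sum_strict_mono) auto
    thus False using tot cP by simp
  qed
  thus ?thesis using that by blast
qed

text \<open>Each of the \<open>k\<close> factors \<open>1 / (N - j)\<close> is at most
  \<open>2 / N\<close>. The quotient is the probability that a random permutation extends a given
  matching of size \<open>k\<close>.\<close>

lemma fact_diff_ratio_le:
  assumes "2 * k \<le> N"
  shows "fact (N - k) / fact N \<le> (2 / real N) ^ k"
proof (cases "N = 0")
  case False
  have "fact (N - j) / fact N \<le> (2 / real N) ^ j" if "j \<le> k" for j
    using that
  proof (induction j)
    case (Suc j)
    hence j: "j < N" "2 * j \<le> N" using assms by auto
    have "N - j = Suc (N - Suc j)" using j by simp
    hence "fact (N - j) = real (N - j) * fact (N - Suc j)" by (metis fact_Suc of_nat_mult)
    hence "(fact (N - Suc j) :: real) / fact N = (fact (N - j) / fact N) / real (N - j)"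
      using j by simp
    also have "\<dots> \<le> (2 / real N) ^ j * (2 / real N)"
    proof -
      have "real N \<le> 2 * real (N - j)" using j by (simp add: of_nat_diff)
      hence "1 / real (N - j) \<le> 2 / real N" using j by (simp add: field_simps)
      hence "(fact (N - j) / fact N) * (1 / real (N - j)) \<le> (2 / real N) ^ j * (2 / real N)"
        using Suc by (intro mult_mono) auto
      thus ?thesis by simp
    qed
    finally show ?case by (simp add: mult.commute)
  qed simp
  thus ?thesis by simp
qed (use assms in simp)

section \<open>Triangles of a random graph\<close>

text \<open>Every triangle of the random graph counts \<open>1\<close>. Every copy of \<open>K\<^sub>s\<^sub>,\<^sub>t\<close> with sides \<open>P\<close> and \<open>Q\<close>, together with
  a common neighbour \<open>z\<close> of \<open>Min P\<close> and \<open>Min Q\<close>, counts \<open>-1\<close>, as it forces the deletion of one triangle.\<close>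

lemma random_deletion:
  fixes p :: real
  assumes p: "0 \<le> p" "p \<le> 1" and st: "s > 0" "t > 0"
  obtains E :: "nat set set" where "\<Union>E \<subseteq> {..<n}" "\<And>e. e \<in> E \<Longrightarrow> card e = 3" "\<not> kst_copy s t E"
    "real (n choose 3) * p ^ 3 - real n ^ s * real n ^ t * (real n * p ^ (s * t + 2) + real (s + t) * p ^ (s * t + 1)) \<le> card E"
proof -
  let ?V = "{..<n}"
  define A where "A = {f. f \<subseteq> ?V \<and> card f = 2}"
  define Tri where "Tri = {e. e \<subseteq> ?V \<and> card e = 3}"
  define Ps where "Ps k = {P. P \<subseteq> ?V \<and> card P = k}" for k
  \<comment> \<open>\<open>Min P\<close> and \<open>Min Q\<close> merely single out one edge of the
    copy; \<open>z\<close> completes it to a triangle.\<close>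
  define Bad where "Bad = {(P, Q, z). P \<in> Ps s \<and> Q \<in> Ps t \<and> P \<inter> Q = {} \<and> z \<in> ?V \<and> z \<noteq> Min P \<and> z \<noteq> Min Q}"
  define cross where "cross P Q = (\<lambda>(x, y). {x, y}) ` (P \<times> Q)" for P Q :: "nat set"
  define S2 where "S2 = (\<lambda>(P, Q, z). cross P Q \<union> {{z, Min P}, {z, Min Q}})"
  define S1 where "S1 e = {f. f \<subseteq> e \<and> card f = 2}" for e :: "nat set"
  have finPs: "finite (Ps k)" for k unfolding Ps_def by simp
  have cPs: "card (Ps k) = n choose k" for k unfolding Ps_def by (simp add: n_subsets)
  have finTri: "finite Tri" unfolding Tri_def by simp
  have cTri: "card Tri = n choose 3" unfolding Tri_def by (simp add: n_subsets)
  have Badsub: "Bad \<subseteq> Ps s \<times> Ps t \<times> ?V" unfolding Bad_def by auto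
  have finBad: "finite Bad" using Badsub by (rule finite_subset) (simp add: finPs)
  have finA: "finite A" unfolding A_def by simp
  have PsD: "finite P" "P \<noteq> {}" "P \<subseteq> ?V" "card P = k" "Min P \<in> P" if "P \<in> Ps k" "k > 0" for P k
  proof -
    show f: "finite P" "P \<subseteq> ?V" "card P = k" using that(1) finite_subset[of P ?V] by (auto simp: Ps_def)
    show "P \<noteq> {}" using f(3) that(2) by auto
    thus "Min P \<in> P" using f(1) by simp
  qed
  have S1: "S1 e \<subseteq> A" "card (S1 e) = 3" if "e \<in> Tri" for e
  proof -
    show "S1 e \<subseteq> A" using that by (auto simp: S1_def A_def Tri_def)
    have "finite e" "card e = 3" using that finite_subset[of e ?V] by (auto simp: Tri_def)
    moreover have "3 choose 2 = (3::nat)" by (simp add: numeral_eq_Suc)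
    ultimately show "card (S1 e) = 3" by (simp add: S1_def n_subsets)
  qed
  have crossA: "cross P Q \<subseteq> A" if "P \<in> Ps s" "Q \<in> Ps t" "P \<inter> Q = {}" for P Q
  proof
    fix f assume "f \<in> cross P Q"
    then obtain x y where xy: "x \<in> P" "y \<in> Q" "f = {x, y}" by (auto simp: cross_def)
    have "x \<noteq> y" using xy(1,2) that(3) by blast
    thus "f \<in> A" using xy that by (auto simp: A_def Ps_def)
  qed
  have ccross: "card (cross P Q) = s * t" if "P \<in> Ps s" "Q \<in> Ps t" "P \<inter> Q = {}" for P Q
  proof -
    have "inj_on (\<lambda>(x, y). {x, y}) (P \<times> Q)"
      using that(3) by (auto simp: inj_on_def doubleton_eq_iff)
    thus ?thesis using that(1,2) by (simp add: cross_def card_image card_cartesian_product Ps_def)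
  qed
  \<comment> \<open>Both pairs at \<open>z\<close> are new edges if \<open>z\<close> lies outside
    \<open>P \<union> Q\<close>. Otherwise one of them may be a cross edge, but there are at most
    \<open>s + t\<close> such \<open>z\<close>.\<close>
  have S2: "S2 (P, Q, z) \<subseteq> A \<and> p ^ card (S2 (P, Q, z)) \<le> p ^ (s * t + 2) + (if z \<in> P \<union> Q then p ^ (s * t + 1) else 0)"
    if B: "(P, Q, z) \<in> Bad" for P Q z
  proof -
    have PQ: "P \<in> Ps s" "Q \<in> Ps t" "P \<inter> Q = {}" and z: "z < n" "z \<noteq> Min P" "z \<noteq> Min Q"
      using B by (auto simp: Bad_def)
    note P = PsD[OF PQ(1) st(1)] and Q = PsD[OF PQ(2) st(2)]
    have mn: "Min P < n" "Min Q < n" using P(3,5) Q(3,5) by auto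
    have "{z, Min P} \<in> A" "{z, Min Q} \<in> A" using z mn by (auto simp: A_def)
    hence sub: "S2 (P, Q, z) \<subseteq> A" using crossA[OF PQ] by (simp add: S2_def)
    have fc: "finite (cross P Q)" using crossA[OF PQ] finA finite_subset by blast
    have cr: "f \<in> cross P Q \<Longrightarrow> \<exists>x\<in>P. \<exists>y\<in>Q. f = {x, y}" for f by (auto simp: cross_def)
    have ne: "Min P \<noteq> Min Q" using P(5) Q(5) PQ(3) by (metis disjoint_iff)
    have notcr: "{z, m} \<notin> cross P Q" if "z \<in> P \<longleftrightarrow> m \<in> P" "z \<in> Q \<longleftrightarrow> m \<in> Q" for m
    proof
      assume "{z, m} \<in> cross P Q"
      then obtain x y where "x \<in> P" "y \<in> Q" "{z, m} = {x, y}" using cr by blast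
      thus False using that PQ(3) by (auto simp: doubleton_eq_iff)
    qed
    have notcr2: "{z, m} \<notin> cross P Q" if "z \<notin> P" "z \<notin> Q" for m
      using that by (auto simp: cross_def doubleton_eq_iff)
    show ?thesis
    proof (cases "z \<in> P \<union> Q")
      case False
      have "{z, Min P} \<notin> cross P Q" "{z, Min Q} \<notin> insert {z, Min P} (cross P Q)"
        using notcr2[of "Min P"] notcr2[of "Min Q"] False ne by (auto simp: doubleton_eq_iff)
      hence "card (insert {z, Min Q} (insert {z, Min P} (cross P Q))) = s * t + 2"
        using fc ccross[OF PQ] by simp
      moreover have "S2 (P, Q, z) = insert {z, Min Q} (insert {z, Min P} (cross P Q))" by (auto simp: S2_def)
      ultimately show ?thesis using sub False by simp
    next
      case True
      define m where "m = (if z \<in> P then Min P else Min Q)"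
      have "{z, m} \<notin> cross P Q" by (rule notcr) (use True P(5) Q(5) PQ(3) in \<open>auto simp: m_def\<close>)
      hence "s * t + 1 = card (insert {z, m} (cross P Q))" using fc ccross[OF PQ] by simp
      also have "\<dots> \<le> card (S2 (P, Q, z))"
        by (rule card_mono[OF finite_subset[OF sub finA]]) (auto simp: S2_def m_def)
      finally have "p ^ card (S2 (P, Q, z)) \<le> p ^ (s * t + 1)" by (rule power_decreasing) (use p in auto)
      moreover have "0 \<le> p ^ (s * t + 2)" using p by simp
      ultimately show ?thesis using sub True by simp
    qed
  qed
  define w where "w = case_sum (\<lambda>_::nat set. 1 :: real) (\<lambda>_::nat set \<times> nat set \<times> nat. -1)"
  obtain R where R: "R \<subseteq> A" "(\<Sum>i\<in>Tri <+> Bad. w i * p ^ card (case_sum S1 S2 i)) \<le> (\<Sum>i\<in>{i \<in> Tri <+> Bad. case_sum S1 S2 i \<subseteq> R}. w i)"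
  proof (rule exists_subset_ge_average_subset[OF finA, of "Tri <+> Bad" p "case_sum S1 S2" w])
    have "S2 b \<subseteq> A" if "b \<in> Bad" for b using S2 that by (cases b) blast
    thus "case_sum S1 S2 i \<subseteq> A" if "i \<in> Tri <+> Bad" for i
      using that S1(1) by (elim PlusE) simp_all
  qed (use finTri finBad p in auto)
  define TR where "TR = {e\<in>Tri. S1 e \<subseteq> R}"
  define BR where "BR = {b\<in>Bad. S2 b \<subseteq> R}"
  have finR: "finite TR" "finite BR" using finTri finBad by (auto simp: TR_def BR_def)
  have "{i \<in> Tri <+> Bad. case_sum S1 S2 i \<subseteq> R} = TR <+> BR" by (auto simp: TR_def BR_def)
  hence rhs: "(\<Sum>i\<in>{i \<in> Tri <+> Bad. case_sum S1 S2 i \<subseteq> R}. w i) = real (card TR) - real (card BR)"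
    using finR by (simp add: sum.Plus w_def)
  have "(\<Sum>b\<in>Bad. p ^ card (S2 b)) \<le> (\<Sum>(P, Q, z)\<in>Bad. p ^ (s * t + 2) + (if z \<in> P \<union> Q then p ^ (s * t + 1) else 0))"
    using S2 by (intro sum_mono) (auto simp del: power_add)
  also have "\<dots> \<le> (\<Sum>(P, Q, z)\<in>Ps s \<times> Ps t \<times> ?V. p ^ (s * t + 2) + (if z \<in> P \<union> Q then p ^ (s * t + 1) else 0))"
    by (rule sum_mono2) (use finPs Badsub p in \<open>auto\<close>)
  also have "\<dots> = (\<Sum>P\<in>Ps s. \<Sum>Q\<in>Ps t. \<Sum>z\<in>?V. p ^ (s * t + 2) + (if z \<in> P \<union> Q then p ^ (s * t + 1) else 0))"
    by (simp add: sum.cartesian_product[symmetric])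
  also have "\<dots> \<le> (\<Sum>P\<in>Ps s. \<Sum>Q\<in>Ps t. real n * p ^ (s * t + 2) + real (s + t) * p ^ (s * t + 1))"
  proof (intro sum_mono)
    fix P Q assume PQ: "P \<in> Ps s" "Q \<in> Ps t"
    have "(\<Sum>z\<in>?V. (if z \<in> P \<union> Q then p ^ (s * t + 1) else 0)) = real (card {z\<in>?V. z \<in> P \<union> Q}) * p ^ (s * t + 1)"
      by (simp add: sum.If_cases Int_def)
    also have "\<dots> \<le> real (s + t) * p ^ (s * t + 1)"
    proof (rule mult_right_mono)
      have "card {z\<in>?V. z \<in> P \<union> Q} \<le> card (P \<union> Q)"
        using PsD(1)[OF PQ(1) st(1)] PsD(1)[OF PQ(2) st(2)] by (intro card_mono) auto
      also have "\<dots> \<le> s + t" using card_Un_le[of P Q] PQ by (simp add: Ps_def)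
      finally show "real (card {z\<in>?V. z \<in> P \<union> Q}) \<le> real (s + t)" by (simp only: of_nat_le_iff)
    qed (use p in simp)
    finally show "(\<Sum>z\<in>?V. p ^ (s * t + 2) + (if z \<in> P \<union> Q then p ^ (s * t + 1) else 0))
        \<le> real n * p ^ (s * t + 2) + real (s + t) * p ^ (s * t + 1)"
      by (simp add: sum.distrib del: power_add)
  qed
  also have "\<dots> = real (n choose s) * real (n choose t) * (real n * p ^ (s * t + 2) + real (s + t) * p ^ (s * t + 1))"
    by (simp add: cPs)
  also have "\<dots> \<le> real n ^ s * real n ^ t * (real n * p ^ (s * t + 2) + real (s + t) * p ^ (s * t + 1))"
  proof (intro mult_right_mono mult_mono)
    show "real (n choose s) \<le> real n ^ s" "real (n choose t) \<le> real n ^ t"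
      using binomial_le_power[of n s] binomial_le_power[of n t] by (simp_all add: of_nat_power[symmetric] del: of_nat_power)
  qed (use p in auto)
  finally have bad: "(\<Sum>b\<in>Bad. p ^ card (S2 b)) \<le> real n ^ s * real n ^ t * (real n * p ^ (s * t + 2) + real (s + t) * p ^ (s * t + 1))" .
  have "(\<Sum>i\<in>Tri <+> Bad. w i * p ^ card (case_sum S1 S2 i)) = (\<Sum>e\<in>Tri. p ^ card (S1 e)) - (\<Sum>b\<in>Bad. p ^ card (S2 b))"
    using finTri finBad by (simp add: sum.Plus w_def sum_negf)
  also have "(\<Sum>e\<in>Tri. p ^ card (S1 e)) = real (n choose 3) * p ^ 3"
    using S1(2) by (simp add: cTri)
  finally have main: "real (n choose 3) * p ^ 3 - real n ^ s * real n ^ t * (real n * p ^ (s * t + 2) + real (s + t) * p ^ (s * t + 1))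
     \<le> real (card TR) - real (card BR)"
    using R(2) bad unfolding rhs by linarith
  define E where "E = TR - (\<lambda>(P, Q, z). {Min P, Min Q, z}) ` BR"
  show ?thesis
  proof (rule that[of E])
    show "\<Union>E \<subseteq> ?V" by (auto simp: E_def TR_def Tri_def)
    show E3: "card e = 3" if "e \<in> E" for e using that by (auto simp: E_def TR_def Tri_def)
    have "real (card TR) - real (card BR) \<le> card E"
    proof -
      have "card TR - card ((\<lambda>(P, Q, z). {Min P, Min Q, z}) ` BR) \<le> card E"
        unfolding E_def by (rule diff_card_le_card_Diff) (use finR in simp)
      moreover have "card ((\<lambda>(P, Q, z). {Min P, Min Q, z}) ` BR) \<le> card BR" by (rule card_image_le[OF finR(2)])
      ultimately show ?thesis by linarith
    qed
    thus "real (n choose 3) * p ^ 3 - real n ^ s * real n ^ t * (real n * p ^ (s * t + 2) + real (s + t) * p ^ (s * t + 1)) \<le> card E"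
      using main by linarith
    define G where "G x y \<longleftrightarrow> x \<noteq> y \<and> (\<exists>e\<in>E. x \<in> e \<and> y \<in> e)" for x y
    have GR: "{x, y} \<in> R \<and> x < n \<and> y < n" if "G x y" for x y
    proof -
      from that obtain e where e: "e \<in> E" "x \<in> e" "y \<in> e" and ne: "x \<noteq> y" by (auto simp: G_def)
      have "{x, y} \<in> S1 e" using e ne by (auto simp: S1_def)
      moreover have "e \<in> Tri" "S1 e \<subseteq> R" using e by (auto simp: E_def TR_def)
      ultimately show ?thesis using e by (auto simp: Tri_def)
    qed
    have "kst_free s t G"
      unfolding kst_free_def
    proof (intro allI impI notI)
      fix P Q assume fin: "finite P" "finite Q" and c: "card P = s" "card Q = t" and all: "\<forall>x\<in>P. \<forall>y\<in>Q. G x y"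
      have ne: "P \<noteq> {}" "Q \<noteq> {}" using c st by auto
      have mem: "Min P \<in> P" "Min Q \<in> Q" using fin ne by auto
      have sub: "P \<subseteq> ?V" "Q \<subseteq> ?V" using all GR ne by blast+
      have disj: "P \<inter> Q = {}" using all by (auto simp: G_def)
      have Ps: "P \<in> Ps s" "Q \<in> Ps t" using sub c by (auto simp: Ps_def)
      \<comment> \<open>Edges of \<open>G\<close> come from surviving triples. So the singled-out
        edge lies in some \<open>e \<in> E\<close>, whose third vertex \<open>z\<close> puts
        \<open>(P, Q, z)\<close> into \<open>BR\<close>, and \<open>e\<close> has been
        deleted.\<close>
      have "G (Min P) (Min Q)" using all mem by blast
      then obtain e where e: "e \<in> E" "Min P \<in> e" "Min Q \<in> e" and neq: "Min P \<noteq> Min Q" by (auto simp: G_def)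
      have fe: "finite e" using E3[OF e(1)] by (metis card.infinite zero_neq_numeral)
      have "card (e - {Min P, Min Q}) = 1" using E3[OF e(1)] e neq fe by (subst card_Diff_subset) auto
      then obtain z where z: "e - {Min P, Min Q} = {z}" by (auto simp: card_1_singleton_iff)
      have eq: "e = {Min P, Min Q, z}" and zne: "z \<noteq> Min P" "z \<noteq> Min Q" using z e(2,3) by auto
      have "z \<in> e" using z by blast
      hence "G z (Min P)" "G z (Min Q)" unfolding G_def using zne e(1-3) by blast+
      from GR[OF this(1)] GR[OF this(2)] have zR: "{z, Min P} \<in> R" "{z, Min Q} \<in> R" "z < n" by simp_all
      have "cross P Q \<subseteq> R" using all GR by (auto simp: cross_def)
      hence "(P, Q, z) \<in> BR" using zR zne Ps disj by (auto simp: BR_def Bad_def S2_def)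
      hence "e \<in> (\<lambda>(P, Q, z). {Min P, Min Q, z}) ` BR" unfolding eq by (rule rev_image_eqI) simp
      thus False using e(1) by (simp add: E_def)
    qed
    thus "\<not> kst_copy s t E"
      by (rule kst_free_imp_not_kst_copy) (auto simp: G_def)
  qed
qed

section \<open>A tripartite construction inside a dense host graph\<close>

text \<open>A maximiser of the degree sum minus \<open>2 * \<delta> * card U\<close> has minimum
  degree at least \<open>\<delta>\<close>, since deleting \<open>x\<close> lowers the degree sum by
  twice the degree of \<open>x\<close>. Comparison with \<open>V\<close> shows that half of the
  degree sum survives.\<close>

lemma dense_core:
  fixes \<delta> :: real
  assumes fin: "finite V" and sym: "\<And>x y. A x y \<Longrightarrow> A y x" and irr: "\<And>x. \<not> A x x"
    and \<delta>: "4 * \<delta> * card V \<le> (\<Sum>x\<in>V. real (card {y\<in>V. A x y}))"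
  obtains U where "U \<subseteq> V" "\<And>x. x \<in> U \<Longrightarrow> \<delta> \<le> card {y\<in>U. A x y}"
    "(\<Sum>x\<in>V. real (card {y\<in>V. A x y})) \<le> 2 * (\<Sum>x\<in>U. real (card {y\<in>U. A x y}))"
proof (cases "\<delta> \<ge> 0")
  case False
  show ?thesis
  proof (rule that[of V])
    show "\<delta> \<le> card {y\<in>V. A x y}" for x using False by linarith
    have "0 \<le> (\<Sum>x\<in>V. real (card {y\<in>V. A x y}))" by (simp add: sum_nonneg)
    thus "(\<Sum>x\<in>V. real (card {y\<in>V. A x y})) \<le> 2 * (\<Sum>x\<in>V. real (card {y\<in>V. A x y}))" by linarith
  qed simp
next
  case \<delta>0: True
  define D where "D U = (\<Sum>x\<in>U. real (card {y\<in>U. A x y}))" for U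
  define \<Phi> where "\<Phi> U = D U - 2 * \<delta> * card U" for U
  have "\<exists>U\<in>Pow V. \<forall>W\<in>Pow V. \<Phi> W \<le> \<Phi> U"
  proof -
    have "Max (\<Phi> ` Pow V) \<in> \<Phi> ` Pow V" using fin by (intro Max_in) auto
    then obtain U where "U \<in> Pow V" "\<Phi> U = Max (\<Phi> ` Pow V)" by force
    moreover have "\<Phi> W \<le> Max (\<Phi> ` Pow V)" if "W \<in> Pow V" for W using fin that by (intro Max_ge) auto
    ultimately show ?thesis by metis
  qed
  then obtain U where U: "U \<subseteq> V" "\<And>W. W \<subseteq> V \<Longrightarrow> \<Phi> W \<le> \<Phi> U" by blast
  have finU: "finite U" using U(1) fin finite_subset by blast
  show ?thesis
  proof (rule that[OF U(1)])
    fix x assume x: "x \<in> U"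
    let ?U' = "U - {x}"
    have "D U = card {y\<in>U. A x y} + (\<Sum>z\<in>?U'. real (card {y\<in>U. A z y}))"
      unfolding D_def by (rule sum.remove[OF finU x])
    also have "(\<Sum>z\<in>?U'. real (card {y\<in>U. A z y})) = (\<Sum>z\<in>?U'. real (card {y\<in>?U'. A z y}) + (if A x z then 1 else 0))"
    proof (rule sum.cong[OF refl])
      fix z assume "z \<in> ?U'"
      show "real (card {y\<in>U. A z y}) = real (card {y\<in>?U'. A z y}) + (if A x z then 1 else 0)"
      proof (cases "A x z")
        case True
        have "{y\<in>U. A z y} = insert x {y\<in>?U'. A z y}" using sym[OF True] x by auto
        thus ?thesis using finU True by simp
      next
        case False
        hence "{y\<in>U. A z y} = {y\<in>?U'. A z y}" using sym by blast
        thus ?thesis using False by simp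
      qed
    qed
    also have "\<dots> = D ?U' + card {z\<in>?U'. A x z}"
      unfolding D_def using finU by (simp add: sum.distrib sum.If_cases Int_def)
    also have "{z\<in>?U'. A x z} = {y\<in>U. A x y}" using irr by auto
    finally have 1: "D U = D ?U' + 2 * card {y\<in>U. A x y}" by simp
    have "card U = Suc (card ?U')" using finU x by (metis card_Suc_Diff1)
    moreover have "\<Phi> ?U' \<le> \<Phi> U" using U by blast
    ultimately show "\<delta> \<le> card {y\<in>U. A x y}" using 1 by (simp add: \<Phi>_def algebra_simps)
  next
    have "\<Phi> V \<le> \<Phi> U" using U(2) by simp
    moreover have "0 \<le> 2 * \<delta> * card U" using \<delta>0 by simp
    ultimately have "D V - 2 * \<delta> * card V \<le> D U" unfolding \<Phi>_def by linarith
    thus "(\<Sum>x\<in>V. real (card {y\<in>V. A x y})) \<le> 2 * (\<Sum>x\<in>U. real (card {y\<in>U. A x y}))"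
      using \<delta> unfolding D_def by linarith
  qed
qed

lemma kst_free_card_common:
  assumes "kst_free s t A" "finite S" "card S = s" "t > 0"
  shows "card {x\<in>X. \<forall>y\<in>S. A y x} < t"
proof (rule ccontr)
  assume "\<not> ?thesis"
  then obtain T where "T \<subseteq> {x\<in>X. \<forall>y\<in>S. A y x}" "card T = t" "finite T"
    by (meson obtain_subset_with_card_n not_less)
  thus False using assms unfolding kst_free_def by blast
qed

text \<open>With \<open>k = s - card S\<close>: a common neighbour of \<open>S\<close> has at least
  \<open>\<delta> / 2\<close> neighbours outside \<open>S\<close>, hence at least
  \<open>(\<delta> / (2 * s)) ^ k\<close> sets \<open>T\<close> of \<open>k\<close> of them, while
  each \<open>S \<union> T\<close> has fewer than \<open>t\<close> common neighbours. A power of a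
  base independent of \<open>S\<close> lets the bounds for two sets be multiplied later.\<close>

lemma common_neighbours_bound:
  fixes \<delta> :: real
  assumes fin: "finite U" and sym: "\<And>x y. A x y \<Longrightarrow> A y x"
    and free: "kst_free s t A" and t: "t > 0"
    and deg: "\<And>x. x \<in> U \<Longrightarrow> \<delta> \<le> card {y\<in>U. A x y}" and \<delta>: "2 * real s \<le> \<delta>"
    and S: "S \<subseteq> U" "card S < s" and N: "card U \<le> N"
  shows "card {x\<in>U. \<forall>y\<in>S. A x y} \<le> (2 * real s * real t * real N / \<delta>) ^ (s - card S)"
proof -
  define k where "k = s - card S"
  have k: "k > 0" "k \<le> s" using S by (auto simp: k_def)
  have finS: "finite S" using S fin finite_subset by blast
  define M where "M = {x\<in>U. \<forall>y\<in>S. A x y}"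
  have \<delta>0: "\<delta> > 0" using \<delta> k by linarith
  have each: "(\<delta> / (2 * s)) ^ k \<le> card {y\<in>U - S. A x y} choose k" if x: "x \<in> M" for x
  proof -
    have xU: "x \<in> U" using x by (simp add: M_def)
    have "card {y\<in>U. A x y} - card S \<le> card ({y\<in>U. A x y} - S)" by (rule diff_card_le_card_Diff[OF finS])
    also have "{y\<in>U. A x y} - S = {y\<in>U - S. A x y}" by auto
    finally have d: "\<delta> / 2 \<le> card {y\<in>U - S. A x y}" using deg[OF xU] \<delta> S(2) by linarith
    hence kd: "k \<le> card {y\<in>U - S. A x y}" using \<delta> k by linarith
    have "\<delta> / (2 * s) = (\<delta> / 2) / s" by simp
    also have "\<dots> \<le> real (card {y\<in>U - S. A x y}) / k"
      using d k \<delta>0 by (intro frac_le) auto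
    finally have "(\<delta> / (2 * s)) ^ k \<le> (real (card {y\<in>U - S. A x y}) / k) ^ k"
      using \<delta>0 by (intro power_mono) auto
    also have "\<dots> \<le> card {y\<in>U - S. A x y} choose k" by (rule binomial_ge_n_over_k_pow_k[OF kd])
    finally show ?thesis .
  qed
  have "card M * (\<delta> / (2 * s)) ^ k \<le> (\<Sum>x\<in>M. real (card {y\<in>U - S. A x y} choose k))"
    using each sum_bounded_below[of M "(\<delta> / (2 * s)) ^ k" "\<lambda>x. real (card {y\<in>U - S. A x y} choose k)"] by simp
  also have "\<dots> = real (\<Sum>T | T \<subseteq> U - S \<and> card T = k. card {x\<in>M. \<forall>y\<in>T. A x y})"
    by (subst sum_binomial_double_count[symmetric]) (use fin in \<open>auto simp: M_def\<close>)
  also have "\<dots> \<le> real (\<Sum>T | T \<subseteq> U - S \<and> card T = k. t)"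
  proof (intro of_nat_mono sum_mono)
    fix T assume T: "T \<in> {T. T \<subseteq> U - S \<and> card T = k}"
    have finT: "finite T" using T fin finite_subset[of T "U - S"] by auto
    have "S \<inter> T = {}" using T by auto
    hence "card (S \<union> T) = s" using T finS finT S(2) by (simp add: card_Un_disjoint k_def)
    hence "card {x\<in>U. \<forall>y\<in>S \<union> T. A y x} < t"
      using finS finT t by (intro kst_free_card_common[OF free]) auto
    moreover have "{x\<in>M. \<forall>y\<in>T. A x y} = {x\<in>U. \<forall>y\<in>S \<union> T. A y x}" using sym by (auto simp: M_def)
    ultimately show "card {x\<in>M. \<forall>y\<in>T. A x y} \<le> t" by simp
  qed
  also have "\<dots> = real t * real (card (U - S) choose k)" using fin by (simp add: n_subsets)
  also have "\<dots> \<le> real t ^ k * real N ^ k"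
  proof (intro mult_mono)
    show "real t \<le> real t ^ k" using t k by (intro self_le_power) auto
    have "card (U - S) \<le> N" using N card_mono[OF fin, of "U - S"] by simp
    hence "card (U - S) ^ k \<le> N ^ k" by (intro power_mono) auto
    hence "card (U - S) choose k \<le> N ^ k" using binomial_le_power[of "card (U - S)" k] by linarith
    thus "real (card (U - S) choose k) \<le> real N ^ k" by (metis of_nat_le_iff of_nat_power)
  qed auto
  finally have "card M * (\<delta> / (2 * s)) ^ k \<le> (real t * real N) ^ k" by (simp add: power_mult_distrib)
  moreover have "(\<delta> / (2 * s)) ^ k > 0" using \<delta>0 k by simp
  ultimately have "card M \<le> (real t * real N) ^ k / (\<delta> / (2 * s)) ^ k" by (simp add: pos_le_divide_eq)
  also have "\<dots> = (real t * real N / (\<delta> / (2 * s))) ^ k" by (rule power_divide[symmetric])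
  also have "real t * real N / (\<delta> / (2 * s)) = 2 * real s * real t * real N / \<delta>" by simp
  finally show ?thesis by (simp add: M_def k_def)
qed

text \<open>A walk \<open>c, a, b, d\<close> becomes a triangle of the twisted graph once
  \<open>\<pi> c = d\<close>. If every vertex goes to \<open>V1\<close> with probability 1/2, a walk
  is split as required with probability at least 1/16; coincidence of \<open>c\<close> and
  \<open>d\<close> only helps.\<close>

lemma crossing_paths_bipartition:
  fixes \<delta> :: real
  assumes fin: "finite U" and sym: "\<And>x y. A x y \<Longrightarrow> A y x" and irr: "\<And>x. \<not> A x x"
    and deg: "\<And>x. x \<in> U \<Longrightarrow> \<delta> \<le> card {y\<in>U. A x y}" and \<delta>: "1 \<le> \<delta>"
  obtains V1 V2 where "V1 \<union> V2 = U" "V1 \<inter> V2 = {}"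
    "(\<Sum>x\<in>U. real (card {y\<in>U. A x y})) * (\<delta> - 1)\<^sup>2 / 16
       \<le> card {(a, b, c, d). a \<in> V1 \<and> b \<in> V1 \<and> c \<in> V2 \<and> d \<in> V2 \<and> A a b \<and> A a c \<and> A b d}"
proof -
  define I where "I = (SIGMA a:U. SIGMA b:{b\<in>U. A a b}. ({c\<in>U. A a c} - {b}) \<times> ({d\<in>U. A b d} - {a}))"
  define S T where "S = (\<lambda>(a, b, c :: 'a, d :: 'a). {a, b :: 'a})" and "T = (\<lambda>(a :: 'a, b :: 'a, c, d). {c, d :: 'a})"
  have finI: "finite I" unfolding I_def using fin by auto
  have "(\<delta> - 1)\<^sup>2 * (\<Sum>x\<in>U. real (card {y\<in>U. A x y})) = (\<Sum>a\<in>U. \<Sum>b\<in>{b\<in>U. A a b}. (\<delta> - 1) * (\<delta> - 1))"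
    by (simp add: sum_distrib_left power2_eq_square mult.commute)
  also have "\<dots> \<le> (\<Sum>a\<in>U. \<Sum>b\<in>{b\<in>U. A a b}. real (card ({c\<in>U. A a c} - {b})) * real (card ({d\<in>U. A b d} - {a})))"
  proof (intro sum_mono mult_mono)
    fix a b assume ab: "a \<in> U" "b \<in> {b\<in>U. A a b}"
    have "card ({c\<in>U. A a c} - {b}) = card {c\<in>U. A a c} - 1" "card ({d\<in>U. A b d} - {a}) = card {d\<in>U. A b d} - 1"
      using ab sym by (auto intro!: card_Diff_singleton)
    thus "\<delta> - 1 \<le> card ({c\<in>U. A a c} - {b})" "\<delta> - 1 \<le> card ({d\<in>U. A b d} - {a})"
      using deg[of a] deg[of b] ab \<delta> by auto
  qed (use \<delta> in auto)
  also have "\<dots> = real (card I)" unfolding I_def using fin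
    by (simp add: card_SigmaI card_cartesian_product)
  finally have cI: "(\<delta> - 1)\<^sup>2 * (\<Sum>x\<in>U. real (card {y\<in>U. A x y})) \<le> card I" .
  have "\<exists>R\<subseteq>U. (\<Sum>i\<in>I. 1 * ((1/2) ^ card (S i) * (1 - 1/2) ^ card (T i))) \<le> (\<Sum>i\<in>{i\<in>I. S i \<subseteq> R \<and> T i \<inter> R = {}}. (1::real))"
  proof (rule exists_subset_ge_average[OF fin finI])
    fix i assume i: "i \<in> I"
    obtain a b c d where "i = (a, b, c, d)" by (cases i)
    thus "S i \<subseteq> U" "T i \<subseteq> U" "S i \<inter> T i = {}"
      using i irr by (auto simp: S_def T_def I_def)
  qed auto
  then obtain R where R: "R \<subseteq> U" "(\<Sum>i\<in>I. (1/2::real) ^ card (S i) * (1/2) ^ card (T i)) \<le> card {i\<in>I. S i \<subseteq> R \<and> T i \<inter> R = {}}"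
    by auto
  have "real (card I) / 16 = (\<Sum>i\<in>I. (1/2::real) ^ 2 * (1/2) ^ 2)" by (simp add: power2_eq_square)
  also have "\<dots> \<le> (\<Sum>i\<in>I. (1/2::real) ^ card (S i) * (1/2) ^ card (T i))"
  proof (intro sum_mono mult_mono power_decreasing)
    fix i
    show "card (S i) \<le> 2" "card (T i) \<le> 2"
      by (cases i; simp add: S_def T_def card_insert_if)+
  qed auto
  also note R(2)
  also have "real (card {i\<in>I. S i \<subseteq> R \<and> T i \<inter> R = {}})
      \<le> card {(a, b, c, d). a \<in> R \<and> b \<in> R \<and> c \<in> U - R \<and> d \<in> U - R \<and> A a b \<and> A a c \<and> A b d}"
  proof (intro of_nat_mono card_mono)
    show "finite {(a, b, c, d). a \<in> R \<and> b \<in> R \<and> c \<in> U - R \<and> d \<in> U - R \<and> A a b \<and> A a c \<and> A b d}"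
      by (rule finite_subset[of _ "U \<times> U \<times> U \<times> U"]) (use R(1) fin in auto)
  qed (auto simp: I_def S_def T_def)
  finally have "(\<Sum>x\<in>U. real (card {y\<in>U. A x y})) * (\<delta> - 1)\<^sup>2 / 16
      \<le> card {(a, b, c, d). a \<in> R \<and> b \<in> R \<and> c \<in> U - R \<and> d \<in> U - R \<and> A a b \<and> A a c \<and> A b d}"
    using cI by (simp add: mult.commute)
  moreover have "R \<union> (U - R) = U" using R(1) by auto
  ultimately show ?thesis using that[of R "U - R"] by auto
qed

text \<open>The tripartite graph has parts \<open>{0} \<times> V1\<close>, \<open>{1} \<times> V1\<close> and \<open>{2} \<times> V2\<close>; the edges between the second and
  the third part are twisted by \<open>\<pi>\<close>. A copy of \<open>K\<^sub>s\<^sub>,\<^sub>t\<close> with a side contained in one of the first two parts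
  projects to a copy in \<open>A\<close>, which leaves only the bicliques with one side in the third part.\<close>

definition twisted_triangles :: "('a \<Rightarrow> 'a \<Rightarrow> bool) \<Rightarrow> ('a \<Rightarrow> 'a) \<Rightarrow> 'a set \<Rightarrow> 'a set \<Rightarrow> ('a \<times> 'a \<times> 'a) set" where
  "twisted_triangles A \<pi> V1 V2 = {(a, b, c). a \<in> V1 \<and> b \<in> V1 \<and> c \<in> V2 \<and> \<pi> c \<in> V2 \<and> A a b \<and> A a c \<and> A b (\<pi> c)}"

definition twisted_bicliques :: "('a \<Rightarrow> 'a \<Rightarrow> bool) \<Rightarrow> ('a \<Rightarrow> 'a) \<Rightarrow> 'a set \<Rightarrow> 'a set \<Rightarrow> nat \<Rightarrow> nat \<Rightarrow> ('a set \<times> 'a set \<times> 'a set) set" where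
  "twisted_bicliques A \<pi> V1 V2 k l = {(X, Y, Z). X \<subseteq> V2 \<and> \<pi> ` X \<subseteq> V2 \<and> Y \<subseteq> V1 \<and> Z \<subseteq> V1 \<and> Y \<noteq> {} \<and> Z \<noteq> {} \<and>
     card X = k \<and> card Y + card Z = l \<and> (\<forall>x\<in>X. (\<forall>y\<in>Y. A y x) \<and> (\<forall>z\<in>Z. A z (\<pi> x)))}"

text \<open>Only edges at the third part are thinned, so a triangle survives with probability
  \<open>p\<^sup>2\<close> and a biclique with probability \<open>p ^ (s * t)\<close>. A surviving
  biclique is destroyed by deleting all triples through one of its edges between the first and the
  third part; these are at most \<open>L\<close>, because the remaining vertex is a neighbour of
  \<open>a\<close> in \<open>V1\<close>.\<close>

lemma tripartite_thinning:
  fixes A :: "'a \<Rightarrow> 'a \<Rightarrow> bool" and p L :: real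
  assumes fin: "finite V1" "finite V2" and disj: "V1 \<inter> V2 = {}"
    and sym: "\<And>x y. A x y \<Longrightarrow> A y x" and free: "kst_free s t A"
    and \<pi>: "inj \<pi>" and st: "s > 0" "t > 0" and p: "0 \<le> p" "p \<le> 1"
    and L: "\<And>a. a \<in> V1 \<Longrightarrow> card {b\<in>V1. A a b} \<le> L"
  obtains E :: "(nat \<times> 'a) set set" where
    "\<Union>E \<subseteq> {0} \<times> V1 \<union> {1} \<times> V1 \<union> {2} \<times> V2" "\<And>e. e \<in> E \<Longrightarrow> card e = 3" "\<not> kst_copy s t E"
    "p\<^sup>2 * card (twisted_triangles A \<pi> V1 V2)
       - L * p ^ (s * t) * card (twisted_bicliques A \<pi> V1 V2 s t \<union> twisted_bicliques A \<pi> V1 V2 t s) \<le> card E"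
proof -
  define Tri where "Tri = twisted_triangles A \<pi> V1 V2"
  define Bad where "Bad = twisted_bicliques A \<pi> V1 V2 s t \<union> twisted_bicliques A \<pi> V1 V2 t s"
  define AA where "AA = {0, 1 :: nat} \<times> V1 \<times> V2"
  define S1 where "S1 = (\<lambda>(a :: 'a, b :: 'a, c). {(0 :: nat, a, c), (1, b, c :: 'a)})"
  define S2 where "S2 = (\<lambda>(X :: 'a set, Y :: 'a set, Z :: 'a set). {0} \<times> Y \<times> X \<union> {1 :: nat} \<times> Z \<times> X)"
  define del where "del = (\<lambda>(X :: 'a set, Y :: 'a set, Z :: 'a set). {(a, b, c). (a, b, c) \<in> Tri \<and> a = (SOME y. y \<in> Y) \<and> c = (SOME x. x \<in> X)})"
  define tri where "tri = (\<lambda>(a :: 'a, b :: 'a, c :: 'a). {(0 :: nat, a), (1, b), (2, c)})"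
  have finAA: "finite AA" using fin by (simp add: AA_def)
  have Trisub: "Tri \<subseteq> V1 \<times> V1 \<times> V2" by (auto simp: Tri_def twisted_triangles_def)
  have finTri: "finite Tri" by (rule finite_subset[OF Trisub]) (use fin in auto)
  have Badsub: "Bad \<subseteq> Pow V2 \<times> Pow V1 \<times> Pow V1" by (auto simp: Bad_def twisted_bicliques_def)
  have finBad: "finite Bad" by (rule finite_subset[OF Badsub]) (use fin in auto)
  have S1: "S1 i \<subseteq> AA" "card (S1 i) = 2" if "i \<in> Tri" for i
    using that Trisub by (auto simp: S1_def AA_def)
  have BadD: "finite X" "finite Y" "finite Z" "X \<noteq> {}" "Y \<noteq> {}" "Z \<noteq> {}" "X \<subseteq> V2" "Y \<subseteq> V1" "Z \<subseteq> V1" "card X * (card Y + card Z) = s * t"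
    if B: "(X, Y, Z) \<in> Bad" for X Y Z
  proof -
    have sub: "X \<subseteq> V2" "Y \<subseteq> V1" "Z \<subseteq> V1" using B Badsub by auto
    thus "finite X" "finite Y" "finite Z" "X \<subseteq> V2" "Y \<subseteq> V1" "Z \<subseteq> V1" using fin finite_subset by blast+
    show "X \<noteq> {}" "Y \<noteq> {}" "Z \<noteq> {}" "card X * (card Y + card Z) = s * t"
      using B st by (auto simp: Bad_def twisted_bicliques_def)
  qed
  have S2: "S2 i \<subseteq> AA" "card (S2 i) = s * t" if i: "i \<in> Bad" for i
  proof -
    obtain X Y Z where eq: "i = (X, Y, Z)" by (cases i)
    note B = BadD[OF i[unfolded eq]]
    show "S2 i \<subseteq> AA" using B(7-9) by (auto simp: eq S2_def AA_def)
    have "card (S2 i) = card ({0 :: nat} \<times> Y \<times> X) + card ({1 :: nat} \<times> Z \<times> X)"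
      unfolding eq S2_def prod.case using B(1-3) by (intro card_Un_disjoint) auto
    thus "card (S2 i) = s * t" using B(10) by (simp add: card_cartesian_product algebra_simps)
  qed
  have del: "card (del i) \<le> L" if i: "i \<in> Bad" for i
  proof -
    obtain X Y Z where eq: "i = (X, Y, Z)" by (cases i)
    note B = BadD[OF i[unfolded eq]]
    define a c where "a = (SOME y. y \<in> Y)" and "c = (SOME x. x \<in> X)"
    have a: "a \<in> V1" using B(5,8) some_in_eq[of Y] by (auto simp: a_def)
    have "del i \<subseteq> (\<lambda>b. (a, b, c)) ` {b\<in>V1. A a b}"
      by (auto simp: eq del_def Tri_def twisted_triangles_def a_def c_def)
    hence "card (del i) \<le> card {b\<in>V1. A a b}" using fin(1) by (intro surj_card_le) auto
    thus ?thesis using L[OF a] by linarith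
  qed
  define w where "w = case_sum (\<lambda>_::'a \<times> 'a \<times> 'a. 1 :: real) (\<lambda>_::'a set \<times> 'a set \<times> 'a set. -L)"
  obtain R where R: "R \<subseteq> AA" "(\<Sum>i\<in>Tri <+> Bad. w i * p ^ card (case_sum S1 S2 i)) \<le> (\<Sum>i\<in>{i \<in> Tri <+> Bad. case_sum S1 S2 i \<subseteq> R}. w i)"
  proof (rule exists_subset_ge_average_subset[OF finAA, of "Tri <+> Bad" p "case_sum S1 S2" w])
    show "case_sum S1 S2 i \<subseteq> AA" if "i \<in> Tri <+> Bad" for i
      using that S1(1) S2(1) by (elim PlusE) simp_all
  qed (use finTri finBad p in auto)
  define TR where "TR = {e\<in>Tri. S1 e \<subseteq> R}"
  define BR where "BR = {b\<in>Bad. S2 b \<subseteq> R}"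
  have finR: "finite TR" "finite BR" using finTri finBad by (auto simp: TR_def BR_def)
  have "{i \<in> Tri <+> Bad. case_sum S1 S2 i \<subseteq> R} = TR <+> BR" by (auto simp: TR_def BR_def)
  hence rhs: "(\<Sum>i\<in>{i \<in> Tri <+> Bad. case_sum S1 S2 i \<subseteq> R}. w i) = real (card TR) - L * real (card BR)"
    using finR by (simp add: sum.Plus w_def)
  have "(\<Sum>i\<in>Tri <+> Bad. w i * p ^ card (case_sum S1 S2 i)) = p\<^sup>2 * card Tri - L * p ^ (s * t) * card Bad"
    using finTri finBad S1(2) S2(2) by (simp add: sum.Plus w_def)
  hence main: "p\<^sup>2 * card Tri - L * p ^ (s * t) * card Bad \<le> real (card TR) - L * real (card BR)"
    using R(2) rhs by simp
  define TE where "TE = TR - (\<Union>i\<in>BR. del i)"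
  have injtri: "inj tri" by (auto simp: inj_def tri_def doubleton_eq_iff insert_eq_iff)
  define E where "E = tri ` TE"
  have finDel: "finite (\<Union>i\<in>BR. del i)"
    by (rule finite_subset[OF _ finTri]) (auto simp: del_def)
  have "real (card TR) - L * real (card BR) \<le> card E"
  proof -
    have "card TR - card (\<Union>i\<in>BR. del i) \<le> card TE"
      unfolding TE_def by (rule diff_card_le_card_Diff[OF finDel])
    moreover have "real (card (\<Union>i\<in>BR. del i)) \<le> L * card BR"
    proof -
      have "real (card (\<Union>i\<in>BR. del i)) \<le> (\<Sum>i\<in>BR. real (card (del i)))"
        using card_UN_le[OF finR(2), of del] by (metis of_nat_le_iff of_nat_sum)
      also have "\<dots> \<le> (\<Sum>i\<in>BR. L)" using del by (intro sum_mono) (auto simp: BR_def)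
      finally show ?thesis by (simp add: mult.commute)
    qed
    moreover have "card E = card TE" unfolding E_def by (rule card_image[OF inj_on_subset[OF injtri]]) simp
    ultimately show ?thesis by linarith
  qed
  hence count: "p\<^sup>2 * card Tri - L * p ^ (s * t) * card Bad \<le> card E" using main by linarith
  define G where "G x y \<longleftrightarrow> x \<noteq> y \<and> (\<exists>e\<in>E. x \<in> e \<and> y \<in> e)" for x y
  have Gsym: "G x y \<Longrightarrow> G y x" for x y by (auto simp: G_def)
  have TE: "a \<in> V1 \<and> b \<in> V1 \<and> c \<in> V2 \<and> \<pi> c \<in> V2 \<and> A a b \<and> A a c \<and> A b (\<pi> c) \<and> (0, a, c) \<in> R \<and> (1, b, c) \<in> R"
    if "(a, b, c) \<in> TE" for a b c
    using that by (auto simp: TE_def TR_def Tri_def twisted_triangles_def S1_def)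
  have Gcases: "(i = 0 \<and> j = 1 \<and> (\<exists>c. (x, y, c) \<in> TE)) \<or> (i = 1 \<and> j = 0 \<and> (\<exists>c. (y, x, c) \<in> TE)) \<or>
     (i = 0 \<and> j = 2 \<and> (\<exists>b. (x, b, y) \<in> TE)) \<or> (i = 2 \<and> j = 0 \<and> (\<exists>b. (y, b, x) \<in> TE)) \<or>
     (i = 1 \<and> j = 2 \<and> (\<exists>a. (a, x, y) \<in> TE)) \<or> (i = 2 \<and> j = 1 \<and> (\<exists>a. (a, y, x) \<in> TE))"
    if "G (i, x) (j, y)" for i j x y
  proof -
    from that obtain e where e: "e \<in> E" "(i, x) \<in> e" "(j, y) \<in> e" and ne: "(i, x) \<noteq> (j, y)" by (auto simp: G_def)
    from e(1) obtain a b c where abc: "(a, b, c) \<in> TE" "e = {(0, a), (1, b), (2, c)}" by (auto simp: E_def tri_def)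
    have "(i = 0 \<and> x = a) \<or> (i = 1 \<and> x = b) \<or> (i = 2 \<and> x = c)" "(j = 0 \<and> y = a) \<or> (j = 1 \<and> y = b) \<or> (j = 2 \<and> y = c)"
      using e(2,3) unfolding abc(2) by simp_all
    thus ?thesis using ne abc(1) by (elim disjE conjE; clarsimp; blast)
  qed
  \<comment> \<open>A side lies in the first or the second part. Forgetting tags, and applying
    \<open>\<pi>\<close> on the third part if \<open>h = 1\<close>, is injective on both sides
    because \<open>V1\<close> and \<open>V2\<close> are disjoint, and it maps the copy into
    \<open>A\<close>.\<close>
  have small: False if XY: "finite X" "finite Y" "(card X = s \<and> card Y = t) \<or> (card X = t \<and> card Y = s)"
    and all: "\<And>x y. x \<in> X \<Longrightarrow> y \<in> Y \<Longrightarrow> G x y" and tag: "\<And>i x. (i, x) \<in> X \<Longrightarrow> i = h" and h: "h = 0 \<or> h = (1::nat)" for X Y h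
  proof -
    define \<phi> where "\<phi> = (\<lambda>(i, x). if i = (2::nat) \<and> h = 1 then \<pi> x else x)"
    have X0: "X \<noteq> {}" "Y \<noteq> {}" using XY st by auto
    obtain i0 x0 where "(i0, x0) \<in> X" using X0(1) by fast
    hence x0: "(h, x0) \<in> X" using tag by blast
    have Ytag: "(j = 1 - h \<and> y \<in> V1) \<or> (j = 2 \<and> \<phi> (j, y) \<in> V2)" if "(j, y) \<in> Y" for j y
      using Gcases[OF all[OF x0 that]] h by (auto simp: \<phi>_def dest: TE)
    have iX: "inj_on \<phi> X"
    proof (rule inj_onI)
      fix u v assume uv: "u \<in> X" "v \<in> X" "\<phi> u = \<phi> v"
      obtain i x where u: "u = (i, x)" by (cases u)
      obtain j y where v: "v = (j, y)" by (cases v)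
      have "i = h" "j = h" using tag uv(1,2) u v by blast+
      thus "u = v" using uv(3) h by (auto simp: u v \<phi>_def)
    qed
    have iY: "inj_on \<phi> Y"
    proof (rule inj_onI)
      fix u v assume uv: "u \<in> Y" "v \<in> Y" "\<phi> u = \<phi> v"
      obtain i x where u: "u = (i, x)" by (cases u)
      obtain j y where v: "v = (j, y)" by (cases v)
      have u1: "(i = 1 - h \<and> \<phi> u = x \<and> x \<in> V1) \<or> (i = 2 \<and> \<phi> u \<in> V2)"
        using Ytag[of i x] uv(1) h by (auto simp: u \<phi>_def)
      have v1: "(j = 1 - h \<and> \<phi> v = y \<and> y \<in> V1) \<or> (j = 2 \<and> \<phi> v \<in> V2)"
        using Ytag[of j y] uv(2) h by (auto simp: v \<phi>_def)
      have "i = j" using u1 v1 uv(3) disj h by (metis disjoint_iff)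
      moreover have "x = y"
      proof (cases "i = 2 \<and> h = 1")
        case True
        hence "\<pi> x = \<pi> y" using uv(3) \<open>i = j\<close> by (simp add: u v \<phi>_def)
        thus ?thesis by (rule injD[OF \<pi>])
      next
        case False
        thus ?thesis using uv(3) \<open>i = j\<close> by (auto simp: u v \<phi>_def)
      qed
      ultimately show "u = v" by (simp add: u v)
    qed
    have AXY: "A (\<phi> u) (\<phi> v)" if "u \<in> X" "v \<in> Y" for u v
    proof -
      obtain i x where u: "u = (i, x)" by (cases u)
      obtain j y where v: "v = (j, y)" by (cases v)
      have i: "i = h" using tag that u by blast
      have "G (i, x) (j, y)" using all that u v by blast
      from Gcases[OF this] show ?thesis using h i by (auto simp: u v \<phi>_def dest: TE sym)
    qed
    have c: "finite (\<phi> ` X)" "finite (\<phi> ` Y)" "card (\<phi> ` X) = card X" "card (\<phi> ` Y) = card Y"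
      using XY iX iY by (auto simp: card_image)
    from XY(3) show False
    proof
      assume "card X = s \<and> card Y = t"
      moreover have "\<forall>x\<in>\<phi> ` X. \<forall>y\<in>\<phi> ` Y. A x y" using AXY by blast
      ultimately show False using free c unfolding kst_free_def by metis
    next
      assume "card X = t \<and> card Y = s"
      moreover have "\<forall>x\<in>\<phi> ` Y. \<forall>y\<in>\<phi> ` X. A x y" using AXY sym by blast
      ultimately show False using free c unfolding kst_free_def by metis
    qed
  qed
  \<comment> \<open>If the other side lay in a single part, \<open>small\<close> would apply with
    the sides exchanged. So it meets both of the first two parts, the copy belongs to
    \<open>Bad\<close>, and its chosen edge lies in no triple of \<open>TE\<close>.\<close>
  have large: False if XY: "finite X" "finite Y" "(card X = s \<and> card Y = t) \<or> (card X = t \<and> card Y = s)"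
    and all: "\<And>x y. x \<in> X \<Longrightarrow> y \<in> Y \<Longrightarrow> G x y" and tag: "\<And>i x. (i, x) \<in> X \<Longrightarrow> i = 2" for X Y
  proof -
    have X0: "X \<noteq> {}" "Y \<noteq> {}" using XY st by auto
    obtain i0 x0 where "(i0, x0) \<in> X" using X0(1) by fast
    hence x0: "(2, x0) \<in> X" using tag by blast
    have Ytag: "j = 0 \<or> j = 1" if "(j, y) \<in> Y" for j y
      using Gcases[OF all[OF x0 that]] by auto
    have XY': "(card Y = s \<and> card X = t) \<or> (card Y = t \<and> card X = s)" using XY(3) by blast
    define X' Y' Z' where "X' = Pair 2 -` X" and "Y' = Pair 0 -` Y" and "Z' = Pair 1 -` Y"
    have Z'0: "Z' \<noteq> {}"
    proof
      assume "Z' = {}"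
      hence "j = 0" if "(j, y) \<in> Y" for j y using Ytag[OF that] that by (auto simp: Z'_def)
      thus False using small[OF XY(2,1) XY'] all Gsym by blast
    qed
    have Y'0: "Y' \<noteq> {}"
    proof
      assume "Y' = {}"
      hence "j = 1" if "(j, y) \<in> Y" for j y using Ytag[OF that] that by (auto simp: Y'_def)
      thus False using small[OF XY(2,1) XY'] all Gsym by blast
    qed
    have fin': "finite X'" "finite Y'" "finite Z'"
      unfolding X'_def Y'_def Z'_def by (intro finite_vimageI XY injI; simp)+
    have "X = Pair 2 ` X'"
    proof
      show "X \<subseteq> Pair 2 ` X'"
      proof
        fix u assume u: "u \<in> X"
        obtain i x where ix: "u = (i, x)" by (cases u)
        have "i = 2" using tag u ix by blast
        thus "u \<in> Pair 2 ` X'" using u ix by (simp add: X'_def)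
      qed
    qed (auto simp: X'_def)
    hence cX: "card X = card X'" by (simp add: card_image inj_on_def)
    have "Y = Pair 0 ` Y' \<union> Pair 1 ` Z'"
    proof
      show "Y \<subseteq> Pair 0 ` Y' \<union> Pair 1 ` Z'"
      proof
        fix u assume u: "u \<in> Y"
        obtain i x where ix: "u = (i, x)" by (cases u)
        have "i = 0 \<or> i = 1" using Ytag u ix by blast
        thus "u \<in> Pair 0 ` Y' \<union> Pair 1 ` Z'" using u ix by (auto simp: Y'_def Z'_def)
      qed
    qed (auto simp: Y'_def Z'_def)
    hence "card Y = card (Pair (0::nat) ` Y') + card (Pair (1::nat) ` Z')"
      using fin' by (simp only:) (intro card_Un_disjoint; auto)
    hence cY: "card Y = card Y' + card Z'" by (simp add: card_image inj_on_def)
    have gA: "a \<in> V1 \<and> c \<in> V2 \<and> \<pi> c \<in> V2 \<and> A a c \<and> (0, a, c) \<in> R" if "a \<in> Y'" "c \<in> X'" for a c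
      using Gcases[OF all[of "(2, c)" "(0, a)"]] that by (auto simp: Y'_def X'_def dest: TE)
    have gB: "b \<in> V1 \<and> c \<in> V2 \<and> \<pi> c \<in> V2 \<and> A b (\<pi> c) \<and> (1, b, c) \<in> R" if "b \<in> Z'" "c \<in> X'" for b c
      using Gcases[OF all[of "(2, c)" "(1, b)"]] that by (auto simp: Z'_def X'_def dest: TE)
    have X'0: "X' \<noteq> {}" using x0 by (auto simp: X'_def)
    have sub: "X' \<subseteq> V2" "\<pi> ` X' \<subseteq> V2" "Y' \<subseteq> V1" "Z' \<subseteq> V1" using gA gB X'0 Y'0 by blast+
    have "(X', Y', Z') \<in> Bad" unfolding Bad_def twisted_bicliques_def
      using sub X'0 Y'0 Z'0 XY(3) gA gB cX cY by auto
    moreover have "S2 (X', Y', Z') \<subseteq> R" using gA gB by (auto simp: S2_def)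
    ultimately have BR: "(X', Y', Z') \<in> BR" by (simp add: BR_def)
    define a c where "a = (SOME y. y \<in> Y')" and "c = (SOME x. x \<in> X')"
    have ac: "a \<in> Y'" "c \<in> X'" using X'0 Y'0 some_in_eq unfolding a_def c_def by blast+
    have "G (2, c) (0, a)" using ac by (intro all) (auto simp: X'_def Y'_def)
    from Gcases[OF this] obtain b where b: "(a, b, c) \<in> TE" by auto
    hence "(a, b, c) \<in> del (X', Y', Z')" by (simp add: del_def a_def c_def TE_def TR_def)
    thus False using b BR by (auto simp: TE_def)
  qed
  have "kst_free s t G"
    unfolding kst_free_def
  proof (intro allI impI notI)
    fix S T assume f: "finite S" "finite T" and c: "card S = s" "card T = t" and all: "\<forall>x\<in>S. \<forall>y\<in>T. G x y"
    have ne: "S \<noteq> {}" "T \<noteq> {}" using c st by auto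
    obtain i0 x0 where S0: "(i0, x0) \<in> S" using ne by fast
    obtain j0 y0 where T0: "(j0, y0) \<in> T" using ne by fast
    have tags: "i < 3 \<and> j < 3 \<and> i \<noteq> j" if "(i, x) \<in> S" "(j, y) \<in> T" for i j x y
    proof -
      have "G (i, x) (j, y)" using all that by blast
      from Gcases[OF this] show ?thesis by auto
    qed
    \<comment> \<open>No edge lies inside a part, and two sides that both met two of the three parts
      would share a part.\<close>
    have "(\<forall>(i, x)\<in>S. i = i0) \<or> (\<forall>(j, y)\<in>T. j = j0)"
    proof (rule ccontr)
      assume "\<not> ?thesis"
      then obtain i x j y where 1: "(i, x) \<in> S" "i \<noteq> i0" "(j, y) \<in> T" "j \<noteq> j0" by auto
      show False using tags[OF 1(1,3)] tags[OF 1(1) T0] tags[OF S0 1(3)] tags[OF S0 T0] 1(2,4) by linarith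
    qed
    thus False
    proof
      assume S: "\<forall>(i, x)\<in>S. i = i0"
      have i0: "i0 = 0 \<or> i0 = 1 \<or> i0 = 2" using tags[OF S0 T0] by linarith
      show False
      proof (cases "i0 = 2")
        case True
        show False by (rule large[of S T]) (use f c all S True in auto)
      next
        case False
        show False by (rule small[of S T i0]) (use f c all S False i0 in auto)
      qed
    next
      assume T: "\<forall>(j, y)\<in>T. j = j0"
      have j0: "j0 = 0 \<or> j0 = 1 \<or> j0 = 2" using tags[OF S0 T0] by linarith
      show False
      proof (cases "j0 = 2")
        case True
        show False by (rule large[of T S]) (use f c all T True Gsym in auto)
      next
        case False
        show False by (rule small[of T S j0]) (use f c all T False j0 Gsym in auto)
      qed
    qed
  qed
  hence nocopy: "\<not> kst_copy s t E"
    by (rule kst_free_imp_not_kst_copy) (auto simp: G_def)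
  show ?thesis
  proof (rule that[OF _ _ nocopy])
    show "\<Union>E \<subseteq> {0} \<times> V1 \<union> {1} \<times> V1 \<union> {2} \<times> V2" using TE by (fastforce simp: E_def tri_def)
    show "card e = 3" if "e \<in> E" for e using that by (auto simp: E_def tri_def)
    show "p\<^sup>2 * card (twisted_triangles A \<pi> V1 V2)
       - L * p ^ (s * t) * card (twisted_bicliques A \<pi> V1 V2 s t \<union> twisted_bicliques A \<pi> V1 V2 t s) \<le> card E"
      using count unfolding Tri_def Bad_def .
  qed
qed

section \<open>Counting the bicliques of the twisted graph\<close>

lemma card_subsets_le_power:
  assumes "finite V" "W \<subseteq> V"
  shows "card {Y. Y \<subseteq> W \<and> card Y = k} \<le> card V ^ k"
proof -
  have "finite W" using assms finite_subset by blast
  hence "card {Y. Y \<subseteq> W \<and> card Y = k} = card W choose k" by (rule n_subsets)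
  also have "\<dots> \<le> card W ^ k" by (rule binomial_le_power)
  also have "\<dots> \<le> card V ^ k" using assms by (intro power_mono card_mono) auto
  finally show ?thesis .
qed

text \<open>\<open>X\<close> and its image under \<open>\<pi>\<close> both have \<open>s\<close>
  elements and so fewer than \<open>t\<close> common neighbours, which leaves at most
  \<open>2 ^ t\<close> choices each for \<open>Y\<close> and \<open>Z\<close>. This holds for every
  \<open>\<pi>\<close>, so these bicliques stay out of the averaging over permutations.\<close>

lemma card_twisted_bicliques:
  assumes fin: "finite V" "V1 \<subseteq> V" "V2 \<subseteq> V" and sym: "\<And>x y. A x y \<Longrightarrow> A y x"
    and free: "kst_free s t A" and \<pi>: "inj \<pi>" and st: "s > 0" "t > 0"
  shows "card (twisted_bicliques A \<pi> V1 V2 s t) \<le> card V ^ s * 4 ^ t"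
proof -
  define F where "F X = {b\<in>V1. \<forall>x\<in>X. A x b}" for X
  define Xs where "Xs = {X. X \<subseteq> V2 \<and> card X = s}"
  have finV: "finite V1" "finite V2" using fin finite_subset by blast+
  have finXs: "finite Xs" using finV by (simp add: Xs_def)
  have finF: "finite (F X)" for X using finV by (simp add: F_def)
  have cF: "card (Pow (F X)) \<le> 2 ^ t" if "finite X" "card X = s" for X
  proof -
    have "card (F X) < t" unfolding F_def by (rule kst_free_card_common[OF free that st(2)])
    hence "(2::nat) ^ card (F X) \<le> 2 ^ t" by (intro power_increasing) auto
    thus ?thesis using finF by (simp add: card_Pow)
  qed
  have "twisted_bicliques A \<pi> V1 V2 s t \<subseteq> (SIGMA X:Xs. Pow (F X) \<times> Pow (F (\<pi> ` X)))"
    using sym by (auto simp: twisted_bicliques_def Xs_def F_def)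
  hence "card (twisted_bicliques A \<pi> V1 V2 s t) \<le> card (SIGMA X:Xs. Pow (F X) \<times> Pow (F (\<pi> ` X)))"
    using finXs finF by (intro card_mono) auto
  also have "\<dots> = (\<Sum>X\<in>Xs. card (Pow (F X)) * card (Pow (F (\<pi> ` X))))"
    using finXs finF by (simp add: card_SigmaI card_cartesian_product)
  also have "\<dots> \<le> (\<Sum>X\<in>Xs. 2 ^ t * 2 ^ t)"
  proof (intro sum_mono mult_mono)
    fix X assume X: "X \<in> Xs"
    have fX: "finite X" "card X = s" using X finV(2) finite_subset by (auto simp: Xs_def)
    show "card (Pow (F X)) \<le> 2 ^ t" by (rule cF[OF fX])
    have "card (\<pi> ` X) = s" using fX(2) card_image[OF inj_on_subset[OF \<pi>], of X] by simp
    thus "card (Pow (F (\<pi> ` X))) \<le> 2 ^ t" using fX by (intro cF) auto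
  qed auto
  also have "\<dots> = card Xs * 4 ^ t" by (simp add: power_mult_distrib[symmetric])
  also have "\<dots> \<le> card V ^ s * 4 ^ t"
    unfolding Xs_def by (intro mult_right_mono card_subsets_le_power fin) auto
  finally show ?thesis .
qed

text \<open>As \<open>card Y + card Z = s\<close>, the product of the two neighbourhoods has at most
  \<open>\<Lambda> ^ s\<close> elements however \<open>s\<close> is split, and \<open>M\<close> is
  one of its \<open>t\<close>-subsets. The factor \<open>s\<close> accounts for the possible sizes
  of \<open>Y\<close>.\<close>

lemma card_matchings_between_neighbourhoods:
  fixes \<Lambda> :: real
  assumes fin: "finite V" "V1 \<subseteq> V" "finite U" and \<Lambda>: "0 \<le> \<Lambda>"
    and F: "\<And>Y. Y \<subseteq> V1 \<Longrightarrow> Y \<noteq> {} \<Longrightarrow> card Y < s \<Longrightarrow> card {x\<in>U. \<forall>y\<in>Y. A x y} \<le> \<Lambda> ^ (s - card Y)"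
  shows "card {(Y, Z, M). Y \<subseteq> V1 \<and> Z \<subseteq> V1 \<and> Y \<noteq> {} \<and> Z \<noteq> {} \<and> card Y + card Z = s \<and>
      M \<subseteq> {x\<in>U. \<forall>y\<in>Y. A x y} \<times> {x\<in>U. \<forall>z\<in>Z. A x z} \<and> card M = t \<and> inj_on fst M \<and> inj_on snd M}
    \<le> s * real (card V) ^ s * \<Lambda> ^ (s * t)"
    and "finite {(Y, Z, M). Y \<subseteq> V1 \<and> Z \<subseteq> V1 \<and> Y \<noteq> {} \<and> Z \<noteq> {} \<and> card Y + card Z = s \<and>
      M \<subseteq> {x\<in>U. \<forall>y\<in>Y. A x y} \<times> {x\<in>U. \<forall>z\<in>Z. A x z} \<and> card M = t \<and> inj_on fst M \<and> inj_on snd M}"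
proof -
  define F where "F Y = {x\<in>U. \<forall>y\<in>Y. A x y}" for Y
  define Ps where "Ps k = {Y. Y \<subseteq> V1 \<and> card Y = k}" for k
  define Ms where "Ms Y Z = {M. M \<subseteq> F Y \<times> F Z \<and> card M = t}" for Y Z
  let ?B = "{(Y, Z, M). Y \<subseteq> V1 \<and> Z \<subseteq> V1 \<and> Y \<noteq> {} \<and> Z \<noteq> {} \<and> card Y + card Z = s \<and>
      M \<subseteq> {x\<in>U. \<forall>y\<in>Y. A x y} \<times> {x\<in>U. \<forall>z\<in>Z. A x z} \<and> card M = t \<and> inj_on fst M \<and> inj_on snd M}"
  define C where "C i = (SIGMA Y:Ps i. SIGMA Z:Ps (s - i). Ms Y Z)" for i
  have finV1: "finite V1" using fin finite_subset by blast
  have finF: "finite (F Y)" for Y using fin by (simp add: F_def)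
  have finMs: "finite (Ms Y Z)" for Y Z
    by (rule finite_subset[of _ "Pow (F Y \<times> F Z)"]) (use finF in \<open>auto simp: Ms_def\<close>)
  have finPs: "finite (Ps k)" for k using finV1 by (simp add: Ps_def)
  have finC: "finite (C i)" for i unfolding C_def using finPs finMs by auto
  have sub: "?B \<subseteq> (\<Union>i\<in>{1..<s}. C i)"
  proof
    fix x assume x: "x \<in> ?B"
    obtain Y Z M where eq: "x = (Y, Z, M)" by (cases x)
    have B: "Y \<subseteq> V1" "Z \<subseteq> V1" "Y \<noteq> {}" "Z \<noteq> {}" "card Y + card Z = s" "M \<in> Ms Y Z"
      using x unfolding eq by (auto simp: Ms_def F_def)
    have "finite Y" "finite Z" using B(1,2) finV1 finite_subset by blast+
    hence "card Y > 0" "card Z > 0" using B(3,4) by (simp_all add: card_gt_0_iff)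
    hence "card Y \<in> {1..<s}" "card Z = s - card Y" using B(5) by auto
    moreover have "x \<in> C (card Y)" unfolding eq C_def using B \<open>card Z = s - card Y\<close> by (simp add: Ps_def)
    ultimately show "x \<in> (\<Union>i\<in>{1..<s}. C i)" by blast
  qed
  show "finite ?B" by (rule finite_subset[OF sub]) (use finC in auto)
  have cMs: "card (Ms Y Z) \<le> \<Lambda> ^ (s * t)" if Y: "Y \<in> Ps i" and Z: "Z \<in> Ps (s - i)" and i: "i \<in> {1..<s}" for Y Z i
  proof -
    have ne: "Y \<noteq> {}" "Z \<noteq> {}" using Y Z i by (auto simp: Ps_def)
    have "real (card (F Y)) \<le> \<Lambda> ^ (s - i)" "real (card (F Z)) \<le> \<Lambda> ^ i"
      using assms(5)[of Y] assms(5)[of Z] ne Y Z i by (auto simp: Ps_def F_def)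
    hence "real (card (F Y)) * real (card (F Z)) \<le> \<Lambda> ^ (s - i) * \<Lambda> ^ i"
      using \<Lambda> by (intro mult_mono) auto
    also have "\<dots> = \<Lambda> ^ s" using i by (simp add: power_add[symmetric])
    finally have FF: "real (card (F Y \<times> F Z)) \<le> \<Lambda> ^ s" by (simp add: card_cartesian_product)
    have "card (Ms Y Z) = card (F Y \<times> F Z) choose t"
      unfolding Ms_def by (rule n_subsets) (use finF in simp)
    also have "\<dots> \<le> card (F Y \<times> F Z) ^ t" by (rule binomial_le_power)
    finally have "real (card (Ms Y Z)) \<le> real (card (F Y \<times> F Z)) ^ t" by (metis of_nat_le_iff of_nat_power)
    also have "\<dots> \<le> (\<Lambda> ^ s) ^ t" by (rule power_mono[OF FF]) simp
    finally show ?thesis by (simp add: power_mult)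
  qed
  have cP: "real (card (Ps k)) \<le> real (card V) ^ k" for k
    using card_subsets_le_power[OF fin(1,2), of k] unfolding Ps_def by (metis of_nat_le_iff of_nat_power)
  have cC: "card (C i) \<le> real (card V) ^ s * \<Lambda> ^ (s * t)" if i: "i \<in> {1..<s}" for i
  proof -
    have "real (card (C i)) = (\<Sum>Y\<in>Ps i. \<Sum>Z\<in>Ps (s - i). real (card (Ms Y Z)))"
      unfolding C_def using finPs finMs by (simp add: card_SigmaI)
    also have "\<dots> \<le> (\<Sum>Y\<in>Ps i. \<Sum>Z\<in>Ps (s - i). \<Lambda> ^ (s * t))" using cMs i by (intro sum_mono) blast
    also have "\<dots> = real (card (Ps i)) * real (card (Ps (s - i))) * \<Lambda> ^ (s * t)" by simp
    also have "\<dots> \<le> real (card V) ^ i * real (card V) ^ (s - i) * \<Lambda> ^ (s * t)"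
      using \<Lambda> by (intro mult_right_mono mult_mono cP) auto
    also have "real (card V) ^ i * real (card V) ^ (s - i) = real (card V) ^ s"
      using i by (simp add: power_add[symmetric])
    finally show ?thesis .
  qed
  have "card ?B \<le> card (\<Union>i\<in>{1..<s}. C i)" by (rule card_mono[OF _ sub]) (use finC in auto)
  also have "\<dots> \<le> (\<Sum>i\<in>{1..<s}. card (C i))" by (rule card_UN_le) simp
  finally have le: "card ?B \<le> (\<Sum>i\<in>{1..<s}. card (C i))" .
  have "real (card ?B) \<le> (\<Sum>i\<in>{1..<s}. real (card (C i)))"
    using of_nat_mono[OF le, where 'a = real] by (simp only: of_nat_sum)
  also have "\<dots> \<le> (\<Sum>i\<in>{1..<s}. real (card V) ^ s * \<Lambda> ^ (s * t))" using cC by (intro sum_mono) blast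
  also have "\<dots> = real (s - 1) * (real (card V) ^ s * \<Lambda> ^ (s * t))" by simp
  also have "\<dots> \<le> real s * (real (card V) ^ s * \<Lambda> ^ (s * t))" using \<Lambda> by (intro mult_right_mono) auto
  finally show "card ?B \<le> s * real (card V) ^ s * \<Lambda> ^ (s * t)" by (simp only: mult.assoc)
qed

text \<open>A biclique with \<open>t\<close> vertices in the third part makes \<open>\<pi>\<close> extend a matching of size \<open>t\<close> between two common
  neighbourhoods, which has probability at most \<open>(2 / N) ^ t\<close>.\<close>

lemma permuted_tripartite_construction:
  fixes A :: "'a \<Rightarrow> 'a \<Rightarrow> bool" and p \<delta> :: real
  assumes fin: "finite V" and sym: "\<And>x y. A x y \<Longrightarrow> A y x" and irr: "\<And>x. \<not> A x x"
    and free: "kst_free s t A" and st: "s \<ge> 2" "t > 0" and p: "0 \<le> p" "p \<le> 1"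
    and \<delta>: "2 * real s \<le> \<delta>" "4 * \<delta> * card V \<le> D" and D: "D = (\<Sum>x\<in>V. real (card {y\<in>V. A x y}))"
    and N: "N = card V" "2 * t \<le> N" and \<Lambda>: "\<Lambda> = 2 * real s * real t * real N / \<delta>"
  obtains E :: "(nat \<times> 'a) set set" where
    "finite (\<Union>E)" "card (\<Union>E) \<le> 3 * N" "\<And>e. e \<in> E \<Longrightarrow> card e = 3" "\<not> kst_copy s t E"
    "p\<^sup>2 * D * (\<delta> - 1)\<^sup>2 / (32 * real N)
      - \<Lambda> ^ (s - 1) * p ^ (s * t) * (real N ^ s * 4 ^ t + s * real N ^ s * \<Lambda> ^ (s * t) * (2 / real N) ^ t) \<le> card E"
proof -
  obtain U where U: "U \<subseteq> V" "\<And>x. x \<in> U \<Longrightarrow> \<delta> \<le> card {y\<in>U. A x y}" "D \<le> 2 * (\<Sum>x\<in>U. real (card {y\<in>U. A x y}))"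
    using dense_core[of V A \<delta>, OF fin sym irr \<delta>(2)[unfolded D]] unfolding D by blast
  have finU: "finite U" using U(1) fin finite_subset by blast
  have \<delta>1: "1 \<le> \<delta>" "0 < \<delta>" using \<delta>(1) st by linarith+
  obtain V1 V2 where V12: "V1 \<union> V2 = U" "V1 \<inter> V2 = {}" and
    quads: "(\<Sum>x\<in>U. real (card {y\<in>U. A x y})) * (\<delta> - 1)\<^sup>2 / 16
       \<le> card {(a, b, c, d). a \<in> V1 \<and> b \<in> V1 \<and> c \<in> V2 \<and> d \<in> V2 \<and> A a b \<and> A a c \<and> A b d}"
    using crossing_paths_bipartition[of U A \<delta>, OF finU sym irr U(2) \<delta>1(1)] by blast
  define Q where "Q = {(a, b, c, d). a \<in> V1 \<and> b \<in> V1 \<and> c \<in> V2 \<and> d \<in> V2 \<and> A a b \<and> A a c \<and> A b d}"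
  define F where "F Y = {x\<in>U. \<forall>y\<in>Y. A x y}" for Y
  define B where "B = {(Y, Z, M). Y \<subseteq> V1 \<and> Z \<subseteq> V1 \<and> Y \<noteq> {} \<and> Z \<noteq> {} \<and> card Y + card Z = s \<and>
      M \<subseteq> F Y \<times> F Z \<and> card M = t \<and> inj_on fst M \<and> inj_on snd M}"
  \<comment> \<open>Degree bound within \<open>U\<close>, from
    \<open>common_neighbours_bound\<close> for one vertex; it is the price of destroying a
    biclique.\<close>
  define L where "L = \<Lambda> ^ (s - 1)"
  have V12': "V1 \<subseteq> U" "V2 \<subseteq> U" "V1 \<subseteq> V" "V2 \<subseteq> V" using V12 U(1) by auto
  have fin12: "finite V1" "finite V2" using V12' finU finite_subset by blast+
  have \<Lambda>0: "0 \<le> \<Lambda>" unfolding \<Lambda> using \<delta>1 by simp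
  have L0: "0 \<le> L" unfolding L_def using \<Lambda>0 by simp
  have F: "card (F Y) \<le> \<Lambda> ^ (s - card Y)" if "Y \<subseteq> V1" "card Y < s" for Y
    unfolding F_def \<Lambda>
    by (rule common_neighbours_bound[OF finU sym free st(2) U(2) \<delta>(1)]) (use that V12' U(1) fin N in \<open>auto intro: card_mono\<close>)
  have finQ: "finite Q"
    by (rule finite_subset[of _ "V1 \<times> V1 \<times> V2 \<times> V2"]) (use fin12 in \<open>auto simp: Q_def\<close>)
  have cB: "card B \<le> s * real N ^ s * \<Lambda> ^ (s * t)" and finB: "finite B"
    unfolding B_def F_def N(1) using F[unfolded F_def]
    by (intro card_matchings_between_neighbourhoods[OF fin V12'(3) finU \<Lambda>0]; simp)+
  \<comment> \<open>The weights anticipate the thinning: a path that closes up is worth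
    \<open>p\<^sup>2\<close>, an extended matching costs \<open>L * p ^ (s * t)\<close>. One
    permutation thus serves both counts.\<close>
  define w where "w = case_sum (\<lambda>_::'a \<times> 'a \<times> 'a \<times> 'a. p\<^sup>2) (\<lambda>_::'a set \<times> 'a set \<times> ('a \<times> 'a) set. - (L * p ^ (s * t)))"
  define MM where "MM = case_sum (\<lambda>(a::'a, b::'a, c::'a, d::'a). {(c, d)}) (\<lambda>(Y::'a set, Z::'a set, M::('a \<times> 'a) set). M)"
  obtain \<pi> where \<pi>: "\<pi> permutes V" and avg:
    "(\<Sum>i\<in>Q <+> B. w i * (fact (card V - card (MM i)) / fact (card V))) \<le> (\<Sum>i\<in>{i\<in>Q <+> B. \<forall>(x, y)\<in>MM i. \<pi> x = y}. w i)"
  proof (rule exists_permutation_ge_average[OF fin, of "Q <+> B" MM w])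
    fix i assume "i \<in> Q <+> B"
    thus "MM i \<subseteq> V \<times> V \<and> inj_on fst (MM i) \<and> inj_on snd (MM i)"
    proof
      fix x assume "i = Inl x" "x \<in> Q"
      thus ?thesis using V12' by (auto simp: MM_def Q_def)
    next
      fix x assume "i = Inr x" "x \<in> B"
      moreover have "u \<in> F Y \<Longrightarrow> u \<in> V" for u Y using U(1) by (auto simp: F_def)
      ultimately show ?thesis by (cases x) (auto simp: MM_def B_def dest!: subsetD)
    qed
  qed (use finQ finB in auto)
  define Q' where "Q' = {i\<in>Q. \<forall>(x, y)\<in>MM (Inl i). \<pi> x = y}"
  define B' where "B' = {i\<in>B. \<forall>(x, y)\<in>MM (Inr i). \<pi> x = y}"
  have fin': "finite Q'" "finite B'" using finQ finB by (auto simp: Q'_def B'_def)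
  have "{i\<in>Q <+> B. \<forall>(x, y)\<in>MM i. \<pi> x = y} = Q' <+> B'" by (auto simp: Q'_def B'_def)
  hence rhs: "(\<Sum>i\<in>{i\<in>Q <+> B. \<forall>(x, y)\<in>MM i. \<pi> x = y}. w i) = p\<^sup>2 * card Q' - L * p ^ (s * t) * card B'"
    using fin' by (simp add: sum.Plus w_def mult.commute)
  have N0: "N > 0" using N st by linarith
  have "(\<Sum>i\<in>Q <+> B. w i * (fact (card V - card (MM i)) / fact (card V)))
     = (\<Sum>i\<in>Q. p\<^sup>2 * (fact (N - 1) / fact N)) + (\<Sum>i\<in>B. - (L * p ^ (s * t)) * (fact (N - t) / fact N))"
  proof -
    have 1: "(\<Sum>i\<in>Q. (w \<circ> Inl) i * (fact (card V - card (MM (Inl i))) / fact (card V))) = (\<Sum>i\<in>Q. p\<^sup>2 * (fact (N - 1) / fact N))"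
      by (intro sum.cong refl) (auto simp: w_def MM_def N)
    have 2: "(\<Sum>i\<in>B. (w \<circ> Inr) i * (fact (card V - card (MM (Inr i))) / fact (card V))) = (\<Sum>i\<in>B. - (L * p ^ (s * t)) * (fact (N - t) / fact N))"
      by (intro sum.cong refl) (auto simp: w_def MM_def N B_def)
    show ?thesis using 1 2 finQ finB by (simp add: sum.Plus)
  qed
  also have "\<dots> = p\<^sup>2 * card Q / real N - L * p ^ (s * t) * (card B * (fact (N - t) / fact N))"
  proof -
    have "fact N = real N * fact (N - 1)" using N0 by (simp add: fact_reduce)
    hence "(fact (N - 1) :: real) / fact N = 1 / real N" by simp
    thus ?thesis by (simp add: mult_ac)
  qed
  finally have lhs: "p\<^sup>2 * card Q / real N - L * p ^ (s * t) * (card B * (fact (N - t) / fact N))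
     \<le> p\<^sup>2 * card Q' - L * p ^ (s * t) * card B'" using avg rhs by simp
  have "card B * (fact (N - t) / fact N) \<le> (s * real N ^ s * \<Lambda> ^ (s * t)) * (2 / real N) ^ t"
    using cB \<Lambda>0 by (intro mult_mono fact_diff_ratio_le N) auto
  hence lhs2: "p\<^sup>2 * card Q / real N - L * p ^ (s * t) * (s * real N ^ s * \<Lambda> ^ (s * t) * (2 / real N) ^ t)
     \<le> p\<^sup>2 * card Q' - L * p ^ (s * t) * card B'"
    using mult_left_mono[of "card B * (fact (N - t) / fact N)" "(s * real N ^ s * \<Lambda> ^ (s * t)) * (2 / real N) ^ t" "L * p ^ (s * t)"]
      lhs L0 p by (simp add: mult.assoc)
  have "D * (\<delta> - 1)\<^sup>2 / 32 \<le> card Q"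
  proof -
    have "D * (\<delta> - 1)\<^sup>2 \<le> 2 * (\<Sum>x\<in>U. real (card {y\<in>U. A x y})) * (\<delta> - 1)\<^sup>2" by (intro mult_right_mono U) simp
    thus ?thesis using quads unfolding Q_def by linarith
  qed
  hence "p\<^sup>2 * (D * (\<delta> - 1)\<^sup>2 / 32) / real N \<le> p\<^sup>2 * card Q / real N"
    by (intro divide_right_mono mult_left_mono) auto
  hence Qge: "p\<^sup>2 * D * (\<delta> - 1)\<^sup>2 / (32 * real N) \<le> p\<^sup>2 * card Q / real N" by simp
  have inj\<pi>: "inj \<pi>" by (rule permutes_inj[OF \<pi>])
  let ?T = "twisted_triangles A \<pi> V1 V2" and ?B1 = "twisted_bicliques A \<pi> V1 V2 s t" and ?B2 = "twisted_bicliques A \<pi> V1 V2 t s"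
  have finT: "finite ?T"
    by (rule finite_subset[of _ "V1 \<times> V1 \<times> V2"]) (use fin12 in \<open>auto simp: twisted_triangles_def\<close>)
  have cQ': "card Q' \<le> card ?T"
  proof (rule card_inj_on_le[of "\<lambda>(a, b, c, d). (a, b, c)", OF _ _ finT])
    show "inj_on (\<lambda>(a, b, c, d). (a, b, c)) Q'" by (auto simp: inj_on_def Q'_def MM_def)
    show "(\<lambda>(a, b, c, d). (a, b, c)) ` Q' \<subseteq> ?T" by (auto simp: Q'_def MM_def Q_def twisted_triangles_def)
  qed
  \<comment> \<open>A biclique with \<open>t\<close> vertices in the third part is encoded by the
    graph of \<open>\<pi>\<close> on \<open>X\<close>, a matching that \<open>\<pi>\<close>
    extends.\<close>
  have cB': "card ?B2 \<le> card B'"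
  proof (rule card_inj_on_le[of "\<lambda>(X, Y, Z). (Y, Z, (\<lambda>c. (c, \<pi> c)) ` X)", OF _ _ fin'(2)])
    have "X = fst ` (\<lambda>c. (c, \<pi> c)) ` X" for X by force
    thus "inj_on (\<lambda>(X, Y, Z). (Y, Z, (\<lambda>c. (c, \<pi> c)) ` X)) ?B2"
      by (intro inj_onI) (auto, metis+)
    show "(\<lambda>(X, Y, Z). (Y, Z, (\<lambda>c. (c, \<pi> c)) ` X)) ` ?B2 \<subseteq> B'"
    proof clarify
      fix X Y Z assume b: "(X, Y, Z) \<in> ?B2"
      let ?M = "(\<lambda>c. (c, \<pi> c)) ` X"
      have h: "X \<subseteq> V2" "\<pi> ` X \<subseteq> V2" "Y \<subseteq> V1" "Z \<subseteq> V1" "Y \<noteq> {}" "Z \<noteq> {}" "card X = t" "card Y + card Z = s"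
        "\<And>x y. x \<in> X \<Longrightarrow> y \<in> Y \<Longrightarrow> A y x" "\<And>x z. x \<in> X \<Longrightarrow> z \<in> Z \<Longrightarrow> A z (\<pi> x)"
        using b by (auto simp: twisted_bicliques_def)
      have "?M \<subseteq> F Y \<times> F Z" using h(1,2) V12'(2) by (auto simp: F_def intro!: sym[OF h(9)] sym[OF h(10)])
      moreover have "card ?M = t" using h(7) by (simp add: card_image inj_on_def)
      moreover have "inj_on fst ?M" "inj_on snd ?M" using inj\<pi> by (auto simp: inj_on_def inj_def)
      ultimately show "(Y, Z, ?M) \<in> B'" using h(3-6,8) by (auto simp: B'_def B_def MM_def)
    qed
  qed
  have cB1: "card ?B1 \<le> N ^ s * 4 ^ t"
    using card_twisted_bicliques[OF fin V12'(3,4) sym free inj\<pi>] st N by simp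
  have cBB: "real (card (?B1 \<union> ?B2)) \<le> real N ^ s * 4 ^ t + card B'"
  proof -
    have "card (?B1 \<union> ?B2) \<le> N ^ s * 4 ^ t + card B'" using card_Un_le[of ?B1 ?B2] cB' cB1 by linarith
    hence "real (card (?B1 \<union> ?B2)) \<le> real (N ^ s * 4 ^ t + card B')" by (rule of_nat_mono)
    thus ?thesis by simp
  qed
  have deg: "card {b\<in>V1. A a b} \<le> L" if a: "a \<in> V1" for a
  proof -
    have "card {b\<in>V1. A a b} \<le> card (F {a})" using V12' finU sym by (intro card_mono) (auto simp: F_def)
    thus ?thesis using F[of "{a}"] a st by (simp add: L_def)
  qed
  have s0: "0 < s" using st by simp
  obtain E :: "(nat \<times> 'a) set set" where E: "\<Union>E \<subseteq> {0} \<times> V1 \<union> {1} \<times> V1 \<union> {2} \<times> V2" "\<And>e. e \<in> E \<Longrightarrow> card e = 3" "\<not> kst_copy s t E"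
    "p\<^sup>2 * card ?T - L * p ^ (s * t) * card (?B1 \<union> ?B2) \<le> card E"
    by (rule tripartite_thinning[OF fin12 V12(2) sym free inj\<pi> s0 st(2) p deg]) (assumption | (rule that; assumption))+
  show ?thesis
  proof (rule that[OF _ _ E(2,3)])
    have f3: "finite ({0,1,2::nat} \<times> V)" using fin by simp
    have s3: "\<Union>E \<subseteq> {0,1,2::nat} \<times> V" using E(1) V12' by auto
    show "finite (\<Union>E)" using s3 f3 finite_subset by blast
    show "card (\<Union>E) \<le> 3 * N" using card_mono[OF f3 s3] N by (simp add: card_cartesian_product)
    have "p\<^sup>2 * card Q' \<le> p\<^sup>2 * card ?T" using cQ' by (intro mult_left_mono) auto
    moreover have "L * p ^ (s * t) * card (?B1 \<union> ?B2) \<le> L * p ^ (s * t) * (real N ^ s * 4 ^ t + card B')"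
      using L0 p cBB by (intro mult_left_mono) auto
    ultimately have "p\<^sup>2 * card Q / real N - L * p ^ (s * t) * (s * real N ^ s * \<Lambda> ^ (s * t) * (2 / real N) ^ t)
       - L * p ^ (s * t) * (real N ^ s * 4 ^ t) \<le> card E"
      using E(4) lhs2 by (simp add: distrib_left)
    thus "p\<^sup>2 * D * (\<delta> - 1)\<^sup>2 / (32 * real N)
      - \<Lambda> ^ (s - 1) * p ^ (s * t) * (real N ^ s * 4 ^ t + s * real N ^ s * \<Lambda> ^ (s * t) * (2 / real N) ^ t) \<le> card E"
      using Qge unfolding L_def[symmetric] by (simp add: distrib_left)
  qed
qed

section \<open>Asymptotics\<close>

text \<open>\<open>n powr (- \<mu>)\<close> is the random density, and \<open>y\<close> separates
  sparse from dense hosts. The bound \<open>3 * \<mu> - 2 / q < y\<close> lets the random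
  construction win in the sparse case, the long inequality lets the tripartite one win in the dense
  case. Moreover \<open>y < 1 / q\<close> makes the edges outside \<open>U\<close> negligible, and
  \<open>1 / s < y\<close> allows the two kinds of bicliques to be estimated together.\<close>

lemma exponent_choice:
  fixes s t :: real
  assumes s: "s \<ge> 5" and t: "t > 3 / 2 * s\<^sup>2 - 21 / 4 * s + 57 / 8"
  defines "q \<equiv> s - 1" and "\<mu> \<equiv> (s + t - 2) / (s * t - 1)"
  obtains y where "1 / s < y" "y < 1 / q" "3 * \<mu> - 2 / q < y" "y * (2 * s * t + s) < 3 - 2 / q - s + t + s * t / q" "\<mu> < 1 / 4"
proof -
  \<comment> \<open>In the nonnegative excesses \<open>a\<close> and \<open>u\<close> of
    \<open>s\<close> and \<open>t\<close> the inequalities become statements about polynomial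
    coefficients.\<close>
  define a where "a = s - 5"
  define u where "u = t - (3 / 2 * s\<^sup>2 - 21 / 4 * s + 57 / 8)"
  have a: "a \<ge> 0" and u: "u > 0" using s t by (auto simp: a_def u_def)
  have seq: "s = a + 5" by (simp add: a_def)
  have teq: "t = 3 / 2 * (a + 5)\<^sup>2 - 21 / 4 * (a + 5) + 57 / 8 + u" by (simp add: u_def seq)
  have t2: "t - (s\<^sup>2 - 3 * s + 4) = 35 / 8 + u + 11 / 4 * a + a\<^sup>2 / 2"
    unfolding teq seq by (simp add: power2_eq_square algebra_simps add_divide_distrib)
  have t3: "t > s\<^sup>2 - 3 * s + 4"
  proof -
    have "0 < 35 / 8 + u + 11 / 4 * a + a\<^sup>2 / 2" using a u by (intro add_pos_nonneg) auto
    thus ?thesis using t2 by linarith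
  qed
  have q: "q \<ge> 4" using s by (simp add: q_def)
  have t10: "t > 10"
  proof -
    have "s * s \<ge> 5 * s" using s by (intro mult_right_mono) auto
    thus ?thesis using t3 s unfolding power2_eq_square by linarith
  qed
  have st: "s * t - 1 > 0"
  proof -
    have "s * t \<ge> 5 * 10" using s t10 by (intro mult_mono) auto
    thus ?thesis by linarith
  qed
  have pos: "2 * s * t + s > 0" using st s by linarith
  define B where "B = (3 - 2 / q - s + t + s * t / q) / (2 * s * t + s)"
  have "\<mu> < 1 / q"
  proof -
    have "(s + t - 2) * q < s * t - 1"
      using t3 by (simp add: q_def algebra_simps power2_eq_square)
    thus ?thesis using st q by (simp add: \<mu>_def field_simps)
  qed
  moreover have "1 / q \<le> 1 / 4" using q by (simp add: field_simps)
  ultimately have lam: "\<mu> < 1 / 4" "3 * \<mu> - 2 / q < 1 / q" by (simp_all add: field_simps)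
  have 1: "1 / s < 1 / q" using s by (simp add: q_def field_simps)
  have 2: "1 / s < B"
  proof -
    have "(s - 2) * q < t - 2" using t3 by (simp add: q_def algebra_simps power2_eq_square)
    hence "s - 2 < (t - 2) / q" using q by (simp add: pos_less_divide_eq)
    hence "2 * t + 1 < 3 - 2 / q - s + 2 * t + t / q" by (simp add: diff_divide_distrib)
    moreover have "2 * t + t / q = t + s * t / q" using q by (simp add: q_def field_simps)
    ultimately have "2 * t + 1 < 3 - 2 / q - s + t + s * t / q" by linarith
    moreover have "1 / s * (2 * s * t + s) = 2 * t + 1" using s by (simp add: field_simps)
    ultimately show ?thesis unfolding B_def using pos by (simp only: pos_less_divide_eq)
  qed
  have 3: "3 * \<mu> - 2 / q < B"
  proof -
    \<comment> \<open>Numerator of \<open>B - (3 * \<mu> - 2 / q)\<close> over the common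
      denominator. Expanded in \<open>a\<close> and \<open>u\<close>, only the coefficient of
      \<open>a\<close> is negative; the constant and the term in \<open>a\<^sup>2\<close> make up
      for it.\<close>
    define G where "G = (s * t - 1) * ((3 - s + t) * q - 2 + s * t) - 3 * (s + t - 2) * q * (2 * s * t + s) + 2 * (s * t - 1) * (2 * s * t + s)"
    have "G = (681 / 64 - 1559 / 64 * a + 28 * a\<^sup>2) + (1879 / 4 * u + 25 * u\<^sup>2 + 1345 / 4 * (a * u) + 5 * (a * u\<^sup>2)
       + 177 / 2 * (a\<^sup>2 * u) + 465 / 16 * a ^ 3 + 8 * (a ^ 3 * u) + 33 / 4 * a ^ 4 + 3 / 4 * a ^ 5)"
      unfolding G_def q_def teq seq by (simp add: algebra_simps add_divide_distrib power2_eq_square power3_eq_cube power4_eq_xxxx numeral_eq_Suc)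
    moreover have "0 < 681 / 64 - 1559 / 64 * a + 28 * a\<^sup>2"
    proof -
      \<comment> \<open>Completing the square:
        \<open>1559 / 3584 = (1559 / 64) / (2 * 28)\<close>.\<close>
      have "28 * (a - 1559 / 3584)\<^sup>2 \<ge> 0" by simp
      thus ?thesis by (simp add: power2_eq_square algebra_simps)
    qed
    moreover have "0 \<le> 1879 / 4 * u + 25 * u\<^sup>2 + 1345 / 4 * (a * u) + 5 * (a * u\<^sup>2)
       + 177 / 2 * (a\<^sup>2 * u) + 465 / 16 * a ^ 3 + 8 * (a ^ 3 * u) + 33 / 4 * a ^ 4 + 3 / 4 * a ^ 5"
      using a u by (intro add_nonneg_nonneg) auto
    ultimately have G: "G > 0" by linarith
    have "B - (3 * \<mu> - 2 / q) = G / (q * (s * t - 1) * (2 * s * t + s))"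
    proof -
      have nz: "q \<noteq> 0" "s * t - 1 \<noteq> 0" "2 * s * t + s \<noteq> 0" using q st pos by auto
      have "B = ((3 - s + t) * q - 2 + s * t) * (s * t - 1) / (q * (s * t - 1) * (2 * s * t + s))"
      proof -
        have "3 - 2 / q - s + t + s * t / q = ((3 - s + t) * q - 2 + s * t) / q"
          using nz(1) by (simp add: add_divide_distrib diff_divide_distrib)
        hence B: "B = ((3 - s + t) * q - 2 + s * t) / (q * (2 * s * t + s))"
          unfolding B_def by (simp only: divide_divide_eq_left)
        have nz': "q * (2 * s * t + s) \<noteq> 0" "q * (s * t - 1) * (2 * s * t + s) \<noteq> 0" using nz by simp_all
        show ?thesis unfolding B frac_eq_eq[OF nz'] by (simp only: mult_ac)
      qed
      moreover have "3 * \<mu> = 3 * (s + t - 2) * q * (2 * s * t + s) / (q * (s * t - 1) * (2 * s * t + s))"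
        unfolding \<mu>_def using nz by simp
      moreover have "2 / q = 2 * (s * t - 1) * (2 * s * t + s) / (q * (s * t - 1) * (2 * s * t + s))"
      proof -
        have "q * (s * t - 1) * (2 * s * t + s) \<noteq> 0" using nz by simp
        thus ?thesis by (subst frac_eq_eq[OF nz(1)]) (simp_all only: mult_ac not_False_eq_True)
      qed
      ultimately show ?thesis unfolding G_def by (simp add: add_divide_distrib diff_divide_distrib mult_ac)
    qed
    also have "\<dots> > 0" using G q st pos by simp
    finally show ?thesis by linarith
  qed
  obtain y where y: "max (1 / s) (3 * \<mu> - 2 / q) < y" "y < min (1 / q) B"
    using dense[of "max (1 / s) (3 * \<mu> - 2 / q)" "min (1 / q) B"] 1 2 3 lam by auto
  show ?thesis
  proof (rule that[of y])
    have "y < B" using y by simp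
    thus "y * (2 * s * t + s) < 3 - 2 / q - s + t + s * t / q"
      unfolding B_def using pos by (simp add: pos_less_divide_eq)
  qed (use y lam in auto)
qed

text \<open>Decides the minimum in the theorem for \<open>s \<ge> 5\<close>. The induction uses the
  constant \<open>8\<close>, which absorbs \<open>57 / 8\<close> and the last fraction, as the
  latter is at most \<open>7 / 8\<close>.\<close>

lemma fact_ge_quadratic:
  assumes "s \<ge> 5"
  shows "3 / 2 * (real s)\<^sup>2 - 21 / 4 * real s + 57 / 8 + 3 / (8 * (2 * real s - 3)) \<le> fact (s - 1)"
proof -
  have "3 / 2 * (real s)\<^sup>2 - 21 / 4 * real s + 8 \<le> fact (s - 1)"
    using assms
  proof (induction s rule: dec_induct)
    case base
    show ?case by (simp add: fact_numeral power2_eq_square)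
  next
    case (step n)
    have n: "real n \<ge> 5" using step by simp
    have "3 / 2 * (real (Suc n))\<^sup>2 - 21 / 4 * real (Suc n) + 8 \<le> 5 * (3 / 2 * (real n)\<^sup>2 - 21 / 4 * real n + 8)"
    proof -
      have "real n * real n \<ge> 5 * real n" using n by (intro mult_right_mono) auto
      moreover have e: "real (Suc n) = real n + 1" by simp
      ultimately show ?thesis using n unfolding power2_eq_square e ring_distribs by linarith
    qed
    also have "\<dots> \<le> 5 * fact (n - 1)" using step by simp
    also have "\<dots> \<le> real n * fact (n - 1)" using n by (intro mult_right_mono) auto
    also have "\<dots> = fact (Suc n - 1)" using n by (cases n) auto
    finally show ?case .
  qed
  moreover have "3 / (8 * (2 * real s - 3)) \<le> 7 / 8" using assms by (simp add: field_simps)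
  ultimately show ?thesis by linarith
qed

lemma powr_eventually_le:
  fixes c C d e :: real
  assumes "d < e" "c > 0"
  shows "\<forall>\<^sub>F n in sequentially. C * real n powr d \<le> c * real n powr e"
proof -
  define M where "M = max 1 (C / c)"
  have "\<forall>\<^sub>F n in sequentially. M powr (1 / (e - d)) \<le> real n"
    using filterlim_real_sequentially by (simp add: filterlim_at_top)
  thus ?thesis
  proof eventually_elim
    case (elim n)
    have "C / c \<le> M" by (simp add: M_def)
    also have "M = (M powr (1 / (e - d))) powr (e - d)" using assms(1) by (simp add: powr_powr M_def)
    also have "\<dots> \<le> real n powr (e - d)" using elim assms(1) by (intro powr_mono2) auto
    finally have "C / c \<le> real n powr (e - d)" .
    hence "C \<le> c * real n powr (e - d)" using assms(2) by (simp add: field_simps)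
    hence "C * real n powr d \<le> c * real n powr (e - d) * real n powr d" by (intro mult_right_mono) auto
    also have "\<dots> = c * real n powr e" by (simp add: powr_add[symmetric])
    finally show ?case .
  qed
qed

text \<open>The defining equation of \<open>\<mu>\<close> says that at density
  \<open>n powr (- \<mu>)\<close> the triangles, about \<open>n ^ 3 * p ^ 3\<close>, and the bad
  configurations, about \<open>n ^ (s + t + 1) * p ^ (s * t + 2)\<close>, have the same exponent.
  Configurations with \<open>z\<close> inside the copy have exponent \<open>2 - 2 * \<mu>\<close>,
  which is smaller since \<open>\<mu> < 1\<close>.\<close>

lemma ex_ge_random_deletion:
  fixes s t :: nat
  assumes st: "s \<ge> 2" "t \<ge> 2"
  defines "\<mu> \<equiv> (real s + real t - 2) / (real s * real t - 1)"
  assumes \<mu>: "\<mu> < 1"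
  obtains c where "c > 0" "\<forall>\<^sub>F n in sequentially. c * real n powr (3 - 3 * \<mu>) \<le> real (ex n (expansion (complete_bipartite s t)))"
proof -
  \<comment> \<open>As \<open>s * t + 2 \<ge> 4\<close>, bad configurations carry a factor of at
    most \<open>c ^ 4 = c ^ 3 / 108\<close>. They and the term of lower order leave
    \<open>c ^ 3 / 54\<close> of the \<open>c ^ 3 / 27\<close> contributed by the triangles.\<close>
  define c where "c = (1 / 108 :: real)"
  have c: "0 < c" "c \<le> 1" by (simp_all add: c_def)
  have st4: "real s * real t \<ge> 4" using mult_mono[of 2 "real s" 2 "real t"] st by simp
  have \<mu>0: "0 \<le> \<mu>" using st st4 by (simp add: \<mu>_def)
  have \<mu>eq: "\<mu> * (real s * real t - 1) = real s + real t - 2" using st4 by (simp add: \<mu>_def)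
  have "\<forall>\<^sub>F n in sequentially. real (s + t) * c ^ (s * t + 1) * real n powr (2 - 2 * \<mu>) \<le> c ^ 3 / 108 * real n powr (3 - 3 * \<mu>)"
    by (rule powr_eventually_le) (use \<mu> c in auto)
  moreover have "\<forall>\<^sub>F n in sequentially. n \<ge> (3::nat)" by (rule eventually_ge_at_top)
  ultimately have "\<forall>\<^sub>F n in sequentially. c ^ 3 / 54 * real n powr (3 - 3 * \<mu>) \<le> real (ex n (expansion (complete_bipartite s t)))"
  proof eventually_elim
    case (elim n)
    have n: "real n \<ge> 1" using elim(2) by simp
    define p where "p = c * real n powr (- \<mu>)"
    have pk: "p ^ k = c ^ k * real n powr (- (\<mu> * real k))" for k
      using n by (simp add: p_def power_mult_distrib powr_power mult.commute)
    have nk: "real n ^ k = real n powr (real k)" for k using n by (simp add: powr_realpow)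
    have "real n powr (- \<mu>) \<le> real n powr 0" using n \<mu>0 by (intro powr_mono) auto
    hence p: "0 \<le> p" "p \<le> 1" using n c by (auto simp: p_def intro!: mult_le_one)
    have s0: "s > 0" "t > 0" using st by auto
    obtain E :: "nat set set" where E: "\<Union>E \<subseteq> {..<n}" "\<And>e. e \<in> E \<Longrightarrow> card e = 3" "\<not> kst_copy s t E"
      "real (n choose 3) * p ^ 3 - real n ^ s * real n ^ t * (real n * p ^ (s * t + 2) + real (s + t) * p ^ (s * t + 1)) \<le> card E"
      using random_deletion[OF p s0, where n = n] by metis
    have fE: "finite (\<Union>E)" using E(1) finite_subset by blast
    have "card (\<Union>E) \<le> n" using card_mono[OF _ E(1)] by simp
    hence le: "card E \<le> ex n (expansion (complete_bipartite s t))"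
      by (intro card_le_ex fE E s0)
    have "(real n / 3) ^ 3 \<le> real (n choose 3)"
      using binomial_ge_n_over_k_pow_k[of 3 n, where 'a = real] elim(2) by simp
    hence "(real n / 3) ^ 3 * p ^ 3 \<le> real (n choose 3) * p ^ 3" using p by (intro mult_right_mono) auto
    moreover have "(real n / 3) ^ 3 * p ^ 3 = c ^ 3 / 27 * (real n powr 3 * real n powr (- (\<mu> * 3)))"
      unfolding pk power_divide nk by simp
    moreover have "real n powr 3 * real n powr (- (\<mu> * 3)) = real n powr (3 - 3 * \<mu>)"
      unfolding powr_add[symmetric] by (simp add: mult.commute)
    ultimately have 1: "c ^ 3 / 27 * real n powr (3 - 3 * \<mu>) \<le> real (n choose 3) * p ^ 3" by simp
    have "real n ^ s * real n ^ t * (real n * p ^ (s * t + 2)) =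
        c ^ (s * t + 2) * (real n powr real s * real n powr real t * (real n powr 1 * real n powr (- (\<mu> * real (s * t + 2)))))"
      unfolding pk nk using n by simp
    also have "real n powr real s * real n powr real t * (real n powr 1 * real n powr (- (\<mu> * real (s * t + 2))))
       = real n powr (3 - 3 * \<mu>)"
    proof -
      have "real s + real t + (1 + - (\<mu> * real (s * t + 2))) = 3 - 3 * \<mu>" using \<mu>eq by (simp add: algebra_simps)
      thus ?thesis by (simp only: powr_add[symmetric])
    qed
    also have "c ^ (s * t + 2) * real n powr (3 - 3 * \<mu>) \<le> c ^ 4 * real n powr (3 - 3 * \<mu>)"
    proof (intro mult_right_mono power_decreasing)
      have "2 * 2 \<le> s * t" using st by (intro mult_mono) auto
      thus "4 \<le> s * t + 2" by simp
    qed (use c in auto)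
    also have "c ^ 4 = c ^ 3 / 108" by (simp add: c_def numeral_eq_Suc)
    finally have 2: "real n ^ s * real n ^ t * (real n * p ^ (s * t + 2)) \<le> c ^ 3 / 108 * real n powr (3 - 3 * \<mu>)" .
    have "real n ^ s * real n ^ t * (real (s + t) * p ^ (s * t + 1)) =
        real (s + t) * c ^ (s * t + 1) * (real n powr real s * real n powr real t * real n powr (- (\<mu> * real (s * t + 1))))"
      unfolding pk nk by simp
    also have "real n powr real s * real n powr real t * real n powr (- (\<mu> * real (s * t + 1))) = real n powr (2 - 2 * \<mu>)"
    proof -
      have "real s + real t + - (\<mu> * real (s * t + 1)) = 2 - 2 * \<mu>" using \<mu>eq by (simp add: algebra_simps)
      thus ?thesis by (simp only: powr_add[symmetric])
    qed
    also note elim(1)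
    finally have 3: "real n ^ s * real n ^ t * (real (s + t) * p ^ (s * t + 1)) \<le> c ^ 3 / 108 * real n powr (3 - 3 * \<mu>)" .
    have "c ^ 3 / 54 * real n powr (3 - 3 * \<mu>) \<le> card E"
      using 1 2 3 E(4) by (simp add: distrib_left)
    also have "real (card E) \<le> real (ex n (expansion (complete_bipartite s t)))" using le by simp
    finally show ?case .
  qed
  thus ?thesis by (intro that[of "c ^ 3 / 54"]) (use c in auto)
qed

section \<open>Consequences of a vertex of large degree\<close>

definition degree_sum :: "('a \<Rightarrow> 'a \<Rightarrow> bool) \<Rightarrow> 'a set \<Rightarrow> real" where
  "degree_sum A V = (\<Sum>x\<in>V. real (card {y\<in>V. A x y}))"

lemma degree_sum_le_subset:
  assumes fin: "finite V" and sub: "U \<subseteq> V" and sym: "\<And>x y. A x y \<Longrightarrow> A y x"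
  shows "degree_sum A V \<le> degree_sum A U + 2 * (\<Sum>x\<in>V - U. real (card {y\<in>V. A x y}))"
proof -
  have finU: "finite U" using fin sub finite_subset by blast
  have "degree_sum A V = (\<Sum>x\<in>U. real (card {y\<in>V. A x y})) + (\<Sum>x\<in>V - U. real (card {y\<in>V. A x y}))"
    unfolding degree_sum_def using sum.subset_diff[OF sub fin] by (simp add: add.commute)
  moreover have "(\<Sum>x\<in>U. real (card {y\<in>V. A x y})) \<le> (\<Sum>x\<in>U. real (card {y\<in>U. A x y}) + real (card {y\<in>V - U. A x y}))"
  proof (rule sum_mono)
    fix x
    have "{y\<in>V. A x y} = {y\<in>U. A x y} \<union> {y\<in>V - U. A x y}" using sub by auto
    thus "real (card {y\<in>V. A x y}) \<le> real (card {y\<in>U. A x y}) + real (card {y\<in>V - U. A x y})"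
      by (simp only: of_nat_add[symmetric] of_nat_le_iff card_Un_le)
  qed
  moreover have "(\<Sum>x\<in>U. card {y\<in>V - U. A x y}) = (\<Sum>y\<in>V - U. card {x\<in>U. A x y})"
    by (rule sum_multicount_gen) (use fin finU in auto)
  hence "(\<Sum>x\<in>U. real (card {y\<in>V - U. A x y})) = (\<Sum>y\<in>V - U. real (card {x\<in>U. A x y}))"
    by (metis (no_types, lifting) of_nat_sum sum.cong)
  moreover have "(\<Sum>y\<in>V - U. real (card {x\<in>U. A x y})) \<le> (\<Sum>x\<in>V - U. real (card {y\<in>V. A x y}))"
    using fin sub sym by (intro sum_mono of_nat_mono card_mono) auto
  ultimately show ?thesis unfolding degree_sum_def by (simp add: sum.distrib)
qed

lemma kst_bound_powr:
  fixes X :: "'a set" and Y :: "'b set"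
  assumes fin: "finite X" "finite Y" and k: "k > 0"
    and common: "\<And>S. S \<subseteq> Y \<Longrightarrow> card S = k \<Longrightarrow> card {x\<in>X. \<forall>y\<in>S. R x y} \<le> t"
    and n: "card X \<le> n" "card Y \<le> n" "n > 0"
  shows "(\<Sum>x\<in>X. real (card {y\<in>Y. R x y})) \<le> (k + 1 + t * k ^ k) * real n powr (2 - 1 / k)"
proof -
  define r where "r = real n powr (1 / k)"
  have n1: "real n \<ge> 1" using n by simp
  have r: "r > 0" using n1 by (simp add: r_def)
  have rk: "r ^ k = n" using k n1 by (simp add: r_def powr_power)
  have rr: "real n / r = real n powr (1 - 1 / k)" using n1 by (simp add: r_def powr_diff)
  have "(\<Sum>x\<in>X. real (card {y\<in>Y. R x y})) \<le> k * r ^ k + (1 + t * k ^ k) * card Y * (r ^ k / r)"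
    by (rule kst_bound[OF fin k common r]) (use n rk in auto)
  also have "\<dots> \<le> k * real n powr (2 - 1 / k) + (1 + t * k ^ k) * real n powr (2 - 1 / k)"
  proof (rule add_mono)
    have "real n powr 1 \<le> real n powr (2 - 1 / k)" using n1 k by (intro powr_mono) (auto simp: field_simps)
    thus "k * r ^ k \<le> k * real n powr (2 - 1 / k)" unfolding rk using n1 by (intro mult_left_mono) auto
    have "real (card Y) * (r ^ k / r) \<le> real n powr 1 * real n powr (1 - 1 / k)"
      unfolding rk rr using n n1 by (intro mult_mono) auto
    also have "\<dots> = real n powr (1 + (1 - 1 / k))" by (simp only: powr_add)
    also have "1 + (1 - 1 / k) = 2 - 1 / real k" by simp
    finally have "(1 + t * k ^ k) * (real (card Y) * (r ^ k / r)) \<le> (1 + t * k ^ k) * real n powr (2 - 1 / k)"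
      by (rule mult_left_mono) simp
    thus "(1 + t * k ^ k) * card Y * (r ^ k / r) \<le> (1 + t * k ^ k) * real n powr (2 - 1 / k)"
      by (simp only: of_nat_mult mult.assoc)
  qed
  also have "\<dots> = (real k + 1 + real t * real k ^ k) * real n powr (2 - 1 / k)" by (simp add: algebra_simps)
  finally show ?thesis .
qed

lemma kst_copy_mono:
  assumes "kst_copy s t E" "E \<subseteq> F"
  shows "kst_copy s t F"
proof -
  obtain P Q R where *: "inj_on P {..<s}" "inj_on Q {..<t}" "inj_on R ({..<s} \<times> {..<t})"
    "P ` {..<s} \<inter> Q ` {..<t} = {}" "(P ` {..<s} \<union> Q ` {..<t}) \<inter> R ` ({..<s} \<times> {..<t}) = {}"
    and E: "\<And>i j. i < s \<Longrightarrow> j < t \<Longrightarrow> {P i, Q j, R (i, j)} \<in> E"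
    using assms(1) by (rule kst_copyE) (rule that; assumption)
  have "\<forall>i<s. \<forall>j<t. {P i, Q j, R (i, j)} \<in> F" using E assms(2) by blast
  thus ?thesis unfolding kst_copy_def using * by (intro exI[of _ P] exI[of _ Q] exI[of _ R] conjI)
qed

lemma two_choose_two: "2 * (m choose 2) = m * (m - 1)"
proof -
  have "even (m * (m - 1))" by (cases m) auto
  thus ?thesis unfolding choose_two by (rule dvd_mult_div_cancel)
qed

text \<open>Each of the \<open>w\<close> vertices contributes at most \<open>K \<le> n / 2\<close>
  instead of \<open>n\<close> to twice the degree, while at most about \<open>n\<^sup>2 / 16\<close>
  may be missing. This gives \<open>w \<le> n / 8 + 4\<close>, which is at most \<open>n / 6\<close>
  for \<open>n \<ge> 96\<close>.\<close>

lemma card_complement_high_degree: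
  fixes n w K v' d :: nat
  assumes n: "96 \<le> n" "2 * K \<le> n" and split: "n = Suc (v' + w)"
    and d: "15 / 16 * real ((n - 1) choose 2) \<le> real d" "2 * d \<le> v' * n + K * w"
  shows "6 * w \<le> n"
proof -
  define x where "x = real n"
  define y where "y = real w"
  have x: "x \<ge> 96" "2 * real K \<le> x" using n by (simp_all add: x_def)
  have y0: "y \<ge> 0" by (simp add: y_def)
  have "2 * ((n - 1) choose 2) = (n - 1) * (n - 2)" using two_choose_two[of "n - 1"] by (simp add: numeral_2_eq_2)
  hence "2 * real ((n - 1) choose 2) = real (n - 1) * real (n - 2)" by (metis of_nat_mult of_nat_numeral)
  also have "\<dots> = (x - 1) * (x - 2)" using n by (simp add: of_nat_diff x_def)
  finally have ch: "2 * real ((n - 1) choose 2) = (x - 1) * (x - 2)" .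
  have v': "real v' = x - 1 - y" using split by (simp add: x_def y_def)
  have "2 * real d \<le> (x - 1 - y) * x + real K * y"
    using of_nat_mono[OF d(2), where 'a = real] by (simp add: v' x_def[symmetric] y_def[symmetric])
  hence "15 / 16 * ((x - 1) * (x - 2)) \<le> (x - 1 - y) * x + real K * y" using d(1) ch by linarith
  moreover have "real K * y \<le> x / 2 * y" using x y0 by (intro mult_right_mono) auto
  ultimately have "x * y \<le> x * (x / 8) + x * 4"
    using x by (simp add: field_simps)
  hence "x * y \<le> x * (x / 8 + 4)" by (simp add: distrib_left)
  hence "y \<le> x / 8 + 4" using x by (simp add: mult_le_cancel_left)
  hence "6 * y \<le> x" using x by simp
  thus ?thesis by (simp add: x_def y_def)
qed

text \<open>What the asymptotic argument retains of a copy-free host. \<open>U\<close> has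
  \<open>n div 3\<close> vertices so that three copies of it fit into \<open>n\<close>. Of the two
  bounds on \<open>degree_sum A V\<close>, the one by a power of \<open>n\<close> serves
  \<open>s = 4\<close>; the comparison with \<open>U\<close> serves
  \<open>s \<ge> 5\<close>.\<close>

definition shadow_host :: "nat \<Rightarrow> nat \<Rightarrow> real \<Rightarrow> nat \<Rightarrow> (nat \<Rightarrow> nat \<Rightarrow> bool) \<Rightarrow> nat set \<Rightarrow> nat set \<Rightarrow> bool" where
  "shadow_host s t C n A V U \<longleftrightarrow> finite V \<and> card V = n \<and> U \<subseteq> V \<and> card U = n div 3 \<and>
     (\<forall>x y. A x y \<longrightarrow> A y x) \<and> (\<forall>x. \<not> A x x) \<and> kst_free s t A \<and>
     real (ex n (expansion (complete_bipartite s t))) \<le> C * ((real n)\<^sup>2 + degree_sum A V * real n powr (1 - 2 / real (s - 1))) \<and>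
     degree_sum A V \<le> C * real n powr (2 - 1 / real s) \<and>
     degree_sum A V \<le> degree_sum A U + C * real n powr (2 - 1 / real (s - 1))"

text \<open>The triples inside \<open>W\<close> number at most half of \<open>ex\<close>, which
  leaves a quarter of it from the assumed \<open>3 / 4\<close>. The triangles touching
  \<open>V'\<close> and the quadratic terms have to cover this quarter, whence the factors
  \<open>4\<close> in \<open>C\<close>.\<close>

lemma high_degree_asymptotics:
  fixes s t :: nat
  assumes s: "s \<ge> 3" and t: "t > 0"
  obtains C N0 where "C > 0"
    "\<And>n H :: nat hypergraph. n \<ge> N0 \<Longrightarrow> three_graph H \<Longrightarrow> card (verts H) = n \<Longrightarrow>
        15 / 16 * real ((n - 1) choose 2) \<le> real (max_degree H) \<Longrightarrow>
        3 / 4 * real (ex n (expansion (complete_bipartite s t))) \<le> real (card (edges H)) \<Longrightarrow>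
        \<not> contains_copy H (expansion (complete_bipartite s t)) \<Longrightarrow>
      \<exists>A V U. shadow_host s t C n A V U"
proof -
  define q where "q = s - 1"
  have q: "q \<ge> 2" using s by (simp add: q_def)
  define K where "K = s * t + (s + t)"
  define C1 where "C1 = real s + 1 + real t * real s ^ s"
  define C2 where "C2 = 2 * (real q + 1 + real t * real q ^ q)"
  define C3 where "C3 = 2 * (1 + real t * real q ^ q) + real t * real q ^ q"
  define C where "C = C1 + C2 + 4 * C3 + 4 * (real (K + 1) + 3 * q)"
  have C0: "C1 \<ge> 0" "C2 \<ge> 0" "C3 \<ge> 0" by (simp_all add: C1_def C2_def C3_def)
  have C: "C1 \<le> C" "C2 \<le> C" "4 * C3 \<le> C" "4 * (real (K + 1) + 3 * q) \<le> C" "C > 0"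
    using C0 unfolding C_def by auto
  show ?thesis
  proof (rule that[of C "96 + 2 * K"])
    show "C > 0" by fact
    fix n :: nat and H :: "nat hypergraph"
    assume n: "96 + 2 * K \<le> n" and H: "three_graph H" and cV: "card (verts H) = n"
      and deg: "15 / 16 * real ((n - 1) choose 2) \<le> real (max_degree H)"
      and E: "3 / 4 * real (ex n (expansion (complete_bipartite s t))) \<le> real (card (edges H))"
      and nc: "\<not> contains_copy H (expansion (complete_bipartite s t))"
    define V where "V = verts H"
    have st: "s > 0" "t > 0" using s t by auto
    have fin: "finite V" and e3: "\<And>e. e \<in> edges H \<Longrightarrow> e \<subseteq> V \<and> card e = 3"
      using H by (auto simp: uniform_graph_def V_def)
    have free: "\<not> kst_copy s t (edges H)" using contains_copy_expansion_iff[OF H st] nc by blast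
    have Vne: "V \<noteq> {}" using cV n by (auto simp: V_def)
    have "Max (Defs.degree H ` V) \<in> Defs.degree H ` V" using fin Vne by (intro Max_in) auto
    then obtain v where v: "v \<in> V" "max_degree H = Defs.degree H v"
      unfolding max_degree_def V_def by auto
    have cV': "card V = n" using cV by (simp add: V_def)
    obtain A V' W where VW: "V' \<subseteq> V" "W \<subseteq> V" "V' \<inter> W = {}" "v \<notin> V'" "v \<notin> W" "V = insert v (V' \<union> W)"
      and sym: "\<And>x y. A x y \<Longrightarrow> A y x" and irr: "\<And>x. \<not> A x x" and dom: "\<And>x y. A x y \<Longrightarrow> x \<in> V' \<union> W"
      and Afree: "kst_free s t A"
      and common: "\<And>S. S \<subseteq> V \<Longrightarrow> card S = s - 1 \<Longrightarrow> card {x\<in>V'. \<forall>y\<in>S. A x y} \<le> t"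
      and dv: "2 * card {e \<in> edges H. v \<in> e} \<le> card V' * card V + K * card W"
      and cE: "real (card (edges H)) \<le> card {e \<in> edges H. e \<subseteq> W} + real (K + 1) * (real (card V))\<^sup>2
         + (\<Sum>y\<in>V. \<Sum>x\<in>{x\<in>V'. A x y}. real (card {z\<in>{z\<in>V. A y z}. A x z}))"
      by (rule high_degree_structure[OF fin e3 v(1) free st K_def]) (assumption | (rule that; assumption))+
    have finVW: "finite V'" "finite W" using VW fin finite_subset by blast+
    have "card V = Suc (card (V' \<union> W))" unfolding VW(6) using VW(4,5) finVW by simp
    also have "card (V' \<union> W) = card V' + card W" using VW(3) finVW by (rule card_Un_disjoint[rotated 2])
    finally have cW: "n = Suc (card V' + card W)" using cV' by simp
    have W6: "6 * card W \<le> n"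
    proof (rule card_complement_high_degree[OF _ _ cW])
      show "15 / 16 * real ((n - 1) choose 2) \<le> real (Defs.degree H v)" using deg v(2) by simp
      show "2 * Defs.degree H v \<le> card V' * n + K * card W" using dv cV' by (simp add: Defs.degree_def)
    qed (use n in auto)
    \<comment> \<open>Since \<open>W \<subseteq> U\<close> and \<open>v\<close> is isolated, an edge
      of \<open>A\<close> not inside \<open>U\<close> has an endpoint in \<open>V'\<close>; such
      edges are few by \<open>kst_bound_powr\<close> with \<open>q\<close> in place of
      \<open>s\<close>.\<close>
    have "card W \<le> n div 3" "n div 3 \<le> card V" using W6 cV' by linarith+
    then obtain U where U: "W \<subseteq> U" "U \<subseteq> V" "card U = n div 3"
      using exists_subset_between[of W "n div 3" V] VW(2) fin by blast
    define r where "r = real n powr (1 / real q)"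
    have n1: "real n \<ge> 1" using n by simp
    have r: "r > 0" "r ^ q = n" using q n1 by (auto simp: r_def powr_power)
    have rr: "r ^ q / r\<^sup>2 = real n powr (1 - 2 / real q)"
      unfolding r(2) using n1 by (simp add: r_def powr_power powr_diff)
    have DV: "degree_sum A V = (\<Sum>y\<in>V. real (card {z\<in>V. A y z}))" by (simp add: degree_sum_def)
    have D0: "degree_sum A V \<ge> 0" by (simp add: degree_sum_def sum_nonneg)
    have common': "card {x\<in>V'. \<forall>y\<in>S. A x y} \<le> t" if "S \<subseteq> V" "card S = q" for S
      using common that by (simp add: q_def)
    have T: "(\<Sum>y\<in>V. \<Sum>x\<in>{x\<in>V'. A x y}. real (card {z\<in>{z\<in>V. A y z}. A x z}))
       \<le> C3 * degree_sum A V * (real n powr (1 - 2 / real q)) + 3 * real q * (real n)\<^sup>2"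
    proof -
      have cr: "real (card V) \<le> r ^ q" using cV' r(2) by simp
      have "(\<Sum>y\<in>V. \<Sum>x\<in>{x\<in>V'. A x y}. real (card {z\<in>{z\<in>V. A y z}. A x z}))
        \<le> C3 * degree_sum A V * (r ^ q / r\<^sup>2) + 3 * real q * (r ^ q)\<^sup>2"
        unfolding C3_def DV
        by (rule triangles_touching_bound[OF fin VW(1) q _ irr _ r(1) cr]) (erule sym | erule (1) common' | assumption)+
      thus ?thesis unfolding rr unfolding r(2) by simp
    qed
    have "2 * card {e \<in> edges H. e \<subseteq> W} \<le> ex n (expansion (complete_bipartite s t))"
    proof (rule two_card_le_ex[OF _ _ _ st])
      have sub: "\<Union>{e \<in> edges H. e \<subseteq> W} \<subseteq> W" by auto
      show "finite (\<Union>{e \<in> edges H. e \<subseteq> W})" using sub finVW(2) finite_subset by blast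
      show "2 * card (\<Union>{e \<in> edges H. e \<subseteq> W}) \<le> n" using card_mono[OF finVW(2) sub] W6 by linarith
      show "\<not> kst_copy s t {e \<in> edges H. e \<subseteq> W}" using free kst_copy_mono[of s t "{e \<in> edges H. e \<subseteq> W}" "edges H"] by auto
    qed (use e3 in auto)
    hence "2 * real (card {e \<in> edges H. e \<subseteq> W}) \<le> real (ex n (expansion (complete_bipartite s t)))"
      by (metis of_nat_le_iff of_nat_mult of_nat_numeral)
    hence "real (ex n (expansion (complete_bipartite s t))) \<le> 4 * (real (K + 1) + 3 * q) * (real n)\<^sup>2 + 4 * C3 * (degree_sum A V * real n powr (1 - 2 / real q))"
      using E cE T cV' by (simp add: algebra_simps)
    also have "\<dots> \<le> C * (real n)\<^sup>2 + C * (degree_sum A V * real n powr (1 - 2 / real q))"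
      using C D0 by (intro add_mono mult_right_mono) auto
    finally have 1: "real (ex n (expansion (complete_bipartite s t))) \<le> C * ((real n)\<^sup>2 + degree_sum A V * real n powr (1 - 2 / real (s - 1)))"
      by (simp add: distrib_left q_def)
    have "degree_sum A V \<le> C1 * real n powr (2 - 1 / real s)"
      unfolding DV C1_def
    proof (rule order_trans[OF kst_bound_powr[of V V s A t n]])
      fix S assume S: "S \<subseteq> V" "card S = s"
      have "card {x\<in>V. \<forall>y\<in>S. A y x} < t"
        by (rule kst_free_card_common[OF Afree _ S(2) t]) (use S fin finite_subset in blast)
      moreover have "{x\<in>V. \<forall>y\<in>S. A y x} = {x\<in>V. \<forall>y\<in>S. A x y}" using sym by blast
      ultimately show "card {x\<in>V. \<forall>y\<in>S. A x y} \<le> t" by simp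
    qed (use fin cV' n st in auto)
    also have "\<dots> \<le> C * real n powr (2 - 1 / real s)" using C by (intro mult_right_mono) auto
    finally have 2: "degree_sum A V \<le> C * real n powr (2 - 1 / real s)" .
    have "(\<Sum>x\<in>V - U. real (card {y\<in>V. A x y})) \<le> (\<Sum>x\<in>insert v V'. real (card {y\<in>V. A x y}))"
      using U(1) VW(6) finVW by (intro sum_mono2) auto
    also have "\<dots> = (\<Sum>x\<in>V'. real (card {y\<in>V. A x y}))"
    proof -
      have "{y\<in>V. A v y} = {}" using dom VW(4,5) by blast
      hence "real (card {y\<in>V. A v y}) = 0" by (simp only: card.empty of_nat_0)
      thus ?thesis unfolding sum.insert[OF finVW(1) VW(4)] by linarith
    qed
    also have "\<dots> \<le> (real q + 1 + real t * real q ^ q) * real n powr (2 - 1 / q)"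
    proof (rule kst_bound_powr[OF finVW(1) fin])
      show "card {x\<in>V'. \<forall>y\<in>S. A x y} \<le> t" if "S \<subseteq> V" "card S = q" for S using common'[OF that] .
    qed (use cV' n q cW in auto)
    finally have "2 * (\<Sum>x\<in>V - U. real (card {y\<in>V. A x y})) \<le> C2 * real n powr (2 - 1 / q)"
      unfolding C2_def mult.assoc by (rule mult_left_mono) simp
    also have "\<dots> \<le> C * real n powr (2 - 1 / q)" using C by (intro mult_right_mono) auto
    finally have 3: "degree_sum A V \<le> degree_sum A U + C * real n powr (2 - 1 / real (s - 1))"
      using degree_sum_le_subset[OF fin U(2), of A] sym unfolding q_def by fastforce
    show "\<exists>A V U. shadow_host s t C n A V U"
      using fin cV' U(2,3) sym irr Afree 1 2 3
      by (intro exI[of _ A] exI[of _ V] exI[of _ U], unfold shadow_host_def) (intro conjI; blast)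
  qed
qed

text \<open>A host with degree sum \<open>D\<close> of order at least \<open>n powr (2 - y)\<close>
  has a core of minimum degree \<open>\<delta>\<close> of order at least
  \<open>n powr (1 - y)\<close>. Thinning with \<open>p = n powr (\<kappa> + y - 1 / q)\<close>
  keeps triangles of order \<open>p\<^sup>2 * D * \<delta>\<^sup>2 / n\<close>, so at least about
  \<open>n powr (2 * \<kappa>) * D * n powr (1 - 2 / q)\<close>. The condition on \<open>y\<close>
  says that for \<open>\<kappa> = 0\<close> the loss has a smaller exponent; the slack pays for a
  positive \<open>\<kappa>\<close>.\<close>

lemma ex_ge_dense_host:
  fixes s t :: nat and y :: real
  assumes s: "s \<ge> 3" and t: "t > 0"
  defines "q \<equiv> real s - 1"
  assumes y: "1 / s < y" "y < 1 / q" "y * (2 * s * t + s) < 3 - 2 / q - s + t + s * t / q"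
  obtains c \<kappa> where "c > 0" "\<kappa> > 0"
    "\<forall>\<^sub>F n in sequentially. \<forall>A (V :: nat set). finite V \<longrightarrow> card V = n div 3 \<longrightarrow> (\<forall>x y. A x y \<longrightarrow> A y x) \<longrightarrow> (\<forall>x. \<not> A x x) \<longrightarrow>
       kst_free s t A \<longrightarrow> real n powr (2 - y) / 2 \<le> degree_sum A V \<longrightarrow>
       c * real n powr \<kappa> * (degree_sum A V * real n powr (1 - 2 / q)) \<le> real (ex n (expansion (complete_bipartite s t)))"
proof -
  define g where "g = 3 - 2 / q - s + t + s * t / q - y * (2 * s * t + s)"
  \<comment> \<open>The first bound keeps \<open>p \<le> 1\<close>; the second keeps
    \<open>\<kappa> * (s * t)\<close>, by which \<open>\<kappa>\<close> raises the exponent of the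
    loss, below the slack \<open>g\<close>.\<close>
  define \<kappa> where "\<kappa> = min (1 / q - y) (g / (2 * s * t))"
  have q: "q \<ge> 2" using s by (simp add: q_def)
  have st0: "real s * real t > 0" using s t by simp
  have g: "g > 0" using y(3) by (simp add: g_def)
  have y01: "0 < y" "y < 1"
  proof -
    have "0 \<le> 1 / real s" by simp
    thus "0 < y" using y(1) by linarith
    have "1 / q \<le> 1" using q by (simp add: field_simps)
    thus "y < 1" using y(2) by linarith
  qed
  have \<kappa>: "\<kappa> > 0" "\<kappa> + y - 1 / q \<le> 0" "\<kappa> * (s * t) < g"
  proof -
    have "g / (2 * s * t) > 0" using g s t by (intro divide_pos_pos) auto
    thus "\<kappa> > 0" using y(2) by (simp add: \<kappa>_def)
    show "\<kappa> + y - 1 / q \<le> 0" by (simp add: \<kappa>_def)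
    have "\<kappa> * (s * t) \<le> g / (2 * s * t) * (s * t)" using st0 by (intro mult_right_mono) (auto simp: \<kappa>_def)
    also have "\<dots> = g / 2" using s t by simp
    finally show "\<kappa> * (s * t) < g" using g by linarith
  qed
  define b where "b = 2 * real s * real t"
  define B where "B = b ^ (s - 1) * (4 ^ t + s * b ^ (s * t) * 12 ^ t)"
  \<comment> \<open>Exponent of the loss: the price \<open>\<Lambda> ^ (s - 1)\<close> of destroying
    a biclique, the factor \<open>p ^ (s * t)\<close>, and the number of bicliques.\<close>
  define e2 where "e2 = y * (s - 1) + (\<kappa> + y - 1 / q) * (s * t) + (real s - real t + y * (s * t))"
  \<comment> \<open>The product of \<open>9 / 256\<close>, the square of \<open>3 / 16\<close> from
    \<open>\<delta> - 1 \<ge> \<delta> / 2\<close>, and \<open>3 / 32\<close> from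
    \<open>N \<le> n / 3\<close>.\<close>
  define c1 where "c1 = (27 / 8192 :: real)"
  have b0: "b \<ge> 0" by (simp add: b_def)
  have c1: "c1 > 0" by (simp add: c1_def)
  have e2: "e2 < 2 * \<kappa> + 3 - y - 2 / q"
  proof -
    have "e2 = y * (2 * s * t + s) - y + \<kappa> * (s * t) - s * t / q + s - t"
      using s by (simp add: e2_def of_nat_diff algebra_simps)
    also have "\<dots> < y * (2 * s * t + s) - y + g - s * t / q + s - t" using \<kappa>(3) by linarith
    also have "\<dots> = 3 - y - 2 / q" by (simp add: g_def)
    finally show ?thesis using \<kappa>(1) by linarith
  qed
  have "\<forall>\<^sub>F n in sequentially. B * real n powr e2 \<le> c1 / 4 * real n powr (2 * \<kappa> + 3 - y - 2 / q)"
    by (rule powr_eventually_le[OF e2]) (use c1 in simp)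
  moreover have "\<forall>\<^sub>F n in sequentially. (2 * real s) * real n powr 0 \<le> 3 / 8 * real n powr (1 - y)"
    by (rule powr_eventually_le) (use y01 in auto)
  moreover have "\<forall>\<^sub>F n in sequentially. n \<ge> 6 * t + 6" by (rule eventually_ge_at_top)
  ultimately have "\<forall>\<^sub>F n in sequentially. \<forall>A (V :: nat set). finite V \<longrightarrow> card V = n div 3 \<longrightarrow> (\<forall>x y. A x y \<longrightarrow> A y x) \<longrightarrow> (\<forall>x. \<not> A x x) \<longrightarrow>
       kst_free s t A \<longrightarrow> real n powr (2 - y) / 2 \<le> degree_sum A V \<longrightarrow>
       c1 / 2 * real n powr (2 * \<kappa>) * (degree_sum A V * real n powr (1 - 2 / q)) \<le> real (ex n (expansion (complete_bipartite s t)))"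
  proof eventually_elim
    case (elim n)
    show ?case
    proof (intro allI impI)
      fix A and V :: "nat set"
      assume fin: "finite V" and cV: "card V = n div 3" and sym: "\<forall>x y. A x y \<longrightarrow> A y x" and irr: "\<forall>x. \<not> A x x"
        and free: "kst_free s t A" and D: "real n powr (2 - y) / 2 \<le> degree_sum A V"
      define D' where "D' = degree_sum A V"
      define N where "N = n div 3"
      define x where "x = real n"
      define \<delta> where "\<delta> = D' / (4 * N)"
      define p where "p = x powr (\<kappa> + y - 1 / q)"
      define \<Lambda> where "\<Lambda> = 2 * real s * real t * real N / \<delta>"
      have N: "2 * t \<le> N" "N > 0" "real N \<le> x / 3" "x / 6 \<le> real N"
      proof -
        have n: "n \<ge> 6 * t + 6" by (rule elim(3))
        show "2 * t \<le> N" "N > 0" using n by (simp_all add: N_def)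
        have "3 * N \<le> n" "n \<le> 6 * N" using n unfolding N_def by linarith+
        hence "real (3 * N) \<le> real n" "real n \<le> real (6 * N)" by (simp_all only: of_nat_le_iff)
        thus "real N \<le> x / 3" "x / 6 \<le> real N" by (simp_all add: x_def)
      qed
      have x: "x \<ge> 1" using elim(3) by (simp add: x_def)
      have D': "x powr (2 - y) / 2 \<le> D'" "D' > 0"
      proof -
        show "x powr (2 - y) / 2 \<le> D'" using D by (simp add: D'_def x_def)
        moreover have "x powr (2 - y) > 0" using x by simp
        ultimately show "D' > 0" by linarith
      qed
      have \<delta>ge: "3 / 8 * x powr (1 - y) \<le> \<delta>"
      proof -
        have "3 / 8 * x powr (1 - y) * (4 * N) \<le> 3 / 8 * x powr (1 - y) * (4 * (x / 3))"
          using N by (intro mult_left_mono) auto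
        also have "\<dots> = x powr 1 * x powr (1 - y) / 2" using x by simp
        also have "\<dots> = x powr (2 - y) / 2" by (simp only: powr_add[symmetric]) simp
        also have "\<dots> \<le> D'" by (rule D')
        finally show ?thesis using N(2) by (simp add: \<delta>_def pos_le_divide_eq mult_ac)
      qed
      have \<delta>s: "2 * real s \<le> \<delta>" using elim(2) \<delta>ge x by (simp add: x_def)
      have \<delta>0: "\<delta> > 0" "\<delta> \<ge> 2" using \<delta>s s by linarith+
      have p: "0 \<le> p" "p \<le> 1"
      proof -
        show "0 \<le> p" by (simp add: p_def)
        have "p \<le> x powr 0" unfolding p_def using x \<kappa>(2) by (intro powr_mono) auto
        thus "p \<le> 1" using x by simp
      qed
      have s2: "s \<ge> 2" using s by simp
      obtain E :: "(nat \<times> nat) set set" where E: "finite (\<Union>E)" "card (\<Union>E) \<le> 3 * N" "\<And>e. e \<in> E \<Longrightarrow> card e = 3" "\<not> kst_copy s t E"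
        "p\<^sup>2 * D' * (\<delta> - 1)\<^sup>2 / (32 * real N)
          - \<Lambda> ^ (s - 1) * p ^ (s * t) * (real N ^ s * 4 ^ t + s * real N ^ s * \<Lambda> ^ (s * t) * (2 / real N) ^ t) \<le> card E"
      proof (rule permuted_tripartite_construction[of V A s t p \<delta> D' N \<Lambda>])
        show "4 * \<delta> * real (card V) \<le> D'" using N(2) by (simp add: \<delta>_def cV N_def)
        show "D' = (\<Sum>x\<in>V. real (card {y \<in> V. A x y}))" by (simp add: D'_def degree_sum_def)
        show "N = card V" using cV by (simp add: N_def)
      qed (use fin sym irr free s2 t p \<delta>s N \<Lambda>_def in blast)+
      have "card (\<Union>E) \<le> n" using E(2) by (simp add: N_def)
      hence f: "card E \<le> ex n (expansion (complete_bipartite s t))"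
        by (intro card_le_ex E) (use s t in auto)
      have pos: "c1 * x powr (2 * \<kappa>) * (D' * x powr (1 - 2 / q)) \<le> p\<^sup>2 * D' * (\<delta> - 1)\<^sup>2 / (32 * real N)"
      proof -
        have "(3 / 16 * x powr (1 - y))\<^sup>2 \<le> (\<delta> - 1)\<^sup>2" using \<delta>ge \<delta>0 by (intro power_mono) auto
        moreover have "(3 / 16 * x powr (1 - y))\<^sup>2 = 9 / 256 * x powr (2 - 2 * y)"
          proof -
            have "(x powr (1 - y))\<^sup>2 = x powr ((1 - y) + (1 - y))" by (simp only: power2_eq_square powr_add)
            also have "(1 - y) + (1 - y) = 2 - 2 * y" by simp
            finally show ?thesis by (simp add: power_mult_distrib power_divide)
          qed
        ultimately have 1: "9 / 256 * x powr (2 - 2 * y) \<le> (\<delta> - 1)\<^sup>2" by simp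
        have 2: "3 / (32 * x) \<le> 1 / (32 * real N)" using N x by (simp add: field_simps)
        have pp: "p\<^sup>2 = x powr (2 * (\<kappa> + y - 1 / q))" using x by (simp add: p_def powr_power)
        have "c1 * x powr (2 * \<kappa>) * (D' * x powr (1 - 2 / q)) = p\<^sup>2 * D' * (9 / 256 * x powr (2 - 2 * y)) * (3 / (32 * x))"
        proof -
          have "x powr (2 * \<kappa>) * x powr (1 - 2 / q) = x powr (2 * (\<kappa> + y - 1 / q)) * (x powr (2 - 2 * y) * x powr (- 1))"
            unfolding powr_add[symmetric] by (rule arg_cong[of _ _ "(powr) x"]) (simp add: algebra_simps)
          moreover have "x powr (- 1) = 1 / x" using x by (simp add: powr_minus_divide)
          ultimately show ?thesis unfolding pp c1_def by (simp add: field_simps)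
        qed
        also have "\<dots> \<le> p\<^sup>2 * D' * (\<delta> - 1)\<^sup>2 * (1 / (32 * real N))"
          using 1 2 D' x by (intro mult_mono mult_left_mono) auto
        finally show ?thesis by simp
      qed
      have \<Lambda>: "0 \<le> \<Lambda>" "\<Lambda> \<le> b * x powr y"
      proof -
        show "0 \<le> \<Lambda>" using \<delta>0 by (simp add: \<Lambda>_def)
        have "real N \<le> x powr y * \<delta>"
        proof -
          have "real N \<le> x powr 1 * (3 / 8)" using N(3) x by simp
          also have "x powr 1 = x powr y * x powr (1 - y)" by (simp only: powr_add[symmetric]) simp
          also have "x powr y * x powr (1 - y) * (3 / 8) = x powr y * (3 / 8 * x powr (1 - y))" by simp
          also have "\<dots> \<le> x powr y * \<delta>" using \<delta>ge by (intro mult_left_mono) auto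
          finally show ?thesis .
        qed
        hence "real N / \<delta> \<le> x powr y" using \<delta>0 by (simp add: pos_divide_le_eq)
        hence "b * (real N / \<delta>) \<le> b * x powr y" using b0 by (rule mult_left_mono)
        thus "\<Lambda> \<le> b * x powr y" by (simp add: \<Lambda>_def b_def)
      qed
      have \<Lambda>k: "\<Lambda> ^ k \<le> b ^ k * x powr (y * real k)" for k
      proof -
        have "\<Lambda> ^ k \<le> (b * x powr y) ^ k" by (rule power_mono[OF \<Lambda>(2,1)])
        thus ?thesis using x by (simp add: power_mult_distrib powr_power mult.commute)
      qed
      have pk: "p ^ k = x powr ((\<kappa> + y - 1 / q) * real k)" for k
        using x by (simp add: p_def powr_power mult.commute)
      have Ns: "real N ^ s \<le> x powr real s"
      proof -
        have "real N ^ s \<le> x ^ s" using N x by (intro power_mono) auto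
        thus ?thesis using x by (simp add: powr_realpow)
      qed
      have 2: "(2 / real N) ^ t \<le> 12 ^ t * x powr (- real t)"
      proof -
        have "2 / real N \<le> 12 / x" using N x by (simp add: field_simps)
        hence "(2 / real N) ^ t \<le> (12 / x) ^ t" by (intro power_mono) auto
        also have "\<dots> = 12 ^ t * x powr (- real t)" using x by (simp add: power_divide powr_minus_divide powr_realpow)
        finally show ?thesis .
      qed
      have neg: "\<Lambda> ^ (s - 1) * p ^ (s * t) * (real N ^ s * 4 ^ t + s * real N ^ s * \<Lambda> ^ (s * t) * (2 / real N) ^ t) \<le> B * x powr e2"
      proof -
        \<comment> \<open>This is where \<open>1 / s < y\<close> enters: the bicliques with
          \<open>s\<close> vertices in the third part are absorbed into the estimate for those with
          \<open>t\<close>.\<close>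
        have "real t \<le> y * (s * t)"
        proof -
          have "1 / s * (s * t) \<le> y * (s * t)" using y(1) st0 by (intro mult_right_mono) auto
          thus ?thesis using s by simp
        qed
        hence "x powr real s \<le> x powr (real s - real t + y * (s * t))" using x by (intro powr_mono) auto
        hence A1: "real N ^ s * 4 ^ t \<le> x powr (real s - real t + y * (s * t)) * 4 ^ t" using Ns by (intro mult_right_mono) auto
        have "real N ^ s * \<Lambda> ^ (s * t) * (2 / real N) ^ t \<le> x powr real s * (b ^ (s * t) * x powr (y * real (s * t))) * (12 ^ t * x powr (- real t))"
          using \<Lambda> b0 by (intro mult_mono Ns \<Lambda>k 2) auto
        also have "\<dots> = b ^ (s * t) * 12 ^ t * (x powr real s * x powr (y * real (s * t)) * x powr (- real t))" by (simp only: mult_ac)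
        also have "x powr real s * x powr (y * real (s * t)) * x powr (- real t) = x powr (real s - real t + y * (s * t))"
          unfolding powr_add[symmetric] by (rule arg_cong[of _ _ "(powr) x"]) simp
        finally have A3: "s * (real N ^ s * \<Lambda> ^ (s * t) * (2 / real N) ^ t) \<le> s * (b ^ (s * t) * 12 ^ t * x powr (real s - real t + y * (s * t)))"
          by (rule mult_left_mono) simp
        have A2: "real N ^ s * 4 ^ t + s * real N ^ s * \<Lambda> ^ (s * t) * (2 / real N) ^ t
            \<le> (4 ^ t + s * b ^ (s * t) * 12 ^ t) * x powr (real s - real t + y * (s * t))"
          unfolding distrib_right using add_mono[OF A1 A3] by (simp only: mult_ac)
        have "\<Lambda> ^ (s - 1) * p ^ (s * t) * (real N ^ s * 4 ^ t + s * real N ^ s * \<Lambda> ^ (s * t) * (2 / real N) ^ t)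
          \<le> b ^ (s - 1) * x powr (y * real (s - 1)) * x powr ((\<kappa> + y - 1 / q) * real (s * t)) * ((4 ^ t + s * b ^ (s * t) * 12 ^ t) * x powr (real s - real t + y * (s * t)))"
          unfolding pk using \<Lambda> b0 by (intro mult_mono \<Lambda>k A2 order_refl) auto
        also have "\<dots> = B * (x powr (y * real (s - 1)) * x powr ((\<kappa> + y - 1 / q) * real (s * t)) * x powr (real s - real t + y * (s * t)))"
          unfolding B_def by (simp only: mult_ac)
        also have "x powr (y * real (s - 1)) * x powr ((\<kappa> + y - 1 / q) * real (s * t)) * x powr (real s - real t + y * (s * t)) = x powr e2"
          unfolding powr_add[symmetric] by (rule arg_cong[of _ _ "(powr) x"]) (use s in \<open>simp add: e2_def of_nat_diff\<close>)
        finally show ?thesis .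
      qed
      also have "\<dots> \<le> c1 / 4 * x powr (2 * \<kappa> + 3 - y - 2 / q)" using elim(1) by (simp add: x_def)
      also have "x powr (2 * \<kappa> + 3 - y - 2 / q) = x powr (2 * \<kappa>) * (x powr (2 - y) * x powr (1 - 2 / q))"
        unfolding powr_add[symmetric] by (rule arg_cong[of _ _ "(powr) x"]) simp
      also have "c1 / 4 * (x powr (2 * \<kappa>) * (x powr (2 - y) * x powr (1 - 2 / q)))
          = c1 / 2 * x powr (2 * \<kappa>) * (x powr (2 - y) / 2 * x powr (1 - 2 / q))" by simp
      also have "\<dots> \<le> c1 / 2 * x powr (2 * \<kappa>) * (D' * x powr (1 - 2 / q))"
        using D'(1) c1 by (intro mult_left_mono mult_right_mono) auto
      finally have "c1 / 2 * x powr (2 * \<kappa>) * (D' * x powr (1 - 2 / q)) \<le> card E"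
        using pos E(5) by simp
      also have "real (card E) \<le> real (ex n (expansion (complete_bipartite s t)))" using f by simp
      finally show "c1 / 2 * real n powr (2 * \<kappa>) * (degree_sum A V * real n powr (1 - 2 / q)) \<le> real (ex n (expansion (complete_bipartite s t)))"
        by (simp add: x_def D'_def)
    qed
  qed
  thus ?thesis by (intro that[of "c1 / 2" "2 * \<kappa>"]) (use c1 \<kappa> in auto)
qed

section \<open>Projective norm graphs in characteristic two\<close>

lemma separable_card_roots:
  fixes p :: "'a :: alg_closed_field poly"
  assumes "p \<noteq> 0" and sep: "\<And>x. poly p x = 0 \<Longrightarrow> poly (pderiv p) x \<noteq> 0"
  shows "card {x. poly p x = 0} = Polynomial.degree p"
proof -
  obtain A where A: "size A = Polynomial.degree p" "p = smult (lead_coeff p) (\<Prod>x\<in>#A. [:-x, 1:])"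
    using alg_closed_imp_factorization[OF assms(1)] by blast
  have root: "poly p x = 0 \<longleftrightarrow> x \<in># A" for x
  proof -
    have "poly p x = lead_coeff p * (\<Prod>y\<in>#A. x - y)"
      by (subst A(2)) (simp add: poly_prod_mset image_mset.compositionality comp_def)
    thus ?thesis using assms(1) by (auto simp: prod_mset_zero_iff)
  qed
  have "count A x \<le> 1" for x
  proof (rule ccontr)
    assume "\<not> count A x \<le> 1"
    then obtain B' where B': "A = add_mset x B'"
      by (metis count_eq_zero_iff multi_member_split zero_le)
    hence "x \<in># B'" using \<open>\<not> count A x \<le> 1\<close> by (simp add: count_eq_zero_iff[symmetric])
    then obtain B where B: "A = add_mset x (add_mset x B)"
      using B' by (metis multi_member_split)
    define r where "r = smult (lead_coeff p) (\<Prod>x\<in>#B. [:-x, 1:])"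
    have p: "p = [:-x,1:] * ([:-x,1:] * r)"
      by (subst A(2)) (simp add: B r_def mult_smult_right)
    have "poly (pderiv p) x = 0" unfolding p pderiv_mult by simp
    moreover have "poly p x = 0" unfolding p by simp
    ultimately show False using sep by blast
  qed
  hence "A = mset_set (set_mset A)"
    by (intro multiset_eqI) (metis count_mset_set' count_eq_zero_iff finite_set_mset le_antisym not_in_iff One_nat_def Suc_leI count_greater_zero_iff)
  hence "card (set_mset A) = size A" by (metis size_mset_set)
  moreover have "{x. poly p x = 0} = set_mset A" using root by auto
  ultimately show ?thesis using A(1) by simp
qed

lemma char2_power_add:
  fixes x y :: "'a :: comm_ring_1"
  assumes "(1::'a) + 1 = 0"
  shows "(x + y) ^ (2 ^ k) = x ^ (2 ^ k) + y ^ (2 ^ k)"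
proof (induction k)
  case (Suc k)
  have sq: "(a + b) ^ 2 = a ^ 2 + b ^ 2" for a b :: 'a
  proof -
    have "(a + b) ^ 2 = a ^ 2 + b ^ 2 + (1 + 1) * (a * b)"
      by (simp add: power2_eq_square algebra_simps)
    thus ?thesis using assms by simp
  qed
  show ?case by (simp add: power_mult mult.commute[of 2] Suc sq)
qed auto

text \<open>In characteristic two the polynomial has derivative \<open>-1\<close>, hence simple
  roots. The field with \<open>2 ^ k\<close> elements thus appears as a subset of an algebraically
  closed field, and no type has to be built for each \<open>k\<close>.\<close>

lemma card_frobenius_fixed:
  assumes "(1::'a::alg_closed_field) + 1 = 0" "k > 0"
  shows "card {x::'a. x ^ (2 ^ k) = x} = 2 ^ k"
proof -
  define p where "p = monom (1::'a) (2^k) - [:0,1:]"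
  have two: "2 ^ k > (1::nat)" using assms(2) one_less_power[of "2::nat" k] by simp
  have deg: "Polynomial.degree p = 2 ^ k"
    unfolding p_def diff_conv_add_uminus using two by (subst degree_add_eq_left) (auto simp: degree_monom_eq)
  have p0: "p \<noteq> 0" using deg two by auto
  have "of_nat (2 ^ k) = (0::'a)" using assms by (metis one_add_one of_nat_numeral of_nat_power zero_power)
  hence "pderiv p = [:-1:]"
    unfolding p_def using assms(2) by (simp add: pderiv_diff pderiv_monom pderiv_pCons zero_power)
  hence "card {x. poly p x = 0} = 2 ^ k" using separable_card_roots[OF p0] deg by simp
  thus ?thesis by (simp add: p_def poly_monom)
qed

text \<open>The bound \<open>3! = 6\<close> for a norm-type system in three unknowns, by
  elimination. With \<open>x = v - b 0\<close>, \<open>y = w - c 0\<close> and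
  \<open>z i = u - a i\<close>, differences of the equations are linear in \<open>x\<close> and
  \<open>y\<close> up to the factor \<open>z 0 * z 1 * z 2\<close>. Solving them gives polynomials
  \<open>V\<close> and \<open>W\<close> in \<open>u\<close> that represent \<open>D * x\<close> and
  \<open>D * y\<close> up to that factor, and \<open>z 0 * x * y = d 0\<close> turns
  \<open>V * W\<close> into a polynomial of degree at most 5 in \<open>u\<close>, whereas
  \<open>V * W\<close> itself has degree 6.\<close>

lemma three_products_card_le:
  fixes a b c d :: "nat \<Rightarrow> 'a :: field"
  assumes d: "d 0 \<noteq> 0" "d 1 \<noteq> 0" "d 2 \<noteq> 0"
    and b: "b 0 \<noteq> b 1" "b 0 \<noteq> b 2" "b 1 \<noteq> b 2" and c: "c 0 \<noteq> c 1" "c 0 \<noteq> c 2" "c 1 \<noteq> c 2"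
  defines "U \<equiv> {u. \<exists>v w. \<forall>i<3. (u - a i) * (v - b i) * (w - c i) = d i}"
  shows "finite U \<and> card U \<le> 6"
proof -
  define A where "A i = [:- a i, 1:]" for i
  define B where "B i = b i - b 0" for i
  define C where "C i = c i - c 0" for i
  have nz: "B 1 \<noteq> 0" "B 2 \<noteq> 0" "C 1 \<noteq> 0" "C 2 \<noteq> 0" "B 1 \<noteq> B 2" "C 1 \<noteq> C 2"
    using b c by (auto simp: B_def C_def)
  define F1 where "F1 = smult (d 1) (A 0 * A 2) - smult (d 0) (A 1 * A 2) - smult (B 1 * C 1) (A 0 * A 1 * A 2)"
  define F2 where "F2 = smult (d 2) (A 0 * A 1) - smult (d 0) (A 1 * A 2) - smult (B 2 * C 2) (A 0 * A 1 * A 2)"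
  define V where "V = smult (B 1) F2 - smult (B 2) F1"
  define W where "W = smult (C 2) F1 - smult (C 1) F2"
  define D where "D = C 1 * B 2 - C 2 * B 1"
  \<comment> \<open>If \<open>D = 0\<close>, the linear system is singular, but then
    \<open>V\<close>, of degree 3, already vanishes at \<open>u\<close>.\<close>
  define P where "P = (if D = 0 then V else smult (D^2 * d 0) (A 0 * A 1^2 * A 2^2) - V * W)"
  have dA: "Polynomial.degree (A i) = 1" "A i \<noteq> 0" for i by (simp_all add: A_def)
  have d3: "Polynomial.degree (A 0 * A 1 * A 2) = 3" by (simp add: degree_mult_eq dA)
  have V: "V = smult (B 1 * d 2) (A 0 * A 1) - smult (B 1 * d 0) (A 1 * A 2) - smult (B 2 * d 1) (A 0 * A 2)
              + smult (B 2 * d 0) (A 1 * A 2) + smult (B 1 * B 2 * (C 1 - C 2)) (A 0 * A 1 * A 2)"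
    unfolding V_def F1_def F2_def by (simp add: smult_diff_right smult_add_right algebra_simps smult_diff_left smult_add_left)
  have W: "W = smult (C 2 * d 1) (A 0 * A 2) - smult (C 2 * d 0) (A 1 * A 2) - smult (C 1 * d 2) (A 0 * A 1)
              + smult (C 1 * d 0) (A 1 * A 2) + smult (C 1 * C 2 * (B 2 - B 1)) (A 0 * A 1 * A 2)"
    unfolding W_def F1_def F2_def by (simp add: smult_diff_right smult_add_right algebra_simps smult_diff_left smult_add_left)
  have low: "Polynomial.degree (smult x (A i * A j)) \<le> 2" for x i j
    by (rule order_trans[OF degree_smult_le]) (simp add: degree_mult_eq dA)
  have deg3: "Polynomial.degree (p1 - p2 - p3 + p4 + smult y (A 0 * A 1 * A 2)) = 3"
    if "y \<noteq> 0" "Polynomial.degree p1 \<le> 2" "Polynomial.degree p2 \<le> 2" "Polynomial.degree p3 \<le> 2" "Polynomial.degree p4 \<le> 2"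
    for y p1 p2 p3 p4
  proof -
    have "Polynomial.degree (p1 - p2 - p3 + p4) \<le> 2"
      by (intro degree_add_le degree_diff_le that)
    moreover have "Polynomial.degree (smult y (A 0 * A 1 * A 2)) = 3"
      using d3 that(1) by simp
    ultimately show ?thesis by (subst degree_add_eq_right) auto
  qed
  have dV: "Polynomial.degree V = 3" unfolding V
    by (rule deg3) (use nz low in \<open>auto simp: mult_eq_0_iff\<close>)
  have dW: "Polynomial.degree W = 3" unfolding W
    by (rule deg3) (use nz low in \<open>auto simp: mult_eq_0_iff\<close>)
  have V0: "V \<noteq> 0" "W \<noteq> 0" using dV dW by auto
  have "Polynomial.degree (A 0 * A 1^2 * A 2^2) = 5"
    by (simp add: degree_mult_eq dA degree_power_eq)
  hence "Polynomial.degree (smult (D^2 * d 0) (A 0 * A 1^2 * A 2^2)) \<le> 5"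
    using degree_smult_le by metis
  hence "Polynomial.degree (smult (D^2 * d 0) (A 0 * A 1^2 * A 2^2) - V * W) = 6"
    using V0 dV dW unfolding diff_conv_add_uminus by (subst degree_add_eq_right) (auto simp: degree_mult_eq)
  hence P: "P \<noteq> 0" "Polynomial.degree P \<le> 6" using V0 dV by (auto simp: P_def)
  have "U \<subseteq> {u. poly P u = 0}"
  proof
    fix u assume "u \<in> U"
    then obtain v w where vw: "\<And>i. i < 3 \<Longrightarrow> (u - a i) * (v - b i) * (w - c i) = d i"
      unfolding U_def by auto
    define x where "x = v - b 0"
    define y where "y = w - c 0"
    define z where "z i = u - a i" for i
    have e0: "z 0 * (x * y) = d 0" using vw[of 0] by (simp add: x_def y_def z_def algebra_simps)
    have e1: "z 1 * ((x - B 1) * (y - C 1)) = d 1" using vw[of 1] by (simp add: x_def y_def z_def B_def C_def algebra_simps)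
    have e2: "z 2 * ((x - B 2) * (y - C 2)) = d 2" using vw[of 2] by (simp add: x_def y_def z_def B_def C_def algebra_simps)
    have pA: "poly (A i) u = z i" for i by (simp add: A_def z_def)
    have f1: "poly F1 u = - (z 0 * z 1 * z 2) * (C 1 * x + B 1 * y)"
      unfolding F1_def by (simp add: pA flip: e0 e1[unfolded One_nat_def]) (simp add: algebra_simps)
    have f2: "poly F2 u = - (z 0 * z 1 * z 2) * (C 2 * x + B 2 * y)"
      unfolding F2_def by (simp add: pA flip: e0 e2) (simp add: algebra_simps)
    have v: "poly V u = (z 0 * z 1 * z 2) * (D * x)"
      unfolding V_def D_def by (simp add: f1 f2) (simp add: algebra_simps)
    have w: "poly W u = (z 0 * z 1 * z 2) * (D * y)"
      unfolding W_def D_def by (simp add: f1 f2) (simp add: algebra_simps)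
    show "u \<in> {u. poly P u = 0}"
      by (simp add: P_def v w pA flip: e0) (simp add: power2_eq_square)
  qed
  moreover have "finite {u. poly P u = 0}" "card {u. poly P u = 0} \<le> 6"
    using P poly_roots_finite card_poly_roots_bound order_trans by blast+
  ultimately show ?thesis by (meson card_mono finite_subset order_trans)
qed

text \<open>On the solutions of \<open>x ^ 2 ^ (3 * k) = x\<close>, the field with \<open>2 ^ (3 * k)\<close> elements, this is the norm
  to the subfield with \<open>2 ^ k\<close> elements.\<close>

definition frob_norm :: "nat \<Rightarrow> 'a::comm_ring_1 \<Rightarrow> 'a" where
  "frob_norm k x = x * x ^ (2 ^ k) * (x ^ (2 ^ k)) ^ (2 ^ k)"

text \<open>Adjacency in the projective norm graph, where \<open>+\<close> is also subtraction in
  characteristic two. The coordinates range over the whole field here; they are confined to the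
  finite fields only in \<open>norm_triangles\<close>.\<close>

definition norm_adj :: "nat \<Rightarrow> ('a::field \<times> 'a) \<Rightarrow> ('a \<times> 'a) \<Rightarrow> bool" where
  "norm_adj k p r \<longleftrightarrow> fst p \<noteq> fst r \<and> snd p \<noteq> 0 \<and> snd r \<noteq> 0 \<and> frob_norm k (fst p + fst r) = snd p * snd r"

text \<open>Dividing three of the adjacency equations by the fourth, at \<open>r\<close>, eliminates
  \<open>snd p\<close>. In terms of \<open>1 / (fst p + fst r)\<close> they say that the norm of
  this element plus a constant \<open>cc i\<close> is \<open>dd i\<close>. Its conjugates are then
  treated as three independent unknowns, to which \<open>three_products_card_le\<close>
  applies.\<close>

lemma norm_adj_common_neighbours:
  fixes S :: "('a::field \<times> 'a) set"
  assumes two: "(1::'a) + 1 = 0" and S: "card S = 4"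
  shows "finite {p. \<forall>r\<in>S. norm_adj k p r} \<and> card {p. \<forall>r\<in>S. norm_adj k p r} \<le> 6"
proof (cases "{p. \<forall>r\<in>S. norm_adj k p r} = {}")
  case False
  then obtain p0 where p0: "\<And>r. r \<in> S \<Longrightarrow> norm_adj k p0 r" by auto
  have add: "(x + y) ^ (2^k) = x ^ (2^k) + y ^ (2^k)" for x y :: 'a
    using char2_power_add[OF two] .
  have neg: "- x = x" for x :: 'a
  proof -
    have "x + x = (1 + 1) * x" by (simp only: distrib_right mult_1_left)
    thus ?thesis using two by (simp add: add_eq_0_iff2 eq_neg_iff_add_eq_0 neg_eq_iff_add_eq_0)
  qed
  have inj: "x = y" if "x ^ (2^k) = y ^ (2^k)" for x y :: 'a
  proof -
    have "(x + y) ^ (2^k) = 0" using that neg add by (metis add.right_inverse)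
    hence "x + y = 0" by simp
    thus ?thesis using neg by (metis add_eq_0_iff)
  qed
  have normdiv: "frob_norm k (x / y) = frob_norm k x / frob_norm k y" for x y :: 'a
    by (simp add: frob_norm_def power_divide)
  have norm0: "frob_norm k x = 0 \<longleftrightarrow> x = 0" for x :: 'a by (simp add: frob_norm_def)
  \<comment> \<open>The common neighbour \<open>p0\<close> forces distinct first coordinates: equal
    ones would give equal norms and hence equal second coordinates.\<close>
  have fstinj: "r = r'" if "r \<in> S" "r' \<in> S" "fst r = fst r'" for r r'
    using p0[OF that(1)] p0[OF that(2)] that(3) by (auto simp: norm_adj_def intro!: prod_eqI)
  have finS: "finite S" using S card.infinite by fastforce
  obtain f where f: "bij_betw f {..<4::nat} S"
    using ex_bij_betw_nat_finite[OF finS] S by (metis atLeast0LessThan)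
  have fS: "f i \<in> S" if "i < 4" for i using f that bij_betwE by blast
  have ffne: "fst (f i) \<noteq> fst (f j)" if "i < 4" "j < 4" "i \<noteq> j" for i j
    using fstinj[OF fS fS, of i j] that f by (auto simp: bij_betw_def inj_on_def)
  define r where "r = f 3"
  have rS: "r \<in> S" using fS by (simp add: r_def)
  define cc where "cc i = 1 / (fst (f i) + fst r)" for i
  have nz: "fst (f i) + fst r \<noteq> 0" if "i < 3" for i
    using ffne[of i 3] that neg by (auto simp: r_def add_eq_0_iff2)
  have ccne: "cc i \<noteq> cc j" if "i < 3" "j < 3" "i \<noteq> j" for i j
    using ffne[of i j] nz[of i] nz[of j] that by (auto simp: cc_def field_simps)
  define dd where "dd i = snd (f i) / (snd r * frob_norm k (fst (f i) + fst r))" for i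
  have snz: "snd (f i) \<noteq> 0" if "i < 4" for i using p0[OF fS[OF that]] by (simp add: norm_adj_def)
  have ddne: "dd i \<noteq> 0" if "i < 3" for i
    using snz[of i] snz[of 3] nz[OF that] that by (simp add: dd_def norm0 r_def)
  define U where "U = {u. \<exists>v w. \<forall>i<3. (u - (- cc i)) * (v - (- (cc i ^ (2^k)))) * (w - (- ((cc i ^ (2^k)) ^ (2^k)))) = dd i}"
  have U: "finite U \<and> card U \<le> 6"
    unfolding U_def
  proof (rule three_products_card_le[where a = "\<lambda>i. - cc i" and b = "\<lambda>i. - (cc i ^ (2^k))"
        and c = "\<lambda>i. - ((cc i ^ (2^k)) ^ (2^k))" and d = dd])
    show "dd 0 \<noteq> 0" "dd 1 \<noteq> 0" "dd 2 \<noteq> 0" using ddne by simp_all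
    have ne: "cc 0 \<noteq> cc 1" "cc 0 \<noteq> cc 2" "cc 1 \<noteq> cc 2" using ccne by simp_all
    show "- (cc 0 ^ (2^k)) \<noteq> - (cc 1 ^ (2^k))" "- (cc 0 ^ (2^k)) \<noteq> - (cc 2 ^ (2^k))"
      "- (cc 1 ^ (2^k)) \<noteq> - (cc 2 ^ (2^k))"
      "- ((cc 0 ^ (2^k)) ^ (2^k)) \<noteq> - ((cc 1 ^ (2^k)) ^ (2^k))"
      "- ((cc 0 ^ (2^k)) ^ (2^k)) \<noteq> - ((cc 2 ^ (2^k)) ^ (2^k))"
      "- ((cc 1 ^ (2^k)) ^ (2^k)) \<noteq> - ((cc 2 ^ (2^k)) ^ (2^k))"
      using ne inj neg_equal_iff_equal by metis+
  qed
  define g where "g p = 1 / (fst p + fst r)" for p :: "'a \<times> 'a"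
  let ?T = "{p. \<forall>r\<in>S. norm_adj k p r}"
  have T: "fst p + fst r \<noteq> 0" if "p \<in> ?T" for p
    using that rS neg by (auto simp: norm_adj_def add_eq_0_iff2)
  have injg: "inj_on g ?T"
  proof
    fix p p' assume pp: "p \<in> ?T" "p' \<in> ?T" "g p = g p'"
    hence "fst p = fst p'" using T[OF pp(1)] T[OF pp(2)] by (simp add: g_def field_simps)
    moreover have "snd p * snd r = frob_norm k (fst p + fst r)" "snd p' * snd r = frob_norm k (fst p' + fst r)"
      "snd r \<noteq> 0" using pp(1,2) rS by (auto simp: norm_adj_def)
    ultimately show "p = p'" by (metis mult_cancel_right prod_eqI)
  qed
  have gU: "g p \<in> U" if pT: "p \<in> ?T" for p
  proof -
    obtain X x where Xx: "p = (X, x)" by (cases p)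
    have p: "\<forall>r\<in>S. norm_adj k (X,x) r" using pT Xx by simp
    let ?Y = "g (X,x)"
    have XR: "X + fst r \<noteq> 0" using T[of "(X,x)"] p by simp
    have "frob_norm k (?Y + cc i) = dd i" if i: "i < 3" for i
    proof -
      have "fst r + (X + fst r) = X" using neg[of "fst r"] by (metis add.commute add.left_commute add.left_inverse add.right_neutral)
      hence "fst (f i) + fst r + (X + fst r) = X + fst (f i)" by (simp add: add.assoc add.commute)
      moreover have "?Y + cc i = (fst (f i) + fst r + (X + fst r)) / ((X + fst r) * (fst (f i) + fst r))"
        using XR nz[OF i] by (simp add: g_def cc_def add_frac_eq algebra_simps)
      ultimately have "?Y + cc i = (X + fst (f i)) / (X + fst r) / (fst (f i) + fst r)" by simp
      hence "frob_norm k (?Y + cc i) = frob_norm k (X + fst (f i)) / frob_norm k (X + fst r) / frob_norm k (fst (f i) + fst r)"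
        by (simp only: normdiv)
      moreover have "frob_norm k (X + fst (f i)) = x * snd (f i)" "frob_norm k (X + fst r) = x * snd r" "x \<noteq> 0"
        using p fS[of i] rS i by (auto simp: norm_adj_def)
      ultimately show ?thesis by (simp add: dd_def)
    qed
    thus "g p \<in> U" unfolding U_def Xx
      by (intro CollectI exI[of _ "?Y ^ (2^k)"] exI[of _ "(?Y ^ (2^k)) ^ (2^k)"]) (simp add: frob_norm_def add)
  qed
  hence sub: "g ` ?T \<subseteq> U" by blast
  show ?thesis
    using card_inj_on_le[OF injg sub] inj_on_finite[OF injg sub] U by linarith
next
  case True
  show ?thesis unfolding True by simp
qed


text \<open>Every 3-subset of \<open>F\<close> lifts to a triangle: its second coordinates have to
  satisfy \<open>a * b = u\<close>, \<open>a * c = v\<close>, \<open>b * c = w\<close>, so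
  \<open>a\<close> must be a square root of \<open>u * v / w\<close>. Characteristic two is chosen
  because every element of \<open>K\<close> then has a square root in \<open>K\<close>.\<close>

lemma norm_triangles:
  assumes two: "(1::'a::alg_closed_field) + 1 = 0" and k: "k > 0"
  obtains E :: "('a::alg_closed_field \<times> 'a) set set"
  where "finite (\<Union>E)" "card (\<Union>E) \<le> (2 ^ k) ^ 4" "\<And>e. e \<in> E \<Longrightarrow> card e = 3"
    "(2 ^ (3 * k)) choose 3 \<le> card E"
    "\<And>e p r. e \<in> E \<Longrightarrow> p \<in> e \<Longrightarrow> r \<in> e \<Longrightarrow> p \<noteq> r \<Longrightarrow> norm_adj k p r"
proof -
  define F where "F = {x::'a. x ^ (2 ^ (3 * k)) = x}"
  define K where "K = {x::'a. x ^ (2 ^ k) = x}"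
  define E where "E = {e. e \<subseteq> F \<times> K \<and> card e = 3 \<and> (\<forall>p\<in>e. \<forall>r\<in>e. p \<noteq> r \<longrightarrow> norm_adj k p r)}"
  have cF: "card F = 2 ^ (3 * k)" and cK: "card K = 2 ^ k"
    unfolding F_def K_def using k by (intro card_frobenius_fixed[OF two]; simp)+
  have fin: "finite F" "finite K" using cF cK by (auto intro: card_ge_0_finite)
  have finE: "finite E" by (rule finite_subset[of _ "Pow (F \<times> K)"]) (auto simp: E_def fin)
  have UE: "\<Union>E \<subseteq> F \<times> K" by (auto simp: E_def)
  have addF: "x + y \<in> F" if "x \<in> F" "y \<in> F" for x y
    using that char2_power_add[OF two] by (simp add: F_def)
  have normK: "frob_norm k x \<in> K" if "x \<in> F" for x
  proof -
    have "((x ^ (2 ^ k)) ^ (2 ^ k)) ^ (2 ^ k) = x ^ (2 ^ (3 * k))"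
      by (simp add: power_mult[symmetric] power_add[symmetric] numeral_3_eq_3 add.assoc)
    also have "\<dots> = x" using that by (simp add: F_def)
    finally show ?thesis by (simp add: K_def frob_norm_def power_mult_distrib mult_ac)
  qed
  have norm0: "frob_norm k x \<noteq> 0" if "x \<noteq> 0" for x :: 'a using that by (simp add: frob_norm_def)
  have neg: "x + y \<noteq> 0" if "x \<noteq> y" for x y :: 'a
  proof
    assume "x + y = 0"
    moreover have "y + y = (1 + 1) * y" by (simp only: distrib_right mult_1_left)
    ultimately show False using two that by (simp add: add_eq_0_iff2)
  qed
  have "{T. T \<subseteq> F \<and> card T = 3} \<subseteq> (\<lambda>e. fst ` e) ` E"
  proof clarify
    fix T assume T: "T \<subseteq> F" "card T = 3"
    then obtain A B C where ABC: "T = {A,B,C}" "A \<noteq> B" "A \<noteq> C" "B \<noteq> C"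
      by (auto simp: card_3_iff)
    have inF: "A \<in> F" "B \<in> F" "C \<in> F" using T ABC by auto
    define u where "u = frob_norm k (A + B)"
    define v where "v = frob_norm k (A + C)"
    define w where "w = frob_norm k (B + C)"
    have nz: "u \<noteq> 0" "v \<noteq> 0" "w \<noteq> 0" using ABC by (auto simp: u_def v_def w_def intro!: norm0 neg)
    have uvw: "u \<in> K" "v \<in> K" "w \<in> K" using inF by (auto simp: u_def v_def w_def intro!: normK addF)
    \<comment> \<open>The square root: the \<open>2 ^ k\<close>-th power is the identity on
      \<open>K\<close>, so the power \<open>2 ^ (k - 1)\<close> inverts squaring.\<close>
    define a where "a = (u * v / w) ^ (2 ^ (k - 1))"
    have a0: "a \<noteq> 0" using nz by (simp add: a_def)
    have "a ^ 2 = (u * v / w) ^ (2 ^ k)"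
      unfolding a_def using k by (simp add: power_mult[symmetric] power_Suc2[symmetric] del: power_Suc)
    also have "\<dots> = u * v / w" using uvw by (simp add: K_def power_mult_distrib power_divide)
    finally have a2: "a * a * w = u * v" using nz by (simp add: power2_eq_square field_simps)
    have aK: "a \<in> K"
    proof -
      have "(y ^ (2 ^ (k - 1))) ^ (2 ^ k) = (y ^ (2 ^ k)) ^ (2 ^ (k - 1))" for y :: 'a
        by (metis mult.commute power_mult)
      thus ?thesis using uvw by (simp add: K_def a_def power_mult_distrib power_divide)
    qed
    have K3: "(A, a) \<in> F \<times> K" "(B, u / a) \<in> F \<times> K" "(C, v / a) \<in> F \<times> K"
      using inF aK uvw by (auto simp: K_def power_divide)
    have adj: "norm_adj k (A, a) (B, u / a)" "norm_adj k (A, a) (C, v / a)" "norm_adj k (B, u / a) (C, v / a)"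
      using ABC nz a0 a2 by (auto simp: norm_adj_def u_def[symmetric] v_def[symmetric] w_def[symmetric] field_simps)
    have sym: "norm_adj k r p" if "norm_adj k p r" for p r :: "'a \<times> 'a"
      using that by (auto simp: norm_adj_def add.commute mult.commute)
    have "{(A, a), (B, u / a), (C, v / a)} \<in> E"
      unfolding E_def using K3 adj sym[OF adj(1)] sym[OF adj(2)] sym[OF adj(3)] ABC by auto
    moreover have "T = fst ` {(A, a), (B, u / a), (C, v / a)}" using ABC by simp
    ultimately show "T \<in> (\<lambda>e. fst ` e) ` E" by blast
  qed
  hence "card {T. T \<subseteq> F \<and> card T = 3} \<le> card E" by (rule surj_card_le[OF finE])
  hence "(2 ^ (3 * k)) choose 3 \<le> card E" using n_subsets[OF fin(1), of 3] cF by simp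
  moreover have "card (\<Union>E) \<le> (2 ^ k) ^ 4"
  proof -
    have "card (\<Union>E) \<le> card (F \<times> K)" using UE fin by (intro card_mono) auto
    thus ?thesis by (simp add: card_cartesian_product cF cK power_add[symmetric] power_mult[symmetric] mult.commute)
  qed
  moreover have "finite (\<Union>E)" using UE fin by (meson finite_SigmaI finite_subset)
  ultimately show ?thesis by (intro that[of E]) (simp_all add: E_def)
qed

section \<open>Comparison of the bounds\<close>

text \<open>For \<open>16 ^ k \<le> n < 16 ^ (k + 1)\<close> there are about
  \<open>2 ^ (9 * k) = (16 ^ k) powr (9 / 4)\<close> triangles on at most \<open>16 ^ k\<close>
  vertices. In \<open>c\<close>, the factor \<open>27\<close> comes from the binomial coefficient
  and \<open>16 powr (9 / 4)\<close> from rounding \<open>n\<close> down to a power of 16.\<close>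

lemma ex_ge_norm_graph:
  assumes two: "(1 :: 'a :: alg_closed_field) + 1 = 0" and t: "t \<ge> 7"
  obtains c where "c > 0" "\<forall>\<^sub>F n in sequentially. c * real n powr (9 / 4) \<le> real (ex n (expansion (complete_bipartite 4 t)))"
proof -
  define c where "c = 1 / (27 * 16 powr (9 / 4) :: real)"
  have "\<forall>\<^sub>F n in sequentially. n \<ge> (16::nat)" by (rule eventually_ge_at_top)
  hence "\<forall>\<^sub>F n in sequentially. c * real n powr (9 / 4) \<le> real (ex n (expansion (complete_bipartite 4 t)))"
  proof eventually_elim
    case (elim n)
    obtain k where k: "16 ^ k \<le> n" "n < 16 ^ (k + 1)" using ex_power_ivl1[of 16 n] elim by auto
    have k0: "k > 0" using k(2) elim by (cases k) auto
    obtain E :: "('a \<times> 'a) set set" where E: "finite (\<Union>E)" "card (\<Union>E) \<le> (2 ^ k) ^ 4" "\<And>e. e \<in> E \<Longrightarrow> card e = 3"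
      "(2 ^ (3 * k)) choose 3 \<le> card E"
      "\<And>e p r. e \<in> E \<Longrightarrow> p \<in> e \<Longrightarrow> r \<in> e \<Longrightarrow> p \<noteq> r \<Longrightarrow> norm_adj k p r"
      by (rule norm_triangles[OF two k0]) (rule that; assumption)
    define A :: "'a \<times> 'a \<Rightarrow> 'a \<times> 'a \<Rightarrow> bool" where "A x y = norm_adj k y x" for x y
    have "kst_free 4 t A"
      unfolding kst_free_def
    proof (intro allI impI notI)
      fix S T :: "('a \<times> 'a) set"
      assume S: "card S = 4" "finite T" "card T = t" and all: "\<forall>x\<in>S. \<forall>y\<in>T. A x y"
      note cn = norm_adj_common_neighbours[OF two S(1), of k]
      have "T \<subseteq> {p. \<forall>r\<in>S. norm_adj k p r}" using all by (auto simp: A_def)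
      hence "card T \<le> card {p. \<forall>r\<in>S. norm_adj k p r}" using cn by (intro card_mono) auto
      thus False using cn S(3) t by linarith
    qed
    hence free: "\<not> kst_copy 4 t E"
      by (rule kst_free_imp_not_kst_copy) (use E(5) in \<open>auto simp: A_def\<close>)
    have "(2 ^ k) ^ 4 = ((2::nat) ^ 4) ^ k" by (simp only: power_mult[symmetric] mult.commute)
    hence "(2 ^ k) ^ 4 = (16::nat) ^ k" by simp
    hence "card (\<Union>E) \<le> n" using E(2) k(1) by linarith
    hence f: "card E \<le> ex n (expansion (complete_bipartite 4 t))"
      by (intro card_le_ex E free) (use t in auto)
    have "3 \<le> (2::nat) ^ (3 * k)"
    proof -
      have "(2::nat) ^ 3 \<le> 2 ^ (3 * k)" using k0 by (intro power_increasing) auto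
      thus ?thesis by simp
    qed
    hence "(real (2 ^ (3 * k)) / 3) ^ 3 \<le> real ((2 ^ (3 * k)) choose 3)"
      using binomial_ge_n_over_k_pow_k[of 3 "2 ^ (3 * k)", where 'a = real] by simp
    also have "\<dots> \<le> real (card E)" using E(4) by (rule of_nat_mono)
    finally have 1: "(real (2 ^ (3 * k)) / 3) ^ 3 \<le> real (card E)" .
    have "real n powr (9 / 4) \<le> (16 * 16 ^ k) powr (9 / 4)"
    proof (rule powr_mono2)
      have "real n \<le> real (16 ^ (k + 1))" using k(2) by (intro of_nat_mono) simp
      thus "real n \<le> 16 * 16 ^ k" by simp
    qed auto
    also have "\<dots> = 16 powr (9 / 4) * (16 ^ k) powr (9 / 4)" by (simp add: powr_mult)
    also have "(16 ^ k :: real) powr (9 / 4) = real (2 ^ (3 * k)) ^ 3"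
    proof -
      have "(16::real) ^ k = 2 powr (4 * real k)" by (simp add: powr_realpow[symmetric] powr_powr[symmetric])
      hence "(16 ^ k :: real) powr (9 / 4) = 2 powr (4 * real k * (9 / 4))" by (simp add: powr_powr)
      also have "4 * real k * (9 / 4) = real (3 * k * 3)" by simp
      also have "(2::real) powr real (3 * k * 3) = 2 ^ (3 * k * 3)" by (rule powr_realpow) simp
      finally show ?thesis by (simp only: power_mult of_nat_power of_nat_numeral)
    qed
    finally have "real n powr (9 / 4) \<le> 16 powr (9 / 4) * real (2 ^ (3 * k)) ^ 3" .
    hence "c * real n powr (9 / 4) \<le> c * (16 powr (9 / 4) * real (2 ^ (3 * k)) ^ 3)"
      by (rule mult_left_mono) (simp add: c_def)
    also have "\<dots> = (real (2 ^ (3 * k)) / 3) ^ 3" by (simp add: c_def power_divide)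
    also note 1
    also have "real (card E) \<le> real (ex n (expansion (complete_bipartite 4 t)))" using f by simp
    finally show ?case .
  qed
  thus ?thesis by (intro that[of c]) (auto simp: c_def)
qed

lemma eventually_alpha_beta_boundedI:
  assumes "\<forall>\<^sub>F n in sequentially. \<forall>H :: nat hypergraph. three_graph H \<longrightarrow> card (verts H) = n \<longrightarrow>
     real (max_degree H) \<ge> \<alpha> * real ((n - 1) choose 2) \<longrightarrow>
     real (card (edges H)) \<ge> (1 - \<beta>) * real (ex n F) \<longrightarrow> contains_copy H F"
  shows "alpha_beta_bounded \<alpha> \<beta> F"
  using assms unfolding alpha_beta_bounded_def eventually_sequentially by blast

text \<open>The comparison of exponents is \<open>7 / 4 + 1 / 3 = 25 / 12 < 9 / 4\<close>.\<close>

lemma bounded_K4t_expansion: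
  assumes two: "(1 :: 'a :: alg_closed_field) + 1 = 0" and t: "t \<ge> 7"
  shows "alpha_beta_bounded (15 / 16) (1 / 4) (expansion (complete_bipartite 4 t))"
proof (rule eventually_alpha_beta_boundedI)
  let ?F = "expansion (complete_bipartite 4 t)"
  obtain C N0 where C: "C > 0" and hd: "\<And>n H :: nat hypergraph. n \<ge> N0 \<Longrightarrow> three_graph H \<Longrightarrow> card (verts H) = n \<Longrightarrow>
        15 / 16 * real ((n - 1) choose 2) \<le> real (max_degree H) \<Longrightarrow>
        3 / 4 * real (ex n ?F) \<le> real (card (edges H)) \<Longrightarrow> \<not> contains_copy H ?F \<Longrightarrow>
      \<exists>A V U. shadow_host 4 t C n A V U"
    by (rule high_degree_asymptotics[of 4 t]) (use t in \<open>simp, simp, blast\<close>)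
  obtain c where c: "c > 0" and lb: "\<forall>\<^sub>F n in sequentially. c * real n powr (9 / 4) \<le> real (ex n ?F)"
    by (rule ex_ge_norm_graph[OF two t])
  have "\<forall>\<^sub>F n in sequentially. C * real n powr 2 \<le> c / 4 * real n powr (9 / 4)"
    by (rule powr_eventually_le) (use c in auto)
  moreover have "\<forall>\<^sub>F n in sequentially. C * C * real n powr (25 / 12) \<le> c / 4 * real n powr (9 / 4)"
    by (rule powr_eventually_le) (use c in auto)
  moreover have "\<forall>\<^sub>F n in sequentially. n \<ge> max 1 N0" by (rule eventually_ge_at_top)
  ultimately show "\<forall>\<^sub>F n in sequentially. \<forall>H :: nat hypergraph. three_graph H \<longrightarrow> card (verts H) = n \<longrightarrow>
     real (max_degree H) \<ge> 15 / 16 * real ((n - 1) choose 2) \<longrightarrow>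
     real (card (edges H)) \<ge> (1 - 1 / 4) * real (ex n ?F) \<longrightarrow> contains_copy H ?F"
    using lb
  proof eventually_elim
    case (elim n)
    show ?case
    proof (intro allI impI, rule ccontr)
      fix H :: "nat hypergraph"
      assume H: "three_graph H" "card (verts H) = n" "real (max_degree H) \<ge> 15 / 16 * real ((n - 1) choose 2)"
        "real (card (edges H)) \<ge> (1 - 1 / 4) * real (ex n ?F)" "\<not> contains_copy H ?F"
      have n: "n \<ge> N0" "real n \<ge> 1" using elim(3) by auto
      obtain A and V :: "nat set" where A: "real (ex n ?F) \<le> C * ((real n)\<^sup>2 + degree_sum A V * real n powr (1 / 3))"
        "degree_sum A V \<le> C * real n powr (7 / 4)"
        using hd[OF n(1) H(1,2,3) _ H(5)] H(4) by (auto simp: shadow_host_def)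
      have "degree_sum A V * real n powr (1 / 3) \<le> C * real n powr (7 / 4) * real n powr (1 / 3)"
        using A(2) by (rule mult_right_mono) simp
      also have "\<dots> = C * real n powr (25 / 12)" by (simp add: powr_add[symmetric])
      finally have "C * (degree_sum A V * real n powr (1 / 3)) \<le> C * (C * real n powr (25 / 12))"
        using C by (intro mult_left_mono) auto
      moreover have "(real n)\<^sup>2 = real n powr 2" using n by simp
      ultimately have "real (ex n ?F) \<le> C * real n powr 2 + C * C * real n powr (25 / 12)"
        using A(1) by (simp add: distrib_left)
      hence "c * real n powr (9 / 4) \<le> c / 2 * real n powr (9 / 4)" using elim by linarith
      moreover have "0 < c * real n powr (9 / 4)" using c n by simp
      ultimately show False by simp
    qed
  qed
qed

lemma bounded_Kst_expansion:
  fixes s t :: nat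
  assumes s: "s \<ge> 5" and t: "real t > 3 / 2 * (real s)\<^sup>2 - 21 / 4 * real s + 57 / 8"
  shows "alpha_beta_bounded (15 / 16) (1 / 4) (expansion (complete_bipartite s t))"
proof (rule eventually_alpha_beta_boundedI)
  let ?F = "expansion (complete_bipartite s t)"
  define q where "q = real s - 1"
  define \<mu> where "\<mu> = (real s + real t - 2) / (real s * real t - 1)"
  have s5: "real s \<ge> 5" using s by simp
  have q: "q \<ge> 4" "real (s - 1) = q" using s by (auto simp: q_def of_nat_diff)
  obtain y where y: "1 / real s < y" "y < 1 / q" "3 * \<mu> - 2 / q < y"
      "y * (2 * real s * real t + real s) < 3 - 2 / q - real s + real t + real s * real t / q" and \<mu>: "\<mu> < 1 / 4"
    by (rule exponent_choice[OF s5 t]) (auto simp: q_def \<mu>_def)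
  have t2: "t \<ge> 2"
  proof -
    have "5 * real s \<le> real s * real s" using s5 by (intro mult_right_mono) auto
    hence "real t > 2" using t s5 unfolding power2_eq_square by linarith
    thus ?thesis by simp
  qed
  have st: "s \<ge> 3" "s \<ge> 2" "t > 0" using s t2 by auto
  obtain C N0 where C: "C > 0" and hd: "\<And>n H :: nat hypergraph. n \<ge> N0 \<Longrightarrow> three_graph H \<Longrightarrow> card (verts H) = n \<Longrightarrow>
        15 / 16 * real ((n - 1) choose 2) \<le> real (max_degree H) \<Longrightarrow>
        3 / 4 * real (ex n ?F) \<le> real (card (edges H)) \<Longrightarrow> \<not> contains_copy H ?F \<Longrightarrow>
      \<exists>A V U. shadow_host s t C n A V U"
    by (rule high_degree_asymptotics[OF st(1,3)]) blast
  obtain c where c: "c > 0" and lb: "\<forall>\<^sub>F n in sequentially. c * real n powr (3 - 3 * \<mu>) \<le> real (ex n ?F)"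
    by (rule ex_ge_random_deletion[OF st(2) t2, folded \<mu>_def]) (use \<mu> in auto)
  obtain d \<kappa> where d: "d > 0" "\<kappa> > 0" and lb2:
    "\<forall>\<^sub>F n in sequentially. \<forall>A (V :: nat set). finite V \<longrightarrow> card V = n div 3 \<longrightarrow> (\<forall>x y. A x y \<longrightarrow> A y x) \<longrightarrow> (\<forall>x. \<not> A x x) \<longrightarrow>
       kst_free s t A \<longrightarrow> real n powr (2 - y) / 2 \<le> degree_sum A V \<longrightarrow>
       d * real n powr \<kappa> * (degree_sum A V * real n powr (1 - 2 / q)) \<le> real (ex n ?F)"
    by (rule ex_ge_dense_host[OF st(1,3), of y]) (use y in \<open>auto simp: q_def\<close>)
  have "\<forall>\<^sub>F n in sequentially. C * real n powr 2 \<le> c / 4 * real n powr (3 - 3 * \<mu>)"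
    by (rule powr_eventually_le) (use c \<mu> in auto)
  moreover have "\<forall>\<^sub>F n in sequentially. C * real n powr (2 - y + (1 - 2 / q)) \<le> c / 4 * real n powr (3 - 3 * \<mu>)"
    by (rule powr_eventually_le) (use c y(3) in auto)
  moreover have "\<forall>\<^sub>F n in sequentially. C * real n powr (2 - 1 / q) \<le> 1 / 2 * real n powr (2 - y)"
    by (rule powr_eventually_le) (use y(2) in auto)
  moreover have "\<forall>\<^sub>F n in sequentially. 1 * real n powr 2 \<le> 1 * real n powr (2 - y + (1 - 2 / q))"
  proof (rule powr_eventually_le)
    \<comment> \<open>The quadratic term is negligible as well:
      \<open>y + 2 / q < 3 / q \<le> 3 / 4 < 1\<close>.\<close>
    have "1 / q \<le> 1 / 4" using q by (simp add: field_simps)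
    thus "2 < 2 - y + (1 - 2 / q)" using y(2) by (simp add: field_simps)
  qed simp
  moreover have "\<forall>\<^sub>F n in sequentially. (4 * C + 1) * real n powr 0 \<le> d * real n powr \<kappa>"
    by (rule powr_eventually_le) (use d in auto)
  moreover have "\<forall>\<^sub>F n in sequentially. n \<ge> max 1 N0" by (rule eventually_ge_at_top)
  ultimately show "\<forall>\<^sub>F n in sequentially. \<forall>H :: nat hypergraph. three_graph H \<longrightarrow> card (verts H) = n \<longrightarrow>
     real (max_degree H) \<ge> 15 / 16 * real ((n - 1) choose 2) \<longrightarrow>
     real (card (edges H)) \<ge> (1 - 1 / 4) * real (ex n ?F) \<longrightarrow> contains_copy H ?F"
    using lb lb2
  proof eventually_elim
    case (elim n)
    show ?case
    proof (intro allI impI, rule ccontr)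
      fix H :: "nat hypergraph"
      assume H: "three_graph H" "card (verts H) = n" "real (max_degree H) \<ge> 15 / 16 * real ((n - 1) choose 2)"
        "real (card (edges H)) \<ge> (1 - 1 / 4) * real (ex n ?F)" "\<not> contains_copy H ?F"
      have n: "n \<ge> N0" "real n \<ge> 1" using elim(6) by auto
      have H4: "3 / 4 * real (ex n ?F) \<le> real (card (edges H))" using H(4) by simp
      obtain A and V :: "nat set" and U where V: "finite V" "U \<subseteq> V" "card U = n div 3"
        and sym: "\<forall>x y. A x y \<longrightarrow> A y x" and irr: "\<forall>x. \<not> A x x" and free: "kst_free s t A"
        and A: "real (ex n ?F) \<le> C * ((real n)\<^sup>2 + degree_sum A V * real n powr (1 - 2 / q))"
        and AU: "degree_sum A V \<le> degree_sum A U + C * real n powr (2 - 1 / q)"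
        using hd[OF n(1) H(1,2,3) H4 H(5)] unfolding shadow_host_def q(2) by blast
      define P where "P = real n powr (1 - 2 / q)"
      have P: "P > 0" using n by (simp add: P_def)
      have n2: "(real n)\<^sup>2 = real n powr 2" using n by simp
      have f: "real (ex n ?F) \<le> C * real n powr 2 + C * (degree_sum A V * P)"
        using A unfolding n2 P_def by (simp add: distrib_left)
      show False
      \<comment> \<open>In the sparse case the random lower bound has the larger exponent. In the
        dense case \<open>U\<close> carries at least half of the degree sum, and the upper bound is
        at most \<open>4 * C\<close> times \<open>degree_sum A U * P\<close>, while the tripartite
        host gains a positive power of \<open>n\<close> over the same product.\<close>
      proof (cases "degree_sum A V \<le> real n powr (2 - y)")
        case True
        hence "degree_sum A V * P \<le> real n powr (2 - y) * P" using P by (intro mult_right_mono) auto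
        also have "\<dots> = real n powr (2 - y + (1 - 2 / q))" by (simp only: P_def powr_add)
        finally have "C * (degree_sum A V * P) \<le> C * real n powr (2 - y + (1 - 2 / q))" using C by (intro mult_left_mono) auto
        hence "c * real n powr (3 - 3 * \<mu>) \<le> c / 2 * real n powr (3 - 3 * \<mu>)"
          using f elim(1,2,7) by linarith
        moreover have "0 < c * real n powr (3 - 3 * \<mu>)" using c n by simp
        ultimately show False by simp
      next
        case False
        hence DU: "real n powr (2 - y) / 2 \<le> degree_sum A U" "degree_sum A V \<le> 2 * degree_sum A U"
          using AU elim(3) by linarith+
        have finU: "finite U" using V finite_subset by blast
        have low: "d * real n powr \<kappa> * (degree_sum A U * P) \<le> real (ex n ?F)"
          using elim(8) finU V(3) sym irr free DU(1) unfolding P_def by blast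
        have "real n powr (2 - y) > 0" using n by simp
        hence U0: "degree_sum A U > 0" using DU(1) by linarith
        have "real n powr 2 \<le> real n powr (2 - y) * P" using elim(4) by (simp only: P_def powr_add mult_1)
        also have "\<dots> \<le> 2 * degree_sum A U * P" using DU(1) P by (intro mult_right_mono) auto
        finally have "C * real n powr 2 \<le> C * (2 * degree_sum A U * P)" using C by (intro mult_left_mono) auto
        moreover have "C * (degree_sum A V * P) \<le> C * (2 * degree_sum A U * P)"
          using C P DU(2) by (intro mult_left_mono mult_right_mono) auto
        ultimately have "d * real n powr \<kappa> * (degree_sum A U * P) \<le> 4 * C * (degree_sum A U * P)"
          using f low by simp
        hence "d * real n powr \<kappa> \<le> 4 * C" using U0 P by simp
        thus False using elim(5) n by simp
      qed
    qed
  qed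
qed

text \<open>The algebraic closure of the field with two elements supplies the field for the norm
  graphs.\<close>

lemma bit_alg_closure_one_plus_one: "(1 :: bit alg_closure) + 1 = 0"
proof -
  have "(1 :: bit alg_closure) + 1 = to_ac (1 + 1)" by (simp only: to_ac_add to_ac_1)
  thus ?thesis by simp
qed

theorem theorem1p6:
  fixes s t :: nat
  assumes "s \<ge> 4"
    and "real t > min (3 / 2 * (real s)^2 - 21 / 4 * real s + 57 / 8 + 3 / (8 * (2 * real s - 3)))
                      (fact (s - 1))"
  shows "bounded_three_graph (expansion (complete_bipartite s t))"
proof -
  have "alpha_beta_bounded (15 / 16) (1 / 4) (expansion (complete_bipartite s t))"
  proof (cases "s = 4")
    case True
    \<comment> \<open>For \<open>s = 4\<close> the quadratic expression equals
      \<open>51 / 5\<close>, so the minimum is \<open>3! = 6\<close>, the number of common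
      neighbours allowed in the norm graph.\<close>
    have "real t > 6" using assms(2) by (simp add: True fact_numeral)
    thus ?thesis unfolding True by (intro bounded_K4t_expansion[OF bit_alg_closure_one_plus_one]) simp
  next
    case False
    hence s: "s \<ge> 5" using assms(1) by simp
    have "3 / (8 * (2 * real s - 3)) > 0" using s by simp
    thus ?thesis using assms(2) fact_ge_quadratic[OF s] by (intro bounded_Kst_expansion[OF s]) linarith
  qed
  thus ?thesis unfolding bounded_three_graph_def by (intro exI[of _ "15 / 16"] exI[of _ "1 / 4"]) simp
qed

end
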